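(* Let $V$ be a real vector space of finite dimension $m\ge 3$, and let $s\ge 1$ be an integer. Let $g$ be a $C^s$ (resp. real analytic) pseudo-Riemannian metric on $V$, viewed as a manifold, and let $\mathcal{A}\in\mathfrak{A}(V)$ be a generalized algebraic curvature operator. Identify $T_0V$ with $V$ and let $\langle\cdot,\cdot\rangle:=g_0$ be the inner product that $g$ determines on $V=T_0V$. Then there exists a torsion free $C^s$ (resp. real analytic) connection $\nabla$ on the tangent bundle of some neighborhood $U$ of $0$ in $V$ such that: (1) $\mathcal{R}^\nabla_0=\mathcal{A}$. (2) $\nabla$ has constant scalar curvature, i.e. the function $P\mapsto\tau(\mathcal{R}^\nabla_P,g_P)$ is constant on $U$. (3) If $\mathcal{A}$ is Ricci symmetric, then $\nabla$ is Ricci symmetric. (4) If $\mathcal{A}$ is Ricci antisymmetric, then $\nabla$ is Ricci antisymmetric. (5) If $\mathcal{A}$ is Ricci traceless (with respect to $\langle\cdot,\cdot\rangle$), then $\nabla$ is Ricci traceless (with respect to $g$).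
   Context: For a real vector space $V$, $\mathfrak{A}(V)\subset V^*\otimes V^*\otimes\operatorname{End}(V)$ is the set of generalized algebraic curvature operators, i.e. the tensors $\mathcal{A}$ satisfying $\mathcal{A}(x,y)z=-\mathcal{A}(y,x)z$ and $\mathcal{A}(x,y)z+\mathcal{A}(y,z)x+\mathcal{A}(z,x)y=0$ for all $x,y,z\in V$. The Ricci tensor $\rho(\mathcal{A})\in V^*\otimes V^*$ is $\rho(\mathcal{A})(x,y):=\operatorname{Trace}\{z\mapsto\mathcal{A}(z,x)y\}$; $\rho_a(\mathcal{A})$ and $\rho_s(\mathcal{A})$ denote its antisymmetric and symmetric parts, so $\rho=\rho_a+\rho_s$. Given a non-degenerate symmetric bilinear form $\langle\cdot,\cdot\rangle$ on $V$ (of any signature) and a basis $\{e_i\}$ of $V$, let $g_{ij}=\langle e_i,e_j\rangle$, let $g^{ij}$ be the inverse matrix, and expand $\mathcal{A}(e_i,e_j)e_k=\mathcal{A}_{ijk}{}^\ell e_\ell$ (repeated indices are summed). The scalar curvature and trace free Ricci tensor are $$\tau(\mathcal{A},\langle\cdot,\cdot\rangle):=g^{ij}\mathcal{A}_{kij}{}^k,\qquad \rho_0(\mathcal{A},\langle\cdot,\cdot\rangle):=\rho_s(\mathcal{A})-\tfrac{\tau(\mathcal{A},\langle\cdot,\cdot\rangle)}{m}\langle\cdot,\cdot\rangle .$$ $\mathcal{A}$ is Ricci symmetric if $\rho_a(\mathcal{A})=0$, Ricci antisymmetric if $\rho_s(\mathcal{A})=0$, and Ricci traceless (with respect to $\langle\cdot,\cdot\rangle$)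 if $\rho_0(\mathcal{A},\langle\cdot,\cdot\rangle)=0$. For a torsion free connection $\nabla$, $\mathcal{R}^\nabla_P\in\mathfrak{A}(T_PM)$ denotes its curvature operator at $P$, $\mathcal{R}^\nabla(x,y)=\nabla_x\nabla_y-\nabla_y\nabla_x-\nabla_{[x,y]}$. The connection $\nabla$ is Ricci symmetric (resp. Ricci antisymmetric; resp. Ricci traceless with respect to $g$) if $\mathcal{R}^\nabla_P$ has the corresponding property at every point $P$ of the domain of $\nabla$ (using $g_P$ for the last property). A connection is $C^s$ (resp. real analytic) if its Christoffel symbols in the linear coordinates of $V$ are $C^s$ (resp. real analytic) functions. *)

theory Defs
  imports "HOL-Analysis.Analysis"
begin

text \<open>
  The finite-dimensional real vector space \<open>V\<close> is a type \<^typ>\<open>'a\<close> of class \<^class>\<open>euclidean_space\<close>.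
  The Euclidean inner product of the class serves only to provide the topology, the basis
  \<^const>\<open>Basis\<close> and the coordinates \<open>v \<bullet> i\<close> of a vector with respect to this basis.
  All tangent spaces are identified with \<^typ>\<open>'a\<close>, so that a vector field on an open set \<open>U\<close> is a
  function \<^typ>\<open>'a \<Rightarrow> 'a\<close>, of which only the values on \<open>U\<close> matter.
\<close>

section \<open>Regularity classes\<close>

text \<open>Meant for open sets \<open>U\<close>.\<close>

primrec C_k_on ::
    "nat \<Rightarrow> 'a::euclidean_space set \<Rightarrow> ('a \<Rightarrow> 'b::real_normed_vector) \<Rightarrow> bool" where
  "C_k_on 0 U f \<longleftrightarrow> continuous_on U f"
| "C_k_on (Suc k) U f \<longleftrightarrow>
     (\<forall>P\<in>U. f differentiable (at P)) \<and> (\<forall>v. C_k_on k U (\<lambda>P. frechet_derivative f (at P) v))"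

definition multi_indices :: "('a::euclidean_space \<Rightarrow> nat) set" where
  "multi_indices = {\<alpha>. \<forall>b. b \<notin> Basis \<longrightarrow> \<alpha> b = 0}"

text \<open>
  Real analytic: near every point the function is the sum of an (unconditionally, equivalently
  absolutely) convergent power series in the coordinates.
\<close>

definition real_analytic_on :: "'a::euclidean_space set \<Rightarrow> ('a \<Rightarrow> real) \<Rightarrow> bool" where
  "real_analytic_on U f \<longleftrightarrow>
     (\<forall>P\<in>U. \<exists>r>0. \<exists>c. \<forall>Q\<in>ball P r.
        ((\<lambda>\<alpha>. c \<alpha> * (\<Prod>b\<in>Basis. ((Q - P) \<bullet> b) ^ \<alpha> b)) has_sum f Q) multi_indices)"

section \<open>Inner products and generalized algebraic curvature operators\<close>

definition inner_product_form :: "('a::euclidean_space \<Rightarrow> 'a \<Rightarrow> real) \<Rightarrow> bool" where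
  "inner_product_form h \<longleftrightarrow>
     bilinear h \<and> (\<forall>x y. h x y = h y x) \<and> (\<forall>x. (\<forall>y. h x y = 0) \<longrightarrow> x = 0)"

text \<open>
  \<open>inverse_gram h i j\<close> is the entry \<open>g\<^sup>i\<^sup>j\<close> of the inverse of the matrix \<open>g\<^sub>i\<^sub>j = h i j\<close>, with
  \<open>i\<close> and \<open>j\<close> in \<^const>\<open>Basis\<close>. On these indices the entries are determined uniquely; the others
  are irrelevant.
\<close>

definition is_inverse_gram ::
    "('a::euclidean_space \<Rightarrow> 'a \<Rightarrow> real) \<Rightarrow> ('a \<Rightarrow> 'a \<Rightarrow> real) \<Rightarrow> bool" where
  "is_inverse_gram h k \<longleftrightarrow>
     (\<forall>i\<in>Basis. \<forall>j\<in>Basis.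
        (\<Sum>l\<in>Basis. h i l * k l j) = (if i = j then 1 else 0) \<and>
        (\<Sum>l\<in>Basis. k i l * h l j) = (if i = j then 1 else 0))"

definition inverse_gram :: "('a::euclidean_space \<Rightarrow> 'a \<Rightarrow> real) \<Rightarrow> 'a \<Rightarrow> 'a \<Rightarrow> real" where
  "inverse_gram h = (SOME k. is_inverse_gram h k)"

lemma is_inverse_gram_inverse_gram:
  fixes h :: "'a::euclidean_space \<Rightarrow> 'a \<Rightarrow> real"
  assumes h: "inner_product_form h"
  shows "is_inverse_gram h (inverse_gram h)"
proof -
  have bil: "bilinear h" and sym: "\<And>x y. h x y = h y x"
    and nondeg: "\<And>x. (\<And>y. h x y = 0) \<Longrightarrow> x = 0"
    using h by (auto simp: inner_product_form_def)
  have lin1: "linear (\<lambda>x. h x y)" and lin2: "linear (h x)" for x y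
    using bil by (auto simp: bilinear_def)
  define L where "L x = (\<Sum>j\<in>Basis. h x j *\<^sub>R j)" for x
  have L_comp: "L x \<bullet> j = h x j" if "j \<in> Basis" for x j
    using that by (simp add: L_def)
  have linL: "linear L"
    by (rule linearI)
      (simp_all add: L_def linear_add[OF lin1] linear_scale[OF lin1]
        scaleR_add_left sum.distrib scaleR_sum_right)
  have expand: "h x y = (\<Sum>j\<in>Basis. (y \<bullet> j) * h x j)" for x y
  proof -
    have "h x y = h x (\<Sum>j\<in>Basis. (y \<bullet> j) *\<^sub>R j)"
      by (simp add: euclidean_representation)
    also have "\<dots> = (\<Sum>j\<in>Basis. (y \<bullet> j) * h x j)"
      by (simp only: linear_sum[OF lin2] linear_scale[OF lin2] real_scaleR_def)
    finally show ?thesis .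
  qed
  have "inj L"
    unfolding linear_injective_0[OF linL]
  proof (intro allI impI)
    fix x assume "L x = 0"
    then have "h x j = 0" if "j \<in> Basis" for j
      using L_comp[OF that, of x] by simp
    then have "h x y = 0" for y
      using expand[of x y] by simp
    then show "x = 0" using nondeg by blast
  qed
  then have surj: "surj L"
    using linL linear_injective_imp_surjective by blast
  define M where "M = inv L"
  have LM: "L (M y) = y" for y
    using surj by (simp add: M_def surj_f_inv_f)
  define k where "k i j = M i \<bullet> j" for i j
  have kh: "(\<Sum>l\<in>Basis. k i l * h l j) = (if i = j then 1 else 0)"
    if "i \<in> Basis" "j \<in> Basis" for i j
  proof -
    have "(\<Sum>l\<in>Basis. k i l * h l j) = h (M i) j"
      using expand[of j "M i"] sym by (simp add: k_def)
    also have "\<dots> = L (M i) \<bullet> j" using that L_comp by simp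
    finally show ?thesis using that LM by (simp add: inner_Basis)
  qed
  have "k i j = k j i" if "i \<in> Basis" "j \<in> Basis" for i j
  proof -
    have "h (M i) (M j) = M j \<bullet> i" if "i \<in> Basis" "j \<in> Basis" for i j
    proof -
      have "h (M i) (M j) = (\<Sum>l\<in>Basis. (M j \<bullet> l) * (L (M i) \<bullet> l))"
        using expand[of "M i" "M j"] L_comp by simp
      also have "\<dots> = M j \<bullet> i"
        using LM by (simp add: euclidean_inner[symmetric])
      finally show ?thesis .
    qed
    then show ?thesis using that sym[of "M i" "M j"] by (simp add: k_def)
  qed
  note k_sym = this
  have hk: "(\<Sum>l\<in>Basis. h i l * k l j) = (if i = j then 1 else 0)"
    if "i \<in> Basis" "j \<in> Basis" for i j
  proof -
    have "(\<Sum>l\<in>Basis. h i l * k l j) = (\<Sum>l\<in>Basis. k j l * h l i)"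
      by (rule sum.cong) (use that k_sym in \<open>auto simp: sym[of i] mult.commute\<close>)
    then show ?thesis using kh[OF that(2,1)] by auto
  qed
  have "is_inverse_gram h k"
    using kh hk by (simp add: is_inverse_gram_def)
  then show ?thesis
    unfolding inverse_gram_def by (metis someI)
qed

definition alg_curvature_ops :: "('a::euclidean_space \<Rightarrow> 'a \<Rightarrow> 'a \<Rightarrow> 'a) set" where
  "alg_curvature_ops =
     {A. (\<forall>y z. linear (\<lambda>x. A x y z)) \<and> (\<forall>x z. linear (\<lambda>y. A x y z)) \<and>
         (\<forall>x y. linear (\<lambda>z. A x y z)) \<and>
         (\<forall>x y z. A x y z = - A y x z) \<and>
         (\<forall>x y z. A x y z + A y z x + A z x y = 0)}"

definition trace_endo :: "('a::euclidean_space \<Rightarrow> 'a) \<Rightarrow> real" where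
  "trace_endo f = (\<Sum>b\<in>Basis. f b \<bullet> b)"

definition ricci :: "('a::euclidean_space \<Rightarrow> 'a \<Rightarrow> 'a \<Rightarrow> 'a) \<Rightarrow> 'a \<Rightarrow> 'a \<Rightarrow> real" where
  "ricci A x y = trace_endo (\<lambda>z. A z x y)"

definition ricci_a :: "('a::euclidean_space \<Rightarrow> 'a \<Rightarrow> 'a \<Rightarrow> 'a) \<Rightarrow> 'a \<Rightarrow> 'a \<Rightarrow> real" where
  "ricci_a A x y = (ricci A x y - ricci A y x) / 2"

definition ricci_s :: "('a::euclidean_space \<Rightarrow> 'a \<Rightarrow> 'a \<Rightarrow> 'a) \<Rightarrow> 'a \<Rightarrow> 'a \<Rightarrow> real" where
  "ricci_s A x y = (ricci A x y + ricci A y x) / 2"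

text \<open>The factor \<open>A k i j \<bullet> k\<close> is the component \<open>A\<^sub>k\<^sub>i\<^sub>j\<^sup>k\<close>.\<close>

definition scalar_curv ::
    "('a::euclidean_space \<Rightarrow> 'a \<Rightarrow> 'a \<Rightarrow> 'a) \<Rightarrow> ('a \<Rightarrow> 'a \<Rightarrow> real) \<Rightarrow> real" where
  "scalar_curv A h =
     (\<Sum>i\<in>Basis. \<Sum>j\<in>Basis. \<Sum>k\<in>Basis. inverse_gram h i j * (A k i j \<bullet> k))"

definition ricci_0 ::
    "('a::euclidean_space \<Rightarrow> 'a \<Rightarrow> 'a \<Rightarrow> 'a) \<Rightarrow> ('a \<Rightarrow> 'a \<Rightarrow> real) \<Rightarrow> 'a \<Rightarrow> 'a \<Rightarrow> real" where
  "ricci_0 A h x y = ricci_s A x y - scalar_curv A h / real DIM('a) * h x y"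

definition ricci_symmetric :: "('a::euclidean_space \<Rightarrow> 'a \<Rightarrow> 'a \<Rightarrow> 'a) \<Rightarrow> bool" where
  "ricci_symmetric A \<longleftrightarrow> (\<forall>x y. ricci_a A x y = 0)"

definition ricci_antisymmetric :: "('a::euclidean_space \<Rightarrow> 'a \<Rightarrow> 'a \<Rightarrow> 'a) \<Rightarrow> bool" where
  "ricci_antisymmetric A \<longleftrightarrow> (\<forall>x y. ricci_s A x y = 0)"

definition ricci_traceless ::
    "('a::euclidean_space \<Rightarrow> 'a \<Rightarrow> 'a \<Rightarrow> 'a) \<Rightarrow> ('a \<Rightarrow> 'a \<Rightarrow> real) \<Rightarrow> bool" where
  "ricci_traceless A h \<longleftrightarrow> (\<forall>x y. ricci_0 A h x y = 0)"

section \<open>Pseudo-Riemannian metrics and connections\<close>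

text \<open>
  The parameter \<open>reg\<close> is a regularity class of real functions on open sets, such as
  \<^term>\<open>C_k_on s\<close> or \<^const>\<open>real_analytic_on\<close>.
\<close>

definition pseudo_riemannian_metric ::
    "('a set \<Rightarrow> ('a \<Rightarrow> real) \<Rightarrow> bool) \<Rightarrow> ('a::euclidean_space \<Rightarrow> 'a \<Rightarrow> 'a \<Rightarrow> real) \<Rightarrow> bool" where
  "pseudo_riemannian_metric reg g \<longleftrightarrow>
     (\<forall>P. inner_product_form (g P)) \<and>
     (\<forall>i\<in>Basis. \<forall>j\<in>Basis. reg UNIV (\<lambda>P. g P i j))"

definition lie_bracket :: "('a::euclidean_space \<Rightarrow> 'a) \<Rightarrow> ('a \<Rightarrow> 'a) \<Rightarrow> 'a \<Rightarrow> 'a" where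
  "lie_bracket X Y P =
     frechet_derivative Y (at P) (X P) - frechet_derivative X (at P) (Y P)"

text \<open>
  A connection on the tangent bundle of the open set \<open>U\<close>, as a covariant derivative
  \<open>\<nabla>\<^sub>X Y\<close> of the \<open>C\<^sup>1\<close> field \<open>Y\<close> in the direction of the continuous field \<open>X\<close>. The class \<open>C\<^sup>1\<close>
  is needed for \<open>Y\<close> because \<open>\<nabla>\<^sub>X \<nabla>\<^sub>Y Z\<close> has to make sense when the connection is only \<open>C\<^sup>1\<close>.
  Since \<open>Y = (\<Sum>i. Y\<^sup>i e\<^sub>i)\<close> with \<open>C\<^sup>1\<close> coefficients on all of \<open>U\<close>, the axioms determine \<open>\<nabla>\<close> from its
  Christoffel symbols; in particular they imply that it is local.
\<close>

definition connection_on ::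
    "'a::euclidean_space set \<Rightarrow> (('a \<Rightarrow> 'a) \<Rightarrow> ('a \<Rightarrow> 'a) \<Rightarrow> 'a \<Rightarrow> 'a) \<Rightarrow> bool" where
  "connection_on U nabla \<longleftrightarrow>
     (\<forall>X X' Y. continuous_on U X \<longrightarrow> continuous_on U X' \<longrightarrow> C_k_on 1 U Y \<longrightarrow>
        (\<forall>P\<in>U. nabla (\<lambda>Q. X Q + X' Q) Y P = nabla X Y P + nabla X' Y P)) \<and>
     (\<forall>f X Y. continuous_on U f \<longrightarrow> continuous_on U X \<longrightarrow> C_k_on 1 U Y \<longrightarrow>
        (\<forall>P\<in>U. nabla (\<lambda>Q. f Q *\<^sub>R X Q) Y P = f P *\<^sub>R nabla X Y P)) \<and>
     (\<forall>X Y Y'. continuous_on U X \<longrightarrow> C_k_on 1 U Y \<longrightarrow> C_k_on 1 U Y' \<longrightarrow>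
        (\<forall>P\<in>U. nabla X (\<lambda>Q. Y Q + Y' Q) P = nabla X Y P + nabla X Y' P)) \<and>
     (\<forall>f X Y. C_k_on 1 U f \<longrightarrow> continuous_on U X \<longrightarrow> C_k_on 1 U Y \<longrightarrow>
        (\<forall>P\<in>U. nabla X (\<lambda>Q. f Q *\<^sub>R Y Q) P =
           frechet_derivative f (at P) (X P) *\<^sub>R Y P + f P *\<^sub>R nabla X Y P))"

definition torsion_free_on ::
    "'a::euclidean_space set \<Rightarrow> (('a \<Rightarrow> 'a) \<Rightarrow> ('a \<Rightarrow> 'a) \<Rightarrow> 'a \<Rightarrow> 'a) \<Rightarrow> bool" where
  "torsion_free_on U nabla \<longleftrightarrow>
     (\<forall>X Y. C_k_on 1 U X \<longrightarrow> C_k_on 1 U Y \<longrightarrow>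
        (\<forall>P\<in>U. nabla X Y P - nabla Y X P = lie_bracket X Y P))"

text \<open>The Christoffel symbol \<open>\<Gamma>\<^sub>i\<^sub>j\<^sup>k\<close> in the linear coordinates, for \<open>i\<close>, \<open>j\<close>, \<open>k\<close> in \<^const>\<open>Basis\<close>.\<close>

definition christoffel ::
    "(('a::euclidean_space \<Rightarrow> 'a) \<Rightarrow> ('a \<Rightarrow> 'a) \<Rightarrow> 'a \<Rightarrow> 'a) \<Rightarrow> 'a \<Rightarrow> 'a \<Rightarrow> 'a \<Rightarrow> 'a \<Rightarrow> real" where
  "christoffel nabla i j k P = nabla (\<lambda>_. i) (\<lambda>_. j) P \<bullet> k"

definition regular_connection_on ::
    "('a set \<Rightarrow> ('a \<Rightarrow> real) \<Rightarrow> bool) \<Rightarrow> 'a::euclidean_space set \<Rightarrow>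
     (('a \<Rightarrow> 'a) \<Rightarrow> ('a \<Rightarrow> 'a) \<Rightarrow> 'a \<Rightarrow> 'a) \<Rightarrow> bool" where
  "regular_connection_on reg U nabla \<longleftrightarrow>
     (\<forall>i\<in>Basis. \<forall>j\<in>Basis. \<forall>k\<in>Basis. reg U (christoffel nabla i j k))"

definition curvature ::
    "(('a::euclidean_space \<Rightarrow> 'a) \<Rightarrow> ('a \<Rightarrow> 'a) \<Rightarrow> 'a \<Rightarrow> 'a) \<Rightarrow>
     ('a \<Rightarrow> 'a) \<Rightarrow> ('a \<Rightarrow> 'a) \<Rightarrow> ('a \<Rightarrow> 'a) \<Rightarrow> 'a \<Rightarrow> 'a" where
  "curvature nabla X Y Z P =
     nabla X (nabla Y Z) P - nabla Y (nabla X Z) P - nabla (lie_bracket X Y) Z P"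

text \<open>
  The curvature operator at a point. The curvature is tensorial, so its value on tangent vectors
  may be computed with any extensions to vector fields; the constant ones are used.
\<close>

definition curvature_at ::
    "(('a::euclidean_space \<Rightarrow> 'a) \<Rightarrow> ('a \<Rightarrow> 'a) \<Rightarrow> 'a \<Rightarrow> 'a) \<Rightarrow> 'a \<Rightarrow> 'a \<Rightarrow> 'a \<Rightarrow> 'a \<Rightarrow> 'a" where
  "curvature_at nabla P x y z = curvature nabla (\<lambda>_. x) (\<lambda>_. y) (\<lambda>_. z) P"

end

theory Submission
  imports Defs
begin

text \<open>
  In the linear coordinates put \<open>\<Gamma> = \<Gamma>\<^sub>0 + v\<close>, where
  \<open>\<Gamma>\<^sub>0(P)(y, z) = (\<A>(P, y) z + \<A>(P, z) y) / 3\<close> is linear in \<open>P\<close> and has curvature \<open>\<A>\<close> at 0.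
  Let \<open>E\<close> be the endomorphism that represents the symmetric Ricci tensor of \<open>\<A>\<close> with respect to
  \<open>g\<^sub>0\<close>, and let \<open>S\<^sub>P(x, y) = (g\<^sub>P(E x, y) + g\<^sub>P(x, E y)) / 2\<close>. Its trace with respect to \<open>g\<^sub>P\<close> is the
  constant \<open>tr E\<close>, it vanishes if \<open>E = 0\<close>, and it is a multiple of \<open>g\<^sub>P\<close> if \<open>E\<close> is scalar. It therefore
  suffices that the Ricci tensor of \<open>\<Gamma>\<close> be the constant antisymmetric part of that of \<open>\<A>\<close> plus
  \<open>S\<^sub>P\<close>.

  Because the dimension is at least 3, one can choose for all \<open>j\<close>, \<open>k\<close> an index \<open>\<iota>(j, k)\<close> different
  from both, and let \<open>v\<^sub>j\<^sub>k\<close> have only this component. Then \<open>v\<close> is trace free, and the Ricci equation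
  becomes the system \<open>\<partial>\<^sub>\<iota>\<^sub>(\<^sub>j\<^sub>,\<^sub>k\<^sub>) v\<^sub>j\<^sub>k = F\<^sub>j\<^sub>k(P, v)\<close> with \<open>F\<close> quadratic in \<open>v\<close>. In integrated form,
  with \<open>v\<^sub>j\<^sub>k = 0\<close> where the coordinate \<open>\<iota>(j, k)\<close> vanishes, it is solved by contraction on a small cube, in
  a weighted \<open>C\<^sup>s\<close> norm or in the weighted \<open>\<ell>\<^sup>1\<close> norm of power series coefficients. Neither norm loses
  derivatives.
\<close>

section \<open>Integration along a coordinate\<close>

text \<open>In coordinates Ric_jk is the sum over l of d_l \<Gamma>_jk^l - d_j \<Gamma>_lk^l plus a
  quadratic term. A trace-free v drops out of the second sum, and the choice of \<iota> leaves a
  single derivative of v_jk in the first. Each unknown is thus differentiated in one direction only,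
  and the right-hand sides contain no derivatives of the unknowns. The system can therefore be
  integrated like ordinary differential equations, although different unknowns are integrated in
  different directions; this is why finite C^s regularity suffices. Zero data on the hyperplanes
  also protect the curvature at 0. There v vanishes, its derivatives within the hyperplane vanish,
  and the remaining one is F(0, 0) = S_0 minus the symmetric Ricci tensor of the given operator,
  which is 0. The antisymmetric part of Ric stays constant because v and the quadratic term
  contribute only symmetrically and \<Gamma>_0 is linear in P. The C^s and the analytic case differ
  only in the norm, so the fixed point argument is carried out once, for an abstract family of norms
  on shrinking cubes.\<close>

definition cube :: "real \<Rightarrow> 'a::euclidean_space set" where
  "cube r = {x. \<forall>b\<in>Basis. \<bar>x \<bullet> b\<bar> < r}"

text \<open>The integral of \<open>f\<close> over the segment in direction \<open>b\<close> from the hyperplane \<open>x \<bullet> b = 0\<close> to \<open>x\<close>.\<close>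

definition antideriv :: "'a::euclidean_space \<Rightarrow> ('a \<Rightarrow> real) \<Rightarrow> 'a \<Rightarrow> real" where
  "antideriv b f x = (x \<bullet> b) * integral {0..1} (\<lambda>t. f (x - ((1 - t) * (x \<bullet> b)) *\<^sub>R b))"

lemma cube_eq_box: "cube r = box (- (r *\<^sub>R One)) (r *\<^sub>R (One :: 'a::euclidean_space))"
  by (auto simp: cube_def box_def abs_less_iff)

lemma open_cube [simp]: "open (cube r)"
  and convex_cube [simp]: "convex (cube r)"
  by (simp_all add: cube_eq_box open_box convex_box)

lemma zero_in_cube [simp]: "0 < r \<Longrightarrow> 0 \<in> cube r"
  by (simp add: cube_def)

lemma cube_mono: "q \<le> p \<Longrightarrow> cube q \<subseteq> cube p"
  by (force simp: cube_def)

text \<open>Sliding multiplies the coordinate along \<open>b\<close> by \<open>t\<close> and fixes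
  all the others.\<close>

lemma slide_in_cube:
  assumes "x \<in> cube r" "b \<in> Basis" "0 \<le> t" "t \<le> 1"
  shows "x - ((1 - t) * (x \<bullet> b)) *\<^sub>R b \<in> cube r"
proof -
  have "\<bar>(x - ((1 - t) * (x \<bullet> b)) *\<^sub>R b) \<bullet> c\<bar> \<le> \<bar>x \<bullet> c\<bar>" if "c \<in> Basis" for c
  proof (cases "c = b")
    case True
    then have "(x - ((1 - t) * (x \<bullet> b)) *\<^sub>R b) \<bullet> c = t * (x \<bullet> c)"
      using assms by (simp add: algebra_simps)
    then show ?thesis using assms by (simp add: abs_mult mult_left_le_one_le)
  next
    case False
    then show ?thesis using assms that by (simp add: inner_diff_left inner_Basis)
  qed
  then show ?thesis using assms(1) by (force simp: cube_def)
qed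

lemma continuous_on_slide:
  assumes "continuous_on (cube r) f" "x \<in> cube r" "b \<in> Basis"
  shows "continuous_on {0..1} (\<lambda>t. f (x - ((1 - t) * (x \<bullet> b)) *\<^sub>R b))"
  by (rule continuous_on_compose2[OF assms(1)])
    (use assms slide_in_cube in \<open>auto intro!: continuous_intros\<close>)

lemma antideriv_diff:
  assumes "continuous_on (cube r) f" "continuous_on (cube r) g" "x \<in> cube r" "b \<in> Basis"
  shows "antideriv b (\<lambda>y. f y - g y) x = antideriv b f x - antideriv b g x"
proof -
  have "(\<lambda>t. f (x - ((1 - t) * (x \<bullet> b)) *\<^sub>R b)) integrable_on {0..1}"
       "(\<lambda>t. g (x - ((1 - t) * (x \<bullet> b)) *\<^sub>R b)) integrable_on {0..1}"
    using assms continuous_on_slide integrable_continuous_interval by blast+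
  then show ?thesis
    by (simp add: antideriv_def integral_diff right_diff_distrib)
qed

lemma antideriv_bound:
  assumes "continuous_on (cube r) f" "\<And>y. y \<in> cube r \<Longrightarrow> \<bar>f y\<bar> \<le> M" "x \<in> cube r" "b \<in> Basis"
  shows "\<bar>antideriv b f x\<bar> \<le> r * M"
proof -
  let ?h = "\<lambda>t. f (x - ((1 - t) * (x \<bullet> b)) *\<^sub>R b)"
  have "norm (integral {0..1} ?h) \<le> M * (1 - 0)"
    using assms by (intro integral_bound) (auto intro!: assms(2) slide_in_cube continuous_on_slide)
  moreover have "\<bar>x \<bullet> b\<bar> \<le> r" using assms by (force simp: cube_def)
  ultimately show ?thesis
    unfolding antideriv_def abs_mult by (intro mult_mono) auto
qed

lemma antideriv_eq_0: "x \<bullet> b = 0 \<Longrightarrow> antideriv b f x = 0"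
  by (simp add: antideriv_def)

lemma antideriv_const: "antideriv b (\<lambda>_. 1) x = x \<bullet> b"
  by (simp add: antideriv_def)

text \<open>As \<open>f\<close> is merely continuous, only the derivative along \<open>b\<close> can
  be claimed. It is the one-variable fundamental theorem on the line through \<open>P\<close> in
  direction \<open>b\<close>.\<close>

lemma antideriv_has_derivative_along:
  assumes f: "continuous_on (cube r) f" and P: "P \<in> cube r" and b: "b \<in> Basis"
  shows "((\<lambda>u. antideriv b f (P + (u - P \<bullet> b) *\<^sub>R b)) has_real_derivative f P) (at (P \<bullet> b))"
proof -
  define Z where "Z = P - (P \<bullet> b) *\<^sub>R b"
  define h where "h u = f (Z + u *\<^sub>R b)" for u
  have Z: "Z \<bullet> c = (if c = b then 0 else P \<bullet> c)" if "c \<in> Basis" for c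
    using that b by (auto simp: Z_def inner_diff_left inner_Basis)
  have in_cube: "Z + u *\<^sub>R b \<in> cube r" if "\<bar>u\<bar> < r" for u
    using that P Z b by (auto simp: cube_def inner_add_left inner_Basis)
  \<comment> \<open>A compact interval with 0 and \<open>P \<bullet> b\<close> in its interior on
    which \<open>h\<close> is continuous. Integrals start at \<open>-a\<close>, which spares a case
    distinction on the sign of \<open>u\<close>.\<close>
  obtain a where a: "\<bar>P \<bullet> b\<bar> < a" "a < r"
    using P b dense[of "\<bar>P \<bullet> b\<bar>" r] by (auto simp: cube_def)
  have conth: "continuous_on {-a..a} h"
    unfolding h_def
    by (rule continuous_on_compose2[OF f]) (use a in_cube in \<open>auto intro!: continuous_intros\<close>)
  have eq: "antideriv b f (P + (u - P \<bullet> b) *\<^sub>R b) = integral {-a..u} h - integral {-a..0} h"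
    if "\<bar>u\<bar> < a" for u
  proof -
    have prim: "((\<lambda>v. integral {-a..v} h) has_real_derivative h v) (at v within {-a..a})"
      if "v \<in> {-a..a}" for v
      using integral_has_real_derivative[OF conth that] .
    \<comment> \<open>This is the substitution v = t u, obtained from the chain rule so that
      \<open>u\<close> may have either sign or be 0.\<close>
    have 1: "((\<lambda>t. integral {-a..t * u} h) has_vector_derivative u * h (t * u)) (at t within {0..1})"
      if t: "t \<in> {0..1}" for t
    proof -
      have tu: "\<bar>t' * u\<bar> < a" if "t' \<in> {0..1}" for t'
        using that \<open>\<bar>u\<bar> < a\<close> mult_left_le_one_le[of "\<bar>u\<bar>" t'] by (auto simp: abs_mult)
      have "((\<lambda>t. integral {-a..t * u} h) has_real_derivative h (t * u) * u) (at t within {0..1})"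
      proof -
        have "((\<lambda>v. integral {-a..v} h) has_real_derivative h (t * u))
            (at (t * u) within (\<lambda>t. t * u) ` {0..1})"
          by (rule DERIV_subset[OF prim]) (use tu t in \<open>force simp: abs_less_iff\<close>)+
        moreover have "((\<lambda>t. t * u) has_real_derivative u) (at t within {0..1})"
          by (auto intro!: derivative_eq_intros)
        ultimately show ?thesis
          by (rule DERIV_image_chain[unfolded o_def])
      qed
      then show ?thesis
        by (simp add: has_real_derivative_iff_has_vector_derivative mult.commute)
    qed
    have "((\<lambda>t. u * h (t * u)) has_integral integral {-a..1 * u} h - integral {-a..0 * u} h) {0..1}"
      by (rule fundamental_theorem_of_calculus) (use 1 in auto)
    then have "u * integral {0..1} (\<lambda>t. h (t * u)) = integral {-a..u} h - integral {-a..0} h"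
      by (simp add: integral_unique flip: integral_mult_right)
    moreover have "antideriv b f (P + (u - P \<bullet> b) *\<^sub>R b) = u * integral {0..1} (\<lambda>t. h (t * u))"
    proof -
      have *: "(P + (u - P \<bullet> b) *\<^sub>R b) \<bullet> b = u"
        using b by (simp add: inner_add_left)
      have "P + (u - P \<bullet> b) *\<^sub>R b - ((1 - t) * u) *\<^sub>R b = Z + (t * u) *\<^sub>R b" for t
        by (simp add: Z_def algebra_simps)
      then show ?thesis unfolding antideriv_def * h_def by simp
    qed
    ultimately show ?thesis by simp
  qed
  have "((\<lambda>u. integral {-a..u} h) has_real_derivative h (P \<bullet> b)) (at (P \<bullet> b) within {-a..a})"
    using a by (intro integral_has_real_derivative[OF conth]) auto
  then have "((\<lambda>u. integral {-a..u} h) has_real_derivative h (P \<bullet> b)) (at (P \<bullet> b))"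
    using at_within_interior[of "P \<bullet> b" "{-a..a}"] a by (simp add: abs_less_iff)
  then have "((\<lambda>u. integral {-a..u} h - integral {-a..0} h) has_real_derivative h (P \<bullet> b)) (at (P \<bullet> b))"
    using DERIV_diff[OF _ DERIV_const] by fastforce
  moreover have "h (P \<bullet> b) = f P" by (simp add: h_def Z_def)
  moreover have "\<forall>\<^sub>F u in nhds (P \<bullet> b). \<bar>u\<bar> < a"
  proof -
    have "\<forall>\<^sub>F u in nhds (P \<bullet> b). u \<in> {-a<..<a}"
      by (rule eventually_nhds_in_open) (use a in auto)
    then show ?thesis by (rule eventually_mono) auto
  qed
  ultimately show ?thesis
    by (subst DERIV_cong_ev[OF refl _ refl, where g = "\<lambda>u. integral {-a..u} h - integral {-a..0} h"])
      (auto elim: eventually_mono simp: eq)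
qed

text \<open>Turns an integral equation back into a differential one: that \<open>w\<close> is
  differentiable is known from its regularity, and the equation supplies the value of the derivative
  along \<open>b\<close>.\<close>

lemma derivative_eq_along_antideriv:
  assumes D: "(w has_derivative D) (at P)" and w: "\<And>x. x \<in> cube r \<Longrightarrow> w x = antideriv b f x"
    and f: "continuous_on (cube r) f" and P: "P \<in> cube r" and b: "b \<in> Basis"
  shows "D b = f P"
proof -
  have "((\<lambda>u. w (P + (u - P \<bullet> b) *\<^sub>R b)) has_derivative (\<lambda>u. D (u *\<^sub>R b))) (at (P \<bullet> b))"
    by (rule has_derivative_compose[where f = "\<lambda>u. P + (u - P \<bullet> b) *\<^sub>R b" and g = w])
      (use D in \<open>auto intro!: derivative_eq_intros\<close>)
  moreover have "(\<lambda>u. D (u *\<^sub>R b)) = (*) (D b)"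
    using linear_scale[OF has_derivative_linear[OF D]] by (auto simp: mult.commute)
  ultimately have 1: "((\<lambda>u. w (P + (u - P \<bullet> b) *\<^sub>R b)) has_real_derivative D b) (at (P \<bullet> b))"
    by (simp add: has_field_derivative_def)
  have "\<forall>\<^sub>F u in nhds (P \<bullet> b). P + (u - P \<bullet> b) *\<^sub>R b \<in> cube r"
  proof -
    have "isCont (\<lambda>u. P + (u - P \<bullet> b) *\<^sub>R b) (P \<bullet> b)" by (intro continuous_intros)
    then have "((\<lambda>u. P + (u - P \<bullet> b) *\<^sub>R b) \<longlongrightarrow> P) (nhds (P \<bullet> b))"
      by (simp add: isCont_def tendsto_nhds_iff)
    then show ?thesis using P open_cube topological_tendstoD by blast
  qed
  then have "((\<lambda>u. w (P + (u - P \<bullet> b) *\<^sub>R b)) has_real_derivative f P) (at (P \<bullet> b))"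
    using antideriv_has_derivative_along[OF f P b]
    by (subst DERIV_cong_ev[OF refl _ refl]) (auto elim!: eventually_mono simp: w)
  then show ?thesis using 1 DERIV_unique by blast
qed

section \<open>Contraction on scales of function spaces\<close>

text \<open>\<open>B p f M\<close> says that the norm of \<open>f\<close> on \<open>cube p\<close> is at most \<open>M\<close>; the norm may depend on \<open>p\<close>. The
  axiom \<open>sums\<close> replaces completeness.\<close>

locale function_scale =
  fixes B :: "real \<Rightarrow> ('a::euclidean_space \<Rightarrow> real) \<Rightarrow> real \<Rightarrow> bool" and C \<kappa> :: real
  assumes C_nonneg: "0 \<le> C" and \<kappa>_nonneg: "0 \<le> \<kappa>"
    and pos: "B p f M \<Longrightarrow> 0 < p"
    and mono: "B p f M \<Longrightarrow> 0 < q \<Longrightarrow> q \<le> p \<Longrightarrow> M \<le> N \<Longrightarrow> B q f N"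
    and cong: "B p f M \<Longrightarrow> (\<And>x. x \<in> cube p \<Longrightarrow> f x = h x) \<Longrightarrow> B p h M"
    and const: "0 < p \<Longrightarrow> B p (\<lambda>_. a) \<bar>a\<bar>"
    and add: "B p f M \<Longrightarrow> B p h N \<Longrightarrow> B p (\<lambda>x. f x + h x) (M + N)"
    and mult: "B p f M \<Longrightarrow> B p h N \<Longrightarrow> B p (\<lambda>x. f x * h x) (C * M * N)"
    and antideriv: "B p f M \<Longrightarrow> b \<in> Basis \<Longrightarrow> B p (antideriv b f) (\<kappa> * p * M)"
    and sums: "(\<And>n. B p (F n) (Ms n)) \<Longrightarrow> summable Ms \<Longrightarrow> B p (\<lambda>x. \<Sum>n. F n x) (\<Sum>n. Ms n)"
    and bound: "B p f M \<Longrightarrow> x \<in> cube p \<Longrightarrow> \<bar>f x\<bar> \<le> M"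
    and cont: "B p f M \<Longrightarrow> continuous_on (cube p) f"
begin

lemma nonneg: "B p f M \<Longrightarrow> 0 \<le> M"
  using bound[of p f M 0] pos by force

text \<open>\<open>B\<close> only provides upper bounds, so the Lipschitz condition ranges over all
  bounds \<open>d\<close> of the differences. The arguments are confined to bound 1 because products
  are Lipschitz only on bounded sets.\<close>

definition lipschitz_at ::
    "real \<Rightarrow> 'i set \<Rightarrow> (('i \<Rightarrow> 'a \<Rightarrow> real) \<Rightarrow> 'a \<Rightarrow> real) \<Rightarrow> real \<Rightarrow> real \<Rightarrow> bool" where
  "lipschitz_at p I \<Phi> M L \<longleftrightarrow>
     (\<forall>w. (\<forall>\<beta>\<in>I. B p (w \<beta>) 1) \<longrightarrow> B p (\<Phi> w) M) \<and>
     (\<forall>w w' d. (\<forall>\<beta>\<in>I. B p (w \<beta>) 1) \<longrightarrow> (\<forall>\<beta>\<in>I. B p (w' \<beta>) 1) \<longrightarrow> 0 \<le> d \<longrightarrow>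
        (\<forall>\<beta>\<in>I. B p (\<lambda>x. w \<beta> x - w' \<beta> x) d) \<longrightarrow> B p (\<lambda>x. \<Phi> w x - \<Phi> w' x) (L * d))"

text \<open>
  The constants have to be uniform in the scale, because the scale is shrunk afterwards to turn the
  map \<open>w \<mapsto> antideriv b (\<Phi> w)\<close> into a contraction.
\<close>

definition lipschitz_op :: "'i set \<Rightarrow> (('i \<Rightarrow> 'a \<Rightarrow> real) \<Rightarrow> 'a \<Rightarrow> real) \<Rightarrow> bool" where
  "lipschitz_op I \<Phi> \<longleftrightarrow>
     (\<exists>q>0. \<exists>M\<ge>0. \<exists>L\<ge>0. \<forall>p. 0 < p \<longrightarrow> p \<le> q \<longrightarrow> lipschitz_at p I \<Phi> M L)"

lemma lipschitz_opI:
  assumes "q > 0" "M \<ge> 0" "L \<ge> 0" "\<And>p. 0 < p \<Longrightarrow> p \<le> q \<Longrightarrow> lipschitz_at p I \<Phi> M L"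
  shows "lipschitz_op I \<Phi>"
  using assms unfolding lipschitz_op_def by blast

lemma lipschitz_at_bound:
  "lipschitz_at p I \<Phi> M L \<Longrightarrow> (\<And>\<beta>. \<beta> \<in> I \<Longrightarrow> B p (w \<beta>) 1) \<Longrightarrow> B p (\<Phi> w) M"
  unfolding lipschitz_at_def by blast

lemma lipschitz_at_diff:
  "lipschitz_at p I \<Phi> M L \<Longrightarrow> (\<And>\<beta>. \<beta> \<in> I \<Longrightarrow> B p (w \<beta>) 1) \<Longrightarrow>
     (\<And>\<beta>. \<beta> \<in> I \<Longrightarrow> B p (w' \<beta>) 1) \<Longrightarrow> 0 \<le> d \<Longrightarrow>
     (\<And>\<beta>. \<beta> \<in> I \<Longrightarrow> B p (\<lambda>x. w \<beta> x - w' \<beta> x) d) \<Longrightarrow> B p (\<lambda>x. \<Phi> w x - \<Phi> w' x) (L * d)"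
  unfolding lipschitz_at_def by blast

lemma lipschitz_at_mono:
  assumes "lipschitz_at p I \<Phi> M L" "0 < p" "M \<le> M'" "L \<le> L'"
  shows "lipschitz_at p I \<Phi> M' L'"
  unfolding lipschitz_at_def
proof (intro conjI allI impI)
  fix w assume "\<forall>\<beta>\<in>I. B p (w \<beta>) 1"
  then show "B p (\<Phi> w) M'"
    using lipschitz_at_bound[OF assms(1), of w] mono assms by blast
next
  fix w w' and d :: real
  assume *: "\<forall>\<beta>\<in>I. B p (w \<beta>) 1" "\<forall>\<beta>\<in>I. B p (w' \<beta>) 1" "0 \<le> d"
    "\<forall>\<beta>\<in>I. B p (\<lambda>x. w \<beta> x - w' \<beta> x) d"
  then have "B p (\<lambda>x. \<Phi> w x - \<Phi> w' x) (L * d)"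
    by (intro lipschitz_at_diff[OF assms(1)]) auto
  then show "B p (\<lambda>x. \<Phi> w x - \<Phi> w' x) (L' * d)"
    by (rule mono) (use assms * in \<open>auto intro: mult_right_mono\<close>)
qed

lemma lipschitz_op_const:
  assumes "B q f M"
  shows "lipschitz_op I (\<lambda>w. f)"
proof (rule lipschitz_opI[of q M 0])
  fix p :: real assume p: "0 < p" "p \<le> q"
  show "lipschitz_at p I (\<lambda>w. f) M 0"
    unfolding lipschitz_at_def using mono[OF assms p] const[OF p(1), of 0] by simp
qed (use assms pos nonneg in auto)

lemma lipschitz_op_proj: "\<beta> \<in> I \<Longrightarrow> lipschitz_op I (\<lambda>w. w \<beta>)"
  by (rule lipschitz_opI[of 1 1 1]) (simp_all add: lipschitz_at_def)

lemma lipschitz_op_add: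
  assumes "lipschitz_op I \<Phi>" "lipschitz_op I \<Psi>"
  shows "lipschitz_op I (\<lambda>w x. \<Phi> w x + \<Psi> w x)"
proof -
  obtain q M L where 1: "q > 0" "M \<ge> 0" "L \<ge> 0"
    "\<And>p. 0 < p \<Longrightarrow> p \<le> q \<Longrightarrow> lipschitz_at p I \<Phi> M L"
    using assms(1) unfolding lipschitz_op_def by blast
  obtain q' M' L' where 2: "q' > 0" "M' \<ge> 0" "L' \<ge> 0"
    "\<And>p. 0 < p \<Longrightarrow> p \<le> q' \<Longrightarrow> lipschitz_at p I \<Psi> M' L'"
    using assms(2) unfolding lipschitz_op_def by blast
  show ?thesis
  proof (rule lipschitz_opI[of "min q q'" "M + M'" "L + L'"])
    fix p :: real assume "0 < p" "p \<le> min q q'"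
    then have p: "lipschitz_at p I \<Phi> M L" "lipschitz_at p I \<Psi> M' L'"
      using 1 2 by auto
    show "lipschitz_at p I (\<lambda>w x. \<Phi> w x + \<Psi> w x) (M + M') (L + L')"
      unfolding lipschitz_at_def
    proof (intro conjI allI impI)
      fix w w' and d :: real
      assume "\<forall>\<beta>\<in>I. B p (w \<beta>) 1" "\<forall>\<beta>\<in>I. B p (w' \<beta>) 1" "0 \<le> d"
        "\<forall>\<beta>\<in>I. B p (\<lambda>x. w \<beta> x - w' \<beta> x) d"
      then have "B p (\<lambda>x. (\<Phi> w x - \<Phi> w' x) + (\<Psi> w x - \<Psi> w' x)) (L * d + L' * d)"
        by (intro add lipschitz_at_diff[OF p(1)] lipschitz_at_diff[OF p(2)]) auto
      then show "B p (\<lambda>x. \<Phi> w x + \<Psi> w x - (\<Phi> w' x + \<Psi> w' x)) ((L + L') * d)"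
        by (simp add: algebra_simps)
    qed (auto intro!: add p[THEN lipschitz_at_bound])
  qed (use 1 2 in auto)
qed

lemma lipschitz_op_mult:
  assumes "lipschitz_op I \<Phi>" "lipschitz_op I \<Psi>"
  shows "lipschitz_op I (\<lambda>w x. \<Phi> w x * \<Psi> w x)"
proof -
  obtain q M L where 1: "q > 0" "M \<ge> 0" "L \<ge> 0"
    "\<And>p. 0 < p \<Longrightarrow> p \<le> q \<Longrightarrow> lipschitz_at p I \<Phi> M L"
    using assms(1) unfolding lipschitz_op_def by blast
  obtain q' M' L' where 2: "q' > 0" "M' \<ge> 0" "L' \<ge> 0"
    "\<And>p. 0 < p \<Longrightarrow> p \<le> q' \<Longrightarrow> lipschitz_at p I \<Psi> M' L'"
    using assms(2) unfolding lipschitz_op_def by blast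
  show ?thesis
  proof (rule lipschitz_opI[of "min q q'" "C * M * M'" "C * L * M' + C * M * L'"])
    fix p :: real assume "0 < p" "p \<le> min q q'"
    then have p: "lipschitz_at p I \<Phi> M L" "lipschitz_at p I \<Psi> M' L'"
      using 1 2 by auto
    show "lipschitz_at p I (\<lambda>w x. \<Phi> w x * \<Psi> w x) (C * M * M') (C * L * M' + C * M * L')"
      unfolding lipschitz_at_def
    proof (intro conjI allI impI)
      fix w w' and d :: real
      assume "\<forall>\<beta>\<in>I. B p (w \<beta>) 1" "\<forall>\<beta>\<in>I. B p (w' \<beta>) 1" "0 \<le> d"
        "\<forall>\<beta>\<in>I. B p (\<lambda>x. w \<beta> x - w' \<beta> x) d"
      then have "B p (\<lambda>x. (\<Phi> w x - \<Phi> w' x) * \<Psi> w x + \<Phi> w' x * (\<Psi> w x - \<Psi> w' x))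
          (C * (L * d) * M' + C * M * (L' * d))"
        by (intro add mult lipschitz_at_diff[OF p(1)] lipschitz_at_diff[OF p(2)]
              lipschitz_at_bound[OF p(1)] lipschitz_at_bound[OF p(2)]) auto
      then show "B p (\<lambda>x. \<Phi> w x * \<Psi> w x - \<Phi> w' x * \<Psi> w' x) ((C * L * M' + C * M * L') * d)"
        by (simp add: algebra_simps)
    qed (auto intro!: mult p[THEN lipschitz_at_bound])
  qed (use 1 2 C_nonneg in auto)
qed

lemma lipschitz_op_sum:
  assumes "finite S" "\<And>s. s \<in> S \<Longrightarrow> lipschitz_op I (\<Phi> s)"
  shows "lipschitz_op I (\<lambda>w x. \<Sum>s\<in>S. \<Phi> s w x)"
  using assms
proof (induction S)
  case empty
  show ?case using lipschitz_op_const[OF const[of 1 0]] by simp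
next
  case (insert s S)
  then show ?case by (simp add: lipschitz_op_add)
qed

lemma lipschitz_op_uniform:
  assumes "finite S" "\<And>\<beta>. \<beta> \<in> S \<Longrightarrow> lipschitz_op I (\<Phi> \<beta>)"
  shows "\<exists>q>0. \<exists>M\<ge>0. \<exists>L\<ge>0. \<forall>p. 0 < p \<longrightarrow> p \<le> q \<longrightarrow>
    (\<forall>\<beta>\<in>S. lipschitz_at p I (\<Phi> \<beta>) M L)"
  using assms
proof (induction S)
  case empty
  show ?case by (intro exI[of _ 1]) auto
next
  case (insert s S)
  obtain q M L where 1: "q > 0" "M \<ge> 0" "L \<ge> 0"
    "\<And>p. 0 < p \<Longrightarrow> p \<le> q \<Longrightarrow> lipschitz_at p I (\<Phi> s) M L"
    using insert.prems[OF insertI1] unfolding lipschitz_op_def by blast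
  obtain q' M' L' where 2: "q' > 0" "M' \<ge> 0" "L' \<ge> 0"
    "\<And>p \<beta>. 0 < p \<Longrightarrow> p \<le> q' \<Longrightarrow> \<beta> \<in> S \<Longrightarrow> lipschitz_at p I (\<Phi> \<beta>) M' L'"
    using insert.IH insert.prems by blast
  show ?case
  proof (intro exI conjI allI impI ballI)
    fix p :: real and \<beta> assume p: "0 < p" "p \<le> min q q'" and "\<beta> \<in> insert s S"
    then show "lipschitz_at p I (\<Phi> \<beta>) (max M M') (max L L')"
      using 1(4)[of p] 2(4)[of p \<beta>]
      by (cases "\<beta> = s") (auto intro: lipschitz_at_mono)
  qed (use 1 2 in auto)
qed

text \<open>Banach's fixed point theorem, carried out by hand because \<open>B\<close> is a relation
  and not a metric. Integration contributes the factor \<open>\<kappa> * p\<close>, so a small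
  \<open>p\<close> makes the map a contraction of the unit ball, while \<open>M\<close> and
  \<open>L\<close> stay the same as \<open>p\<close> shrinks. The last conclusion supplies the
  continuity of the right-hand sides that is needed to differentiate the equations.\<close>

theorem integral_system_solvable:
  assumes I: "finite I" and d: "\<And>\<beta>. \<beta> \<in> I \<Longrightarrow> d \<beta> \<in> Basis"
    and \<Phi>: "\<And>\<beta>. \<beta> \<in> I \<Longrightarrow> lipschitz_op I (\<Phi> \<beta>)" and q0: "0 < q0"
  obtains p w where "0 < p" "p \<le> q0" "\<And>\<beta>. \<beta> \<in> I \<Longrightarrow> B p (w \<beta>) 1"
    "\<And>\<beta> x. \<beta> \<in> I \<Longrightarrow> x \<in> cube p \<Longrightarrow> w \<beta> x = antideriv (d \<beta>) (\<Phi> \<beta> w) x"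
    "\<And>\<beta>. \<beta> \<in> I \<Longrightarrow> \<exists>M. B p (\<Phi> \<beta> w) M"
proof -
  obtain q M L where q: "q > 0" "M \<ge> 0" "L \<ge> 0" and
    \<Phi>_lip: "\<And>p \<beta>. 0 < p \<Longrightarrow> p \<le> q \<Longrightarrow> \<beta> \<in> I \<Longrightarrow> lipschitz_at p I (\<Phi> \<beta>) M L"
    using lipschitz_op_uniform[OF I, of I \<Phi>] \<Phi> by blast
  \<comment> \<open>The summand 1 keeps \<open>K\<close> positive even if all constants vanish, so
    that \<open>1 / (2 * K)\<close> makes sense.\<close>
  define K where "K = \<kappa> * (M + L) + 1"
  have K: "0 < K" "\<kappa> * M \<le> K" "\<kappa> * L \<le> K"
    using q \<kappa>_nonneg by (auto simp: K_def distrib_left intro!: add_nonneg_pos add_increasing add_increasing2)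
  define p where "p = min q (min q0 (1 / (2 * K)))"
  have p: "0 < p" "p \<le> q" "p \<le> q0" "p * K \<le> 1 / 2"
  proof -
    have "p \<le> 1 / (2 * K)" by (simp add: p_def)
    then show "p * K \<le> 1 / 2" using K(1) by (simp add: field_simps)
  qed (use q q0 K(1) in \<open>auto simp: p_def\<close>)
  have small: "\<kappa> * p * M \<le> 1 / 2" "\<kappa> * p * L \<le> 1 / 2"
  proof -
    have "p * (\<kappa> * M) \<le> p * K" "p * (\<kappa> * L) \<le> p * K"
      using K p(1) by (auto intro: mult_left_mono)
    with p(4) have "p * (\<kappa> * M) \<le> 1 / 2" "p * (\<kappa> * L) \<le> 1 / 2" by linarith+
    then show "\<kappa> * p * M \<le> 1 / 2" "\<kappa> * p * L \<le> 1 / 2" by (metis mult.assoc mult.commute)+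
  qed
  note M = lipschitz_at_bound[OF \<Phi>_lip[OF p(1,2)]]
  note L = lipschitz_at_diff[OF \<Phi>_lip[OF p(1,2)]]
  define T where "T w \<beta> = antideriv (d \<beta>) (\<Phi> \<beta> w)" for w \<beta>
  define v where "v n = (T ^^ n) (\<lambda>_ _. 0)" for n
  have v_Suc: "v (Suc n) = T (v n)" for n by (simp add: v_def)
  have T: "B p (T w \<beta>) (1 / 2)" if "\<And>\<beta>. \<beta> \<in> I \<Longrightarrow> B p (w \<beta>) 1" "\<beta> \<in> I" for w \<beta>
    unfolding T_def
    by (rule mono[OF antideriv[OF M]]) (use that p small d in auto)
  have v: "B p (v n \<beta>) 1" if "\<beta> \<in> I" for n \<beta>
    using that
  proof (induction n arbitrary: \<beta>)
    case 0
    then show ?case using mono[OF const[of p 0]] p by (simp add: v_def)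
  next
    case (Suc n)
    then have "B p (v (Suc n) \<beta>) (1/2)" unfolding v_Suc by (intro T) auto
    then show ?case by (rule mono) (use p in auto)
  qed
  have T_diff: "B p (\<lambda>x. T w \<beta> x - T w' \<beta> x) (D / 2)"
    if w: "\<And>\<beta>. \<beta> \<in> I \<Longrightarrow> B p (w \<beta>) 1" and w': "\<And>\<beta>. \<beta> \<in> I \<Longrightarrow> B p (w' \<beta>) 1"
      and "0 \<le> D" and D: "\<And>\<beta>. \<beta> \<in> I \<Longrightarrow> B p (\<lambda>x. w \<beta> x - w' \<beta> x) D"
      and \<beta>: "\<beta> \<in> I" for w w' D \<beta>
  proof -
    have "B p (antideriv (d \<beta>) (\<lambda>x. \<Phi> \<beta> w x - \<Phi> \<beta> w' x)) (\<kappa> * p * (L * D))"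
      by (intro antideriv d L) (use that p in auto)
    moreover have "\<kappa> * p * (L * D) \<le> D / 2"
      using mult_right_mono[OF small(2), of D] \<open>0 \<le> D\<close> by (simp add: algebra_simps)
    ultimately have "B p (antideriv (d \<beta>) (\<lambda>x. \<Phi> \<beta> w x - \<Phi> \<beta> w' x)) (D / 2)"
      using mono p(1) by blast
    then show ?thesis
      by (rule cong) (auto simp: T_def intro!: antideriv_diff[of p] cont[OF M] \<beta> p w w' d)
  qed
  define \<delta> where "\<delta> n \<beta> x = v (Suc n) \<beta> x - v n \<beta> x" for n \<beta> x
  have \<delta>: "B p (\<delta> n \<beta>) ((1/2) ^ Suc n)" if "\<beta> \<in> I" for n \<beta>
    using that
  proof (induction n arbitrary: \<beta>)
    case 0
    have "B p (v 1 \<beta>) (1/2)" using T[OF v[of _ 0]] 0 v_Suc[of 0] by simp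
    then show ?case by (simp add: \<delta>_def[abs_def]) (simp add: v_def)
  next
    case (Suc n)
    have "B p (\<lambda>x. T (v (Suc n)) \<beta> x - T (v n) \<beta> x) ((1/2) ^ Suc n / 2)"
      using Suc by (intro T_diff v) (auto simp: \<delta>_def[abs_def])
    then show ?case by (simp add: \<delta>_def[abs_def] v_Suc)
  qed
  \<comment> \<open>The limit of the iterates is written as the series of their increments, because
    \<open>sums\<close> is the only form of completeness at hand. The increments are bounded by 1/2,
    1/4, ..., so the sum stays within bound 1.\<close>
  define w where "w \<beta> x = (\<Sum>n. \<delta> n \<beta> x)" for \<beta> x
  have geo: "(\<lambda>n. (1/2::real) ^ Suc n) sums 1"
    by (rule power_half_series)
  have w: "B p (w \<beta>) 1" if "\<beta> \<in> I" for \<beta>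
    using sums[OF \<delta>[OF that] sums_summable[OF geo]] sums_unique[OF geo] by (simp add: w_def[abs_def])
  \<comment> \<open>Pointwise convergence would not do here: the contraction estimate for
    \<open>w\<close> against \<open>v n\<close> needs their distance in the sense of
    \<open>B\<close>.\<close>
  have tail: "B p (\<lambda>x. w \<beta> x - v n \<beta> x) ((1/2) ^ n)" if "\<beta> \<in> I" for n \<beta>
  proof -
    have geo': "(\<lambda>k. (1/2::real) ^ Suc (k + n)) sums (1/2) ^ n"
      using sums_mult2[OF geo, of "(1/2) ^ n"] by (simp add: power_add mult_ac)
    have "B p (\<lambda>x. \<Sum>k. \<delta> (k + n) \<beta> x) ((1/2) ^ n)"
      using sums[OF \<delta>[OF that, of "_ + n"] sums_summable[OF geo']] sums_unique[OF geo'] by simp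
    then show ?thesis
    proof (rule cong)
      fix x :: 'a assume x: "x \<in> cube p"
      have "summable (\<lambda>n. \<delta> n \<beta> x)"
        by (rule summable_comparison_test'[OF sums_summable[OF geo]])
          (use bound[OF \<delta>[OF that] x] in auto)
      then have "w \<beta> x = (\<Sum>k. \<delta> (k + n) \<beta> x) + (\<Sum>k<n. \<delta> k \<beta> x)"
        unfolding w_def by (rule suminf_split_initial_segment)
      moreover have "(\<Sum>k<n. \<delta> k \<beta> x) = v n \<beta> x"
        unfolding \<delta>_def using sum_lessThan_telescope[of "\<lambda>k. v k \<beta> x" n] by (simp add: v_def)
      ultimately show "(\<Sum>k. \<delta> (k + n) \<beta> x) = w \<beta> x - v n \<beta> x" by simp
    qed
  qed
  \<comment> \<open>Half of the error is the distance of \<open>w\<close> to the next iterate, the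
    other half is the distance of \<open>T w\<close> to \<open>T (v n)\<close>.\<close>
  have fixed: "w \<beta> x = T w \<beta> x" if \<beta>: "\<beta> \<in> I" and x: "x \<in> cube p" for \<beta> x
  proof -
    have "\<bar>w \<beta> x - T w \<beta> x\<bar> \<le> (1/2) ^ n" for n
    proof -
      have "\<bar>w \<beta> x - v (Suc n) \<beta> x\<bar> \<le> (1/2) ^ Suc n"
        using bound[OF tail[OF \<beta>] x] .
      moreover have "\<bar>T w \<beta> x - T (v n) \<beta> x\<bar> \<le> (1/2) ^ n / 2"
        by (rule bound[OF T_diff x]) (use w v tail \<beta> in auto)
      moreover have "(1/2::real) ^ Suc n = (1/2) ^ n / 2" by simp
      ultimately show ?thesis unfolding v_Suc by linarith
    qed
    moreover have "(\<lambda>n. (1/2::real) ^ n) \<longlonglongrightarrow> 0" by (intro LIMSEQ_realpow_zero) auto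
    ultimately have "\<bar>w \<beta> x - T w \<beta> x\<bar> \<le> 0"
      by (intro LIMSEQ_le_const) auto
    then show ?thesis by simp
  qed
  show ?thesis
    by (rule that[of p w]) (use p w fixed M in \<open>auto simp: T_def intro!: exI[of _ M]\<close>)
qed

end

section \<open>Continuously differentiable functions\<close>

lemma has_derivative_imp_continuous_on:
  assumes "\<And>x. x \<in> S \<Longrightarrow> (f has_derivative f' x) (at x)"
  shows "continuous_on S f"
  by (rule has_derivative_continuous_on[OF has_derivative_at_withinI[OF assms]])

text \<open>Differentiation under the integral sign. In directions other than \<open>b\<close> it
  commutes with the antiderivative; along \<open>b\<close> the product rule for the factor
  \<open>x \<bullet> b\<close> yields two terms that an integration by parts combines into
  \<open>f x\<close>.\<close>

lemma has_derivative_antideriv: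
  fixes f :: "'a::euclidean_space \<Rightarrow> real"
  assumes f: "\<And>x. x \<in> cube p \<Longrightarrow> (f has_derivative (\<lambda>h. \<Sum>c\<in>Basis. (h \<bullet> c) * D c x)) (at x)"
    and D: "\<And>c. c \<in> Basis \<Longrightarrow> continuous_on (cube p) (D c)"
    and b: "b \<in> Basis" and x: "x \<in> cube p"
  shows "(antideriv b f has_derivative
    (\<lambda>h. \<Sum>c\<in>Basis. (h \<bullet> c) * (if c = b then f x else antideriv b (D c) x))) (at x)"
proof -
  define y where "y x t = x - ((1 - t) * (x \<bullet> b)) *\<^sub>R b" for x :: 'a and t
  have y: "y x t \<in> cube p" if "x \<in> cube p" "t \<in> {0..1}" for x t
    using slide_in_cube[OF that(1) b] that(2) by (simp add: y_def)
  have cont_f: "continuous_on (cube p) f"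
    using f by (rule has_derivative_imp_continuous_on)
  \<comment> \<open>The derivative of \<open>f\<close> after sliding, as a bounded linear map, the
    form in which \<open>leibniz_rule\<close> takes its continuity. The weight \<open>t\<close> for
    \<open>c = b\<close> is the factor by which sliding scales that coordinate.\<close>
  define G :: "'a \<Rightarrow> real \<Rightarrow> 'a \<Rightarrow>\<^sub>L real" where
    "G x t = (\<Sum>c\<in>Basis. ((if c = b then t else 1) * D c (y x t)) *\<^sub>R blinfun_inner_left c)" for x t
  have G_apply: "G x t h = (\<Sum>c\<in>Basis. (h \<bullet> c) * ((if c = b then t else 1) * D c (y x t)))" for x t h
    by (simp add: G_def blinfun.sum_left blinfun.scaleR_left mult.commute)
  have 1: "((\<lambda>x. f (y x t)) has_derivative G x t) (at x within cube p)"
    if "x \<in> cube p" "t \<in> {0..1}" for x t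
  proof -
    have "((\<lambda>x. y x t) has_derivative (\<lambda>h. y h t)) (at x within cube p)"
      unfolding y_def by (auto intro!: derivative_eq_intros)
    then have "((\<lambda>x. f (y x t)) has_derivative (\<lambda>h. \<Sum>c\<in>Basis. (y h t \<bullet> c) * D c (y x t))) (at x within cube p)"
      using has_derivative_compose f y that by blast
    moreover have "y h t \<bullet> c = (h \<bullet> c) * (if c = b then t else 1)" if "c \<in> Basis" for c h
      using that b by (auto simp: y_def inner_diff_left inner_Basis algebra_simps)
    then have "(\<Sum>c\<in>Basis. (y h t \<bullet> c) * D c (y x t)) = G x t h" for h
      unfolding G_apply by (intro sum.cong) auto
    ultimately show ?thesis by simp
  qed
  have cont_y: "continuous_on S (\<lambda>z. y (fst z) (snd z))" for S
    unfolding y_def by (intro continuous_intros)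
  have cont_weight: "continuous_on S (\<lambda>z. if c = b then h z else 1)"
    if "continuous_on S h" for S :: "'z::topological_space set" and h :: "'z \<Rightarrow> real" and c
    using that by (cases "c = b") auto
  have 2: "continuous_on (cube p \<times> cbox 0 1) (\<lambda>(x, t). G x t)"
    unfolding G_def split_beta
    by (intro continuous_intros cont_weight continuous_on_compose2[OF D cont_y])
      (auto simp: y intro!: continuous_intros)
  have cont_yt: "continuous_on {0..1} (\<lambda>t. h (y x t))"
    if "continuous_on (cube p) h" for h :: "'a \<Rightarrow> real"
    using continuous_on_slide[OF that x b] by (simp add: y_def)
  have "((\<lambda>x. integral (cbox 0 1) (\<lambda>t. f (y x t))) has_derivative integral (cbox 0 1) (G x)) (at x within cube p)"
  proof (rule leibniz_rule[OF _ _ 2 x convex_cube])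
    show "(\<lambda>t. f (y x t)) integrable_on cbox 0 1" if "x \<in> cube p" for x
      using continuous_on_slide[OF cont_f that b] by (simp add: y_def integrable_continuous_interval)
  qed (use 1 in auto)
  then have 3: "((\<lambda>x. integral {0..1} (\<lambda>t. f (y x t))) has_derivative integral {0..1} (G x)) (at x)"
    using x by (simp add: at_within_open[OF _ open_cube])
  have cont_G: "continuous_on {0..1} (G x)"
    unfolding G_def by (intro continuous_intros cont_weight cont_yt D) auto
  have int_G: "blinfun_apply (integral {0..1} (G x)) h =
      (\<Sum>c\<in>Basis. (h \<bullet> c) * integral {0..1} (\<lambda>t. (if c = b then t else 1) * D c (y x t)))" for h
  proof -
    have "blinfun_apply (integral {0..1} (G x)) h = integral {0..1} (\<lambda>t. G x t h)"
      using integral_linear[OF integrable_continuous_interval[OF cont_G] blinfun.bounded_linear_left[of h]]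
      by (simp add: o_def)
    also have "\<dots> = (\<Sum>c\<in>Basis. integral {0..1} (\<lambda>t. (h \<bullet> c) * ((if c = b then t else 1) * D c (y x t))))"
      unfolding G_apply
      by (intro integral_sum integrable_continuous_interval continuous_intros cont_weight cont_yt D) auto
    finally show ?thesis by simp
  qed
  \<comment> \<open>Integrates the derivative of \<open>t * f (y x t)\<close> over the unit
    interval; the slid point at \<open>t = 1\<close> is \<open>x\<close> itself.\<close>
  have by_parts: "integral {0..1} (\<lambda>t. f (y x t)) + (x \<bullet> b) * integral {0..1} (\<lambda>t. t * D b (y x t)) = f x"
  proof -
    have yb: "((\<lambda>t. y x t) has_derivative (\<lambda>u. (u * (x \<bullet> b)) *\<^sub>R b)) (at t within {0..1})" for t
      unfolding y_def by (auto intro!: derivative_eq_intros simp: algebra_simps)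
    have dfy: "((\<lambda>t. f (y x t)) has_vector_derivative (x \<bullet> b) * D b (y x t)) (at t within {0..1})"
      if "t \<in> {0..1}" for t
    proof -
      have "((\<lambda>t. f (y x t)) has_derivative
          (\<lambda>u. \<Sum>c\<in>Basis. ((u * (x \<bullet> b)) *\<^sub>R b \<bullet> c) * D c (y x t))) (at t within {0..1})"
        using has_derivative_compose[OF yb f[OF y[OF x that]]] .
      moreover have "(\<Sum>c\<in>Basis. ((u * (x \<bullet> b)) *\<^sub>R b \<bullet> c) * D c (y x t)) = u * ((x \<bullet> b) * D b (y x t))" for u
        using b by (simp add: inner_Basis if_distrib if_distribR sum.delta cong: if_cong)
      ultimately show ?thesis by (simp add: has_vector_derivative_def)
    qed
    have "((\<lambda>t. t * f (y x t)) has_vector_derivative t * ((x \<bullet> b) * D b (y x t)) + 1 * f (y x t)) (at t within {0..1})"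
      if "t \<in> {0..1}" for t
      by (rule has_vector_derivative_mult[OF has_vector_derivative_id dfy[OF that]])
    then have "((\<lambda>t. t * ((x \<bullet> b) * D b (y x t)) + 1 * f (y x t)) has_integral 1 * f (y x 1) - 0 * f (y x 0)) {0..1}"
      by (intro fundamental_theorem_of_calculus) auto
    then have "integral {0..1} (\<lambda>t. (x \<bullet> b) * (t * D b (y x t)) + f (y x t)) = f x"
      by (simp add: integral_unique y_def mult.left_commute)
    moreover have "integral {0..1} (\<lambda>t. (x \<bullet> b) * (t * D b (y x t)) + f (y x t)) =
        integral {0..1} (\<lambda>t. (x \<bullet> b) * (t * D b (y x t))) + integral {0..1} (\<lambda>t. f (y x t))"
      by (intro integral_add integrable_continuous_interval continuous_intros cont_yt D b cont_f)
    ultimately show ?thesis by simp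
  qed
  have "(antideriv b f has_derivative
      (\<lambda>h. (x \<bullet> b) * blinfun_apply (integral {0..1} (G x)) h + (h \<bullet> b) * integral {0..1} (\<lambda>t. f (y x t)))) (at x)"
    unfolding antideriv_def y_def[symmetric] by (rule has_derivative_mult[OF _ 3]) (auto intro!: derivative_eq_intros)
  moreover have "(x \<bullet> b) * blinfun_apply (integral {0..1} (G x)) h + (h \<bullet> b) * integral {0..1} (\<lambda>t. f (y x t)) =
      (\<Sum>c\<in>Basis. (h \<bullet> c) * (if c = b then f x else antideriv b (D c) x))" for h
  proof -
    have "(\<Sum>c\<in>Basis. (h \<bullet> c) * (if c = b then f x else antideriv b (D c) x)) =
        (\<Sum>c\<in>Basis. (x \<bullet> b) * ((h \<bullet> c) * integral {0..1} (\<lambda>t. (if c = b then t else 1) * D c (y x t)))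
          + (if c = b then (h \<bullet> b) * integral {0..1} (\<lambda>t. f (y x t)) else 0))"
      by (rule sum.cong) (auto simp: by_parts[symmetric] antideriv_def y_def algebra_simps)
    then show ?thesis
      using b by (simp add: int_G sum_distrib_left sum.distrib sum.delta)
  qed
  ultimately show ?thesis by (simp only:)
qed

text \<open>
  A weighted \<open>C\<^sup>k\<close> norm. A derivative of order \<open>j\<close> carries the factor \<open>p\<^sup>j\<close>, which makes integration
  small also with respect to the derivatives that it does not integrate.
\<close>

primrec ck_bound :: "nat \<Rightarrow> real \<Rightarrow> ('a::euclidean_space \<Rightarrow> real) \<Rightarrow> real \<Rightarrow> bool" where
  "ck_bound 0 p f M \<longleftrightarrow> continuous_on (cube p) f \<and> (\<forall>x\<in>cube p. \<bar>f x\<bar> \<le> M)"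
| "ck_bound (Suc k) p f M \<longleftrightarrow> (\<exists>M\<^sub>0 D N. (\<forall>x\<in>cube p. \<bar>f x\<bar> \<le> M\<^sub>0) \<and>
     (\<forall>x\<in>cube p. (f has_derivative (\<lambda>h. \<Sum>b\<in>Basis. (h \<bullet> b) * D b x)) (at x)) \<and>
     (\<forall>b\<in>Basis. ck_bound k p (D b) (N b)) \<and> M\<^sub>0 + p * (\<Sum>b\<in>Basis. N b) \<le> M)"

lemma ck_bound_SucI:
  assumes "\<And>x. x \<in> cube p \<Longrightarrow> \<bar>f x\<bar> \<le> M\<^sub>0"
    "\<And>x. x \<in> cube p \<Longrightarrow> (f has_derivative (\<lambda>h. \<Sum>b\<in>Basis. (h \<bullet> b) * D b x)) (at x)"
    "\<And>b. b \<in> Basis \<Longrightarrow> ck_bound k p (D b) (N b)" "M\<^sub>0 + p * (\<Sum>b\<in>Basis. N b) \<le> M"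
  shows "ck_bound (Suc k) p f M"
  unfolding ck_bound.simps using assms by blast

lemma ck_bound_SucE:
  assumes "ck_bound (Suc k) p f M"
  obtains M\<^sub>0 D N where "\<And>x. x \<in> cube p \<Longrightarrow> \<bar>f x\<bar> \<le> M\<^sub>0"
    "\<And>x. x \<in> cube p \<Longrightarrow> (f has_derivative (\<lambda>h. \<Sum>b\<in>Basis. (h \<bullet> b) * D b x)) (at x)"
    "\<And>b. b \<in> Basis \<Longrightarrow> ck_bound k p (D b) (N b)" "M\<^sub>0 + p * (\<Sum>b\<in>Basis. N b) \<le> M"
  using assms unfolding ck_bound.simps by blast

lemma ck_bound_nonneg: "0 < p \<Longrightarrow> ck_bound k p f M \<Longrightarrow> 0 \<le> M"
proof (induction k arbitrary: f M)
  case 0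
  then have "\<bar>f 0\<bar> \<le> M" by simp
  then show ?case by linarith
next
  case (Suc k)
  from Suc.prems(2) obtain M\<^sub>0 D N where *: "\<And>x. x \<in> cube p \<Longrightarrow> \<bar>f x\<bar> \<le> M\<^sub>0"
    "\<And>x. x \<in> cube p \<Longrightarrow> (f has_derivative (\<lambda>h. \<Sum>b\<in>Basis. (h \<bullet> b) * D b x)) (at x)"
    "\<And>b. b \<in> Basis \<Longrightarrow> ck_bound k p (D b) (N b)" "M\<^sub>0 + p * (\<Sum>b\<in>Basis. N b) \<le> M"
    unfolding ck_bound.simps by blast
  have "0 \<le> M\<^sub>0" using *(1)[of 0] Suc.prems(1) by simp
  moreover have "0 \<le> p * (\<Sum>b\<in>Basis. N b)"
    using Suc.IH Suc.prems(1) *(3) by (intro mult_nonneg_nonneg sum_nonneg) auto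
  ultimately show ?case using *(4) by linarith
qed

lemma ck_bound_abs_le:
  assumes "0 < p" "ck_bound k p f M" "x \<in> cube p"
  shows "\<bar>f x\<bar> \<le> M"
proof (cases k)
  case 0
  then show ?thesis using assms by simp
next
  case (Suc k')
  from assms(2)[unfolded Suc] obtain M\<^sub>0 D N where *: "\<And>x. x \<in> cube p \<Longrightarrow> \<bar>f x\<bar> \<le> M\<^sub>0"
    "\<And>x. x \<in> cube p \<Longrightarrow> (f has_derivative (\<lambda>h. \<Sum>b\<in>Basis. (h \<bullet> b) * D b x)) (at x)"
    "\<And>b. b \<in> Basis \<Longrightarrow> ck_bound k' p (D b) (N b)" "M\<^sub>0 + p * (\<Sum>b\<in>Basis. N b) \<le> M"
    unfolding ck_bound.simps by blast
  have "0 \<le> p * (\<Sum>b\<in>Basis. N b)"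
    using ck_bound_nonneg[OF assms(1) *(3)] assms(1) by (intro mult_nonneg_nonneg sum_nonneg) auto
  then show ?thesis using *(1)[OF assms(3)] *(4) by linarith
qed

lemma ck_bound_continuous: "ck_bound k p f M \<Longrightarrow> continuous_on (cube p) f"
proof (cases k)
  case (Suc k')
  assume "ck_bound k p f M"
  then obtain D where "\<forall>x\<in>cube p. (f has_derivative (\<lambda>h. \<Sum>b\<in>Basis. (h \<bullet> b) * D b x)) (at x)"
    unfolding Suc ck_bound.simps by blast
  then show ?thesis
    by (intro has_derivative_imp_continuous_on) blast
qed simp

lemma ck_bound_mono:
  "ck_bound k p f M \<Longrightarrow> 0 < q \<Longrightarrow> q \<le> p \<Longrightarrow> M \<le> M' \<Longrightarrow> ck_bound k q f M'"
proof (induction k arbitrary: f M M')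
  case 0
  then show ?case
    using cube_mono[of q p] by (auto intro: continuous_on_subset order_trans)
next
  case (Suc k)
  from Suc.prems(1) obtain M\<^sub>0 D N where *: "\<And>x. x \<in> cube p \<Longrightarrow> \<bar>f x\<bar> \<le> M\<^sub>0"
    "\<And>x. x \<in> cube p \<Longrightarrow> (f has_derivative (\<lambda>h. \<Sum>b\<in>Basis. (h \<bullet> b) * D b x)) (at x)"
    "\<And>b. b \<in> Basis \<Longrightarrow> ck_bound k p (D b) (N b)" "M\<^sub>0 + p * (\<Sum>b\<in>Basis. N b) \<le> M"
    unfolding ck_bound.simps by blast
  have "q * (\<Sum>b\<in>Basis. N b) \<le> p * (\<Sum>b\<in>Basis. N b)"
    using Suc.prems *(3) by (intro mult_right_mono sum_nonneg ck_bound_nonneg[of p]) auto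
  with *(4) Suc.prems(4) have "M\<^sub>0 + q * (\<Sum>b\<in>Basis. N b) \<le> M'" by linarith
  then show ?case
    using *(1,2) Suc.IH[OF *(3) Suc.prems(2,3) order_refl] cube_mono[OF Suc.prems(3)]
    by (intro ck_bound_SucI) auto
qed

lemma ck_bound_Suc_imp: "0 < p \<Longrightarrow> ck_bound (Suc k) p f M \<Longrightarrow> ck_bound k p f M"
proof (induction k arbitrary: f M)
  case 0
  show ?case
    using ck_bound_continuous[OF 0(2)] ck_bound_abs_le[OF 0] by auto
next
  case (Suc k)
  from Suc.prems(2) show ?case
  proof (rule ck_bound_SucE)
    fix M\<^sub>0 D N
    assume *: "\<And>x. x \<in> cube p \<Longrightarrow> \<bar>f x\<bar> \<le> M\<^sub>0"
      "\<And>x. x \<in> cube p \<Longrightarrow> (f has_derivative (\<lambda>h. \<Sum>b\<in>Basis. (h \<bullet> b) * D b x)) (at x)"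
      "\<And>b. b \<in> Basis \<Longrightarrow> ck_bound (Suc k) p (D b) (N b)" "M\<^sub>0 + p * (\<Sum>b\<in>Basis. N b) \<le> M"
    show ?thesis
      by (rule ck_bound_SucI[OF *(1,2) Suc.IH[OF Suc.prems(1) *(3)] *(4)])
  qed
qed

lemma ck_bound_le_order: "0 < p \<Longrightarrow> ck_bound k p f M \<Longrightarrow> j \<le> k \<Longrightarrow> ck_bound j p f M"
  by (rule dec_induct[of j k "\<lambda>n. ck_bound n p f M \<longrightarrow> ck_bound j p f M", THEN mp])
    (auto dest: ck_bound_Suc_imp simp del: ck_bound.simps)

lemma ck_bound_cong:
  assumes "ck_bound k p f M" "\<And>x. x \<in> cube p \<Longrightarrow> f x = h x"
  shows "ck_bound k p h M"
proof (cases k)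
  case 0
  then show ?thesis using assms by (auto cong: continuous_on_cong)
next
  case (Suc k')
  from assms(1)[unfolded Suc] show ?thesis
  proof (rule ck_bound_SucE)
    fix M\<^sub>0 D N
    assume *: "\<And>x. x \<in> cube p \<Longrightarrow> \<bar>f x\<bar> \<le> M\<^sub>0"
      "\<And>x. x \<in> cube p \<Longrightarrow> (f has_derivative (\<lambda>h. \<Sum>b\<in>Basis. (h \<bullet> b) * D b x)) (at x)"
      "\<And>b. b \<in> Basis \<Longrightarrow> ck_bound k' p (D b) (N b)" "M\<^sub>0 + p * (\<Sum>b\<in>Basis. N b) \<le> M"
    have "(h has_derivative (\<lambda>h. \<Sum>b\<in>Basis. (h \<bullet> b) * D b x)) (at x)" if "x \<in> cube p" for x
      using has_derivative_transform_within_open[OF *(2)[OF that] open_cube that] assms(2) by blast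
    then show ?thesis
      unfolding Suc using *(1) assms(2) by (intro ck_bound_SucI[OF _ _ *(3,4)]) auto
  qed
qed

lemma ck_bound_zero: "0 < p \<Longrightarrow> ck_bound k p (\<lambda>_. 0) 0"
proof (induction k)
  case (Suc k)
  then show ?case by (intro ck_bound_SucI[where D = "\<lambda>_ _. 0" and N = "\<lambda>_. 0" and M\<^sub>0 = 0]) auto
qed auto

lemma ck_bound_const: "0 < p \<Longrightarrow> ck_bound k p (\<lambda>_. a) \<bar>a\<bar>"
proof (cases k)
  case (Suc k')
  assume "0 < p"
  then show ?thesis unfolding Suc
    by (intro ck_bound_SucI[where D = "\<lambda>_ _. 0" and N = "\<lambda>_. 0" and M\<^sub>0 = "\<bar>a\<bar>"])
      (auto intro: ck_bound_zero)
qed auto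

lemma ck_bound_add: "ck_bound k p f M \<Longrightarrow> ck_bound k p h N \<Longrightarrow> ck_bound k p (\<lambda>x. f x + h x) (M + N)"
proof (induction k arbitrary: f h M N)
  case 0
  then show ?case by (auto intro!: continuous_intros order_trans[OF abs_triangle_ineq] add_mono)
next
  case (Suc k)
  from Suc.prems(1) show ?case
  proof (rule ck_bound_SucE)
    fix M\<^sub>0 D Nf
    assume f: "\<And>x. x \<in> cube p \<Longrightarrow> \<bar>f x\<bar> \<le> M\<^sub>0"
      "\<And>x. x \<in> cube p \<Longrightarrow> (f has_derivative (\<lambda>h. \<Sum>b\<in>Basis. (h \<bullet> b) * D b x)) (at x)"
      "\<And>b. b \<in> Basis \<Longrightarrow> ck_bound k p (D b) (Nf b)" "M\<^sub>0 + p * (\<Sum>b\<in>Basis. Nf b) \<le> M"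
    from Suc.prems(2) show ?case
    proof (rule ck_bound_SucE)
      fix N\<^sub>0 E Nh
      assume h: "\<And>x. x \<in> cube p \<Longrightarrow> \<bar>h x\<bar> \<le> N\<^sub>0"
        "\<And>x. x \<in> cube p \<Longrightarrow> (h has_derivative (\<lambda>h. \<Sum>b\<in>Basis. (h \<bullet> b) * E b x)) (at x)"
        "\<And>b. b \<in> Basis \<Longrightarrow> ck_bound k p (E b) (Nh b)" "N\<^sub>0 + p * (\<Sum>b\<in>Basis. Nh b) \<le> N"
      show ?thesis
      proof (rule ck_bound_SucI[OF _ _ Suc.IH[OF f(3) h(3)]])
        show "\<bar>f x + h x\<bar> \<le> M\<^sub>0 + N\<^sub>0" if "x \<in> cube p" for x
          using f(1) h(1) that by (intro order_trans[OF abs_triangle_ineq] add_mono) auto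
        show "((\<lambda>x. f x + h x) has_derivative (\<lambda>v. \<Sum>b\<in>Basis. (v \<bullet> b) * (D b x + E b x))) (at x)"
          if "x \<in> cube p" for x
          using has_derivative_add[OF f(2) h(2), OF that that] by (simp add: algebra_simps sum.distrib)
      qed (use f(4) h(4) in \<open>auto simp: sum.distrib algebra_simps\<close>)
    qed
  qed
qed

text \<open>The constant doubles with each order: the product rule gives two products, and both are
  estimated with the constant of the lower order and the full bound of the undifferentiated factor.
  The remaining sup bound \<open>M\<^sub>0 * N\<^sub>0\<close> is absorbed by the gap between
  \<open>N\<^sub>0\<close> and \<open>N\<close> and between \<open>M\<^sub>0\<close> and
  \<open>M\<close>.\<close>

lemma ck_bound_mult:
  "0 < p \<Longrightarrow> ck_bound k p f M \<Longrightarrow> ck_bound k p h N \<Longrightarrow> ck_bound k p (\<lambda>x. f x * h x) (2 ^ k * M * N)"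
proof (induction k arbitrary: f h M N)
  case 0
  then show ?case by (force intro!: continuous_intros mult_mono simp: abs_mult)
next
  case (Suc k)
  from Suc.prems(2) show ?case
  proof (rule ck_bound_SucE)
    fix M\<^sub>0 D Nf
    assume f: "\<And>x. x \<in> cube p \<Longrightarrow> \<bar>f x\<bar> \<le> M\<^sub>0"
      "\<And>x. x \<in> cube p \<Longrightarrow> (f has_derivative (\<lambda>h. \<Sum>b\<in>Basis. (h \<bullet> b) * D b x)) (at x)"
      "\<And>b. b \<in> Basis \<Longrightarrow> ck_bound k p (D b) (Nf b)" "M\<^sub>0 + p * (\<Sum>b\<in>Basis. Nf b) \<le> M"
    from Suc.prems(3) show ?case
    proof (rule ck_bound_SucE)
      fix N\<^sub>0 E Nh
      assume h: "\<And>x. x \<in> cube p \<Longrightarrow> \<bar>h x\<bar> \<le> N\<^sub>0"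
        "\<And>x. x \<in> cube p \<Longrightarrow> (h has_derivative (\<lambda>h. \<Sum>b\<in>Basis. (h \<bullet> b) * E b x)) (at x)"
        "\<And>b. b \<in> Basis \<Longrightarrow> ck_bound k p (E b) (Nh b)" "N\<^sub>0 + p * (\<Sum>b\<in>Basis. Nh b) \<le> N"
      have fk: "ck_bound k p f M" and hk: "ck_bound k p h N"
        using Suc.prems ck_bound_Suc_imp by blast+
      have nn: "0 \<le> M\<^sub>0" "0 \<le> N\<^sub>0" "0 \<le> M" "0 \<le> N"
        using f(1)[of 0] h(1)[of 0] Suc.prems(1) ck_bound_nonneg[OF Suc.prems(1) fk]
          ck_bound_nonneg[OF Suc.prems(1) hk] by simp_all
      have le: "M\<^sub>0 \<le> M" "N\<^sub>0 \<le> N"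
      proof -
        have "0 \<le> p * (\<Sum>b\<in>Basis. Nf b)" "0 \<le> p * (\<Sum>b\<in>Basis. Nh b)"
          using Suc.prems(1) ck_bound_nonneg[OF Suc.prems(1) f(3)] ck_bound_nonneg[OF Suc.prems(1) h(3)]
          by (auto intro!: mult_nonneg_nonneg sum_nonneg)
        then show "M\<^sub>0 \<le> M" "N\<^sub>0 \<le> N" using f(4) h(4) by linarith+
      qed
      show ?thesis
      proof (rule ck_bound_SucI)
        show "\<bar>f x * h x\<bar> \<le> M\<^sub>0 * N\<^sub>0" if "x \<in> cube p" for x
          unfolding abs_mult using f(1) h(1) that nn by (intro mult_mono) auto
        show "((\<lambda>x. f x * h x) has_derivative (\<lambda>v. \<Sum>b\<in>Basis. (v \<bullet> b) * (f x * E b x + D b x * h x))) (at x)"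
          if "x \<in> cube p" for x
          using has_derivative_mult[OF f(2) h(2), OF that that]
          by (simp add: algebra_simps sum.distrib sum_distrib_left)
        show "ck_bound k p (\<lambda>x. f x * E b x + D b x * h x) (2 ^ k * M * Nh b + 2 ^ k * Nf b * N)"
          if "b \<in> Basis" for b
          using that Suc.prems(1) fk hk f(3) h(3) by (intro ck_bound_add Suc.IH) auto
        have "M * (p * (\<Sum>b\<in>Basis. Nh b)) \<le> M * (N - N\<^sub>0)" "N * (p * (\<Sum>b\<in>Basis. Nf b)) \<le> N * (M - M\<^sub>0)"
          using nn f(4) h(4) by (auto intro!: mult_left_mono)
        then have "2 ^ k * (M * (p * (\<Sum>b\<in>Basis. Nh b)) + N * (p * (\<Sum>b\<in>Basis. Nf b)))
            \<le> 2 ^ k * (M * (N - N\<^sub>0) + N * (M - M\<^sub>0))"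
          by (intro mult_left_mono[OF add_mono]) auto
        moreover have "p * (\<Sum>b\<in>Basis. 2 ^ k * M * Nh b + 2 ^ k * Nf b * N) =
            2 ^ k * (M * (p * (\<Sum>b\<in>Basis. Nh b)) + N * (p * (\<Sum>b\<in>Basis. Nf b)))"
          by (simp add: sum.distrib sum_distrib_left sum_distrib_right algebra_simps)
        moreover have "M\<^sub>0 * N\<^sub>0 \<le> M\<^sub>0 * N" "M * N\<^sub>0 \<ge> 0" "1 * (M\<^sub>0 * N) \<le> 2 ^ k * (M\<^sub>0 * N)"
            "0 \<le> 2 ^ k * (M * N\<^sub>0)"
          using nn le by (intro mult_left_mono mult_right_mono mult_nonneg_nonneg one_le_power; simp)+
        ultimately show "M\<^sub>0 * N\<^sub>0 + p * (\<Sum>b\<in>Basis. 2 ^ k * M * Nh b + 2 ^ k * Nf b * N) \<le> 2 ^ Suc k * M * N"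
          by (simp add: algebra_simps)
      qed
    qed
  qed
qed

text \<open>A derivative along \<open>c \<noteq> b\<close> is again an antiderivative, of a function
  of lower order, and the induction hypothesis applies. The derivative along \<open>b\<close> is
  \<open>f\<close> itself, which gains nothing from integration; its weight \<open>p\<close> in the
  norm supplies the smallness and adds 1 to the constant.\<close>

lemma ck_bound_antideriv:
  assumes p: "0 < p" and b: "b \<in> Basis"
  shows "ck_bound k p f M \<Longrightarrow> ck_bound k p (antideriv b f) (real (Suc k) * p * M)"
proof (induction k arbitrary: f M)
  case 0
  have "continuous_on (cube p) (antideriv b f)"
  proof -
    have "continuous_on (cube p \<times> cbox (0::real) 1) (\<lambda>z. f (fst z - ((1 - snd z) * (fst z \<bullet> b)) *\<^sub>R b))"
    proof (rule continuous_on_compose2[of "cube p" f])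
      show "continuous_on (cube p) f" using 0 by simp
      show "continuous_on (cube p \<times> cbox 0 1) (\<lambda>z. fst z - ((1 - snd z) * (fst z \<bullet> b)) *\<^sub>R b)"
        by (intro continuous_intros)
    qed (auto intro!: slide_in_cube b)
    then have "continuous_on (cube p) (\<lambda>x. integral (cbox 0 1) (\<lambda>t. f (x - ((1 - t) * (x \<bullet> b)) *\<^sub>R b)))"
      by (intro integral_continuous_on_param) (simp add: split_beta)
    then show ?thesis unfolding antideriv_def by (intro continuous_intros) auto
  qed
  then show ?case using 0 antideriv_bound[of p f M _ b] b by auto
next
  case (Suc k)
  from Suc.prems show ?case
  proof (rule ck_bound_SucE)
    fix M\<^sub>0 D N
    assume f: "\<And>x. x \<in> cube p \<Longrightarrow> \<bar>f x\<bar> \<le> M\<^sub>0"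
      "\<And>x. x \<in> cube p \<Longrightarrow> (f has_derivative (\<lambda>h. \<Sum>b\<in>Basis. (h \<bullet> b) * D b x)) (at x)"
      "\<And>b. b \<in> Basis \<Longrightarrow> ck_bound k p (D b) (N b)" "M\<^sub>0 + p * (\<Sum>b\<in>Basis. N b) \<le> M"
    have contf: "continuous_on (cube p) f" using Suc.prems by (rule ck_bound_continuous)
    define E where "E c = (if c = b then f else antideriv b (D c))" for c
    \<comment> \<open>For \<open>c = b\<close> the second summand is slack; it gives the sum over
      all directions a single formula.\<close>
    define N' where "N' c = (if c = b then M else 0) + real (Suc k) * p * N c" for c
    have N: "0 \<le> N c" if "c \<in> Basis" for c using ck_bound_nonneg[OF p f(3)[OF that]] .
    show ?thesis
    proof (rule ck_bound_SucI)
      show "\<bar>antideriv b f x\<bar> \<le> p * M\<^sub>0" if "x \<in> cube p" for x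
        by (rule antideriv_bound[OF contf f(1) that b])
      show "(antideriv b f has_derivative (\<lambda>h. \<Sum>c\<in>Basis. (h \<bullet> c) * E c x)) (at x)" if "x \<in> cube p" for x
        using has_derivative_antideriv[OF f(2) ck_bound_continuous[OF f(3)] b that]
        by (simp add: E_def if_distribR)
      show "ck_bound k p (E c) (N' c)" if "c \<in> Basis" for c
      proof (cases "c = b")
        case True
        have "ck_bound k p f M" using ck_bound_Suc_imp p Suc.prems by blast
        then show ?thesis using True N[OF b] p
          by (auto simp: E_def N'_def intro!: ck_bound_mono[of k p f M])
      next
        case False
        then show ?thesis using Suc.IH[OF f(3)[OF that]] by (simp add: E_def N'_def)
      qed
      have "(\<Sum>c\<in>Basis. N' c) = M + real (Suc k) * p * (\<Sum>b\<in>Basis. N b)"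
        using b by (simp add: N'_def sum.distrib sum_distrib_left)
      then have "p * M\<^sub>0 + p * (\<Sum>c\<in>Basis. N' c) = p * (M\<^sub>0 + real (Suc k) * (p * (\<Sum>b\<in>Basis. N b)) + M)"
        by (simp add: algebra_simps)
      also have "\<dots> \<le> p * (real (Suc k) * (M\<^sub>0 + p * (\<Sum>b\<in>Basis. N b)) + M)"
      proof -
        have "0 \<le> M\<^sub>0" using f(1)[of 0] p by force
        then have "1 * M\<^sub>0 \<le> real (Suc k) * M\<^sub>0" by (intro mult_right_mono) auto
        then show ?thesis using p by (intro mult_left_mono) (auto simp: distrib_left)
      qed
      also have "\<dots> \<le> p * (real (Suc k) * M + M)"
        using p f(4) by (intro mult_left_mono add_mono) auto
      also have "\<dots> = real (Suc (Suc k)) * p * M" by (simp add: algebra_simps)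
      finally show "p * M\<^sub>0 + p * (\<Sum>c\<in>Basis. N' c) \<le> real (Suc (Suc k)) * p * M" .
    qed
  qed
qed

text \<open>Completeness of the weighted C^k norm: the series may be differentiated termwise, since
  the series of derivatives converges uniformly.\<close>

lemma ck_bound_suminf:
  fixes F :: "nat \<Rightarrow> 'a::euclidean_space \<Rightarrow> real"
  assumes p: "0 < p"
  shows "(\<And>n. ck_bound k p (F n) (M n)) \<Longrightarrow> summable M \<Longrightarrow> ck_bound k p (\<lambda>x. \<Sum>n. F n x) (\<Sum>n. M n)"
proof (induction k arbitrary: F M)
  case 0
  have unif: "uniform_limit (cube p) (\<lambda>n x. \<Sum>i<n. F i x) (\<lambda>x. \<Sum>i. F i x) sequentially"
    using 0 by (intro Weierstrass_m_test[of _ _ M]) auto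
  have "\<forall>\<^sub>F n in sequentially. continuous_on (cube p) (\<lambda>x. \<Sum>i<n. F i x)"
    using 0 by (auto intro!: always_eventually continuous_intros)
  then have "continuous_on (cube p) (\<lambda>x. \<Sum>i. F i x)"
    using uniform_limit_theorem[OF _ unif] by simp
  moreover have "\<bar>\<Sum>i. F i x\<bar> \<le> (\<Sum>n. M n)" if "x \<in> cube p" for x
    using norm_suminf_le[of "\<lambda>i. F i x" M] 0 that by auto
  ultimately show ?case by simp
next
  case (Suc k)
  \<comment> \<open>Every \<open>M n\<close> hides its own derivatives and its own splitting into
    partial bounds. After a choice for all \<open>n\<close>, these partial bounds are nonnegative
    and inherit summability from \<open>M\<close>.\<close>
  have "\<forall>n. \<exists>M\<^sub>0 D N. (\<forall>x\<in>cube p. \<bar>F n x\<bar> \<le> M\<^sub>0) \<and>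
     (\<forall>x\<in>cube p. (F n has_derivative (\<lambda>h. \<Sum>b\<in>Basis. (h \<bullet> b) * D b x)) (at x)) \<and>
     (\<forall>b\<in>Basis. ck_bound k p (D b) (N b)) \<and> M\<^sub>0 + p * (\<Sum>b\<in>Basis. N b) \<le> M n"
    using Suc.prems(1) unfolding ck_bound.simps by blast
  then obtain M\<^sub>0 D N where "\<forall>n. (\<forall>x\<in>cube p. \<bar>F n x\<bar> \<le> M\<^sub>0 n) \<and>
     (\<forall>x\<in>cube p. (F n has_derivative (\<lambda>h. \<Sum>b\<in>Basis. (h \<bullet> b) * D n b x)) (at x)) \<and>
     (\<forall>b\<in>Basis. ck_bound k p (D n b) (N n b)) \<and> M\<^sub>0 n + p * (\<Sum>b\<in>Basis. N n b) \<le> M n"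
    unfolding choice_iff by blast
  then have F: "\<And>n x. x \<in> cube p \<Longrightarrow> \<bar>F n x\<bar> \<le> M\<^sub>0 n"
     "\<And>n x. x \<in> cube p \<Longrightarrow> (F n has_derivative (\<lambda>h. \<Sum>b\<in>Basis. (h \<bullet> b) * D n b x)) (at x)"
     "\<And>n b. b \<in> Basis \<Longrightarrow> ck_bound k p (D n b) (N n b)"
     "\<And>n. M\<^sub>0 n + p * (\<Sum>b\<in>Basis. N n b) \<le> M n"
    by blast+
  have N: "0 \<le> N n b" if "b \<in> Basis" for n b using ck_bound_nonneg[OF p F(3)[OF that]] .
  have M\<^sub>0: "0 \<le> M\<^sub>0 n" for n using F(1)[of 0 n] p by force
  have sum_M\<^sub>0: "summable M\<^sub>0"
  proof (rule summable_comparison_test'[OF Suc.prems(2)])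
    fix n
    have "0 \<le> p * (\<Sum>b\<in>Basis. N n b)" using N p by (intro mult_nonneg_nonneg sum_nonneg) auto
    then show "norm (M\<^sub>0 n) \<le> M n" using M\<^sub>0[of n] F(4)[of n] by simp
  qed
  have sum_N: "summable (\<lambda>n. N n b)" if b: "b \<in> Basis" for b
  proof (rule summable_comparison_test'[OF summable_mult[OF Suc.prems(2), of "1 / p"]])
    fix n
    have "N n b \<le> (\<Sum>b\<in>Basis. N n b)" using N b by (intro member_le_sum) auto
    then have "p * N n b \<le> p * (\<Sum>b\<in>Basis. N n b)" using p by simp
    also have "\<dots> \<le> M n" using F(4)[of n] M\<^sub>0[of n] by linarith
    finally show "norm (N n b) \<le> 1 / p * M n" using p N[OF b] by (simp add: field_simps)
  qed
  define DD where "DD b x = (\<Sum>n. D n b x)" for b x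
  have conv: "(\<lambda>n. F n x) sums (\<Sum>n. F n x)" if "x \<in> cube p" for x
    using summable_comparison_test'[OF sum_M\<^sub>0, of 0 "\<lambda>n. F n x"] F(1)[OF that]
    by (simp add: summable_sums)
  have deriv: "((\<lambda>x. \<Sum>n. F n x) has_derivative (\<lambda>h. \<Sum>b\<in>Basis. (h \<bullet> b) * DD b x)) (at x)"
    if x: "x \<in> cube p" for x
  proof -
    have "\<exists>g. \<forall>x\<in>cube p. (\<lambda>n. F n x) sums g x \<and>
        (g has_derivative (\<lambda>h. \<Sum>b\<in>Basis. (h \<bullet> b) * DD b x)) (at x within cube p)"
    proof (rule has_derivative_series[where f = F
          and f' = "\<lambda>n x h. \<Sum>b\<in>Basis. (h \<bullet> b) * D n b x", OF convex_cube _ _ x conv[OF x]])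
      show "(F n has_derivative (\<lambda>h. \<Sum>b\<in>Basis. (h \<bullet> b) * D n b x)) (at x within cube p)"
        if "x \<in> cube p" for n x
        using F(2)[OF that] has_derivative_at_withinI by blast
    next
      fix e :: real assume e: "0 < e"
      \<comment> \<open>\<open>has_derivative_series\<close> wants convergence in operator norm,
        which is split evenly over the basis directions.\<close>
      define e' where "e' = e / DIM('a)"
      have e': "0 < e'" using e by (simp add: e'_def)
      have "\<forall>\<^sub>F n in sequentially. \<forall>x\<in>cube p. dist (\<Sum>i<n. D i b x) (DD b x) < e'" if "b \<in> Basis" for b
      proof -
        have "uniform_limit (cube p) (\<lambda>n x. \<Sum>i<n. D i b x) (DD b) sequentially"
          unfolding DD_def[abs_def]
          using sum_N[OF that] ck_bound_abs_le[OF p F(3)[OF that]] by (intro Weierstrass_m_test) auto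
        then show ?thesis using e' by (rule uniform_limitD)
      qed
      then have "\<forall>\<^sub>F n in sequentially. \<forall>b\<in>Basis. \<forall>x\<in>cube p. dist (\<Sum>i<n. D i b x) (DD b x) < e'"
        by (intro eventually_ball_finite) auto
      then show "\<forall>\<^sub>F n in sequentially. \<forall>x\<in>cube p. \<forall>h.
          norm ((\<Sum>i<n. \<Sum>b\<in>Basis. (h \<bullet> b) * D i b x) - (\<Sum>b\<in>Basis. (h \<bullet> b) * DD b x)) \<le> e * norm h"
      proof (rule eventually_mono, intro ballI allI)
        fix n and x h :: 'a
        assume n: "\<forall>b\<in>Basis. \<forall>x\<in>cube p. dist (\<Sum>i<n. D i b x) (DD b x) < e'" and x: "x \<in> cube p"
        have "(\<Sum>i<n. \<Sum>b\<in>Basis. (h \<bullet> b) * D i b x) - (\<Sum>b\<in>Basis. (h \<bullet> b) * DD b x) =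
            (\<Sum>b\<in>Basis. (h \<bullet> b) * ((\<Sum>i<n. D i b x) - DD b x))"
          by (subst sum.swap) (simp add: sum_distrib_left right_diff_distrib sum_subtractf)
        also have "norm \<dots> \<le> (\<Sum>b\<in>(Basis::'a set). norm h * e')"
        proof (rule sum_norm_le)
          fix b :: 'a assume b: "b \<in> Basis"
          have "\<bar>(\<Sum>i<n. D i b x) - DD b x\<bar> \<le> e'"
            using n b x by (force simp: dist_real_def)
          then show "norm ((h \<bullet> b) * ((\<Sum>i<n. D i b x) - DD b x)) \<le> norm h * e'"
            using Basis_le_norm[OF b, of h] by (auto simp: abs_mult intro!: mult_mono)
        qed
        also have "\<dots> = e * norm h" by (simp add: e'_def)
        finally show "norm ((\<Sum>i<n. \<Sum>b\<in>Basis. (h \<bullet> b) * D i b x) - (\<Sum>b\<in>Basis. (h \<bullet> b) * DD b x)) \<le> e * norm h" .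
      qed
    qed
    then obtain g where g: "\<And>y. y \<in> cube p \<Longrightarrow> (\<lambda>n. F n y) sums g y"
      "(g has_derivative (\<lambda>h. \<Sum>b\<in>Basis. (h \<bullet> b) * DD b x)) (at x within cube p)"
      using x by blast
    have "(g has_derivative (\<lambda>h. \<Sum>b\<in>Basis. (h \<bullet> b) * DD b x)) (at x)"
      using g(2) x by (simp add: at_within_open[OF _ open_cube])
    then show ?thesis
      by (rule has_derivative_transform_within_open[OF _ open_cube x]) (use g(1) in \<open>auto simp: sums_iff\<close>)
  qed
  show ?case
  proof (rule ck_bound_SucI[OF _ deriv])
    show "\<bar>\<Sum>n. F n x\<bar> \<le> (\<Sum>n. M\<^sub>0 n)" if "x \<in> cube p" for x
      using norm_suminf_le[of "\<lambda>n. F n x" M\<^sub>0] F(1)[OF that] sum_M\<^sub>0 by auto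
    show "ck_bound k p (DD b) (\<Sum>n. N n b)" if "b \<in> Basis" for b
      unfolding DD_def[abs_def] using Suc.IH[OF F(3)[OF that] sum_N[OF that]] .
    have "(\<Sum>n. M\<^sub>0 n) + p * (\<Sum>b\<in>Basis. \<Sum>n. N n b) = (\<Sum>n. M\<^sub>0 n + p * (\<Sum>b\<in>Basis. N n b))"
      using sum_M\<^sub>0 sum_N
      by (simp add: suminf_sum[symmetric] suminf_mult[symmetric] suminf_add summable_sum summable_mult)
    also have "\<dots> \<le> (\<Sum>n. M n)"
      using sum_M\<^sub>0 sum_N F(4) Suc.prems(2)
      by (intro suminf_le) (auto intro!: summable_add summable_mult summable_sum)
    finally show "(\<Sum>n. M\<^sub>0 n) + p * (\<Sum>b\<in>Basis. \<Sum>n. N n b) \<le> (\<Sum>n. M n)" .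
  qed
qed

text \<open>\<open>ck_bound\<close> by itself holds vacuously on the empty cube of a nonpositive
  scale, hence the conjunct \<open>0 < p\<close>.\<close>

lemma function_scale_ck:
  "function_scale (\<lambda>p f M. 0 < p \<and> ck_bound k p f M) (2 ^ k) (real (Suc k))"
  by unfold_locales
    (auto simp del: ck_bound.simps of_nat_Suc
      intro: ck_bound_mono ck_bound_cong ck_bound_const ck_bound_add ck_bound_mult ck_bound_antideriv
        ck_bound_suminf ck_bound_abs_le ck_bound_continuous)

section \<open>Comparison of the weighted norm with the class \<open>C_k_on\<close>\<close>

lemma C_k_on_cong:
  assumes "open U"
  shows "(\<And>x. x \<in> U \<Longrightarrow> f x = h x) \<Longrightarrow> C_k_on k U f \<Longrightarrow> C_k_on k U h"
proof (induction k arbitrary: f h)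
  case 0
  then show ?case by (simp cong: continuous_on_cong)
next
  case (Suc k)
  have eq: "(f has_derivative D) (at P) \<longleftrightarrow> (h has_derivative D) (at P)" if "P \<in> U" for P D
    using has_derivative_transform_within_open[OF _ assms that] Suc.prems(1) by metis
  then have "frechet_derivative f (at P) = frechet_derivative h (at P)" if "P \<in> U" for P
    using that by (simp add: frechet_derivative_def)
  then show ?case
    using Suc.prems(2) Suc.IH[of "\<lambda>P. frechet_derivative f (at P) v" "\<lambda>P. frechet_derivative h (at P) v" for v] eq
    by (simp add: differentiable_def)
qed

text \<open>\<open>C_k_on\<close> asks for derivatives in all directions \<open>v\<close>, while
  \<open>ck_bound\<close> records those along the basis; the others are finite linear combinations
  of these.\<close>

lemma ck_bound_imp_C_k_on: "0 < p \<Longrightarrow> ck_bound k p f M \<Longrightarrow> C_k_on k (cube p) f"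
proof (induction k arbitrary: f M)
  case (Suc k)
  from Suc.prems(2) show ?case
  proof (rule ck_bound_SucE)
    fix M\<^sub>0 D N
    assume f: "\<And>x. x \<in> cube p \<Longrightarrow> (f has_derivative (\<lambda>h. \<Sum>b\<in>Basis. (h \<bullet> b) * D b x)) (at x)"
      "\<And>b. b \<in> Basis \<Longrightarrow> ck_bound k p (D b) (N b)"
    have sum: "ck_bound k p (\<lambda>x. \<Sum>b\<in>S. (v \<bullet> b) * D b x) (\<Sum>b\<in>S. 2 ^ k * \<bar>v \<bullet> b\<bar> * N b)"
      if "finite S" "S \<subseteq> Basis" for v S
      using that
    proof (induction S)
      case empty
      show ?case using ck_bound_zero[OF Suc.prems(1)] by simp
    next
      case (insert b S)
      then have "ck_bound k p (\<lambda>x. (v \<bullet> b) * D b x) (2 ^ k * \<bar>v \<bullet> b\<bar> * N b)"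
        using ck_bound_mult[OF Suc.prems(1) ck_bound_const[OF Suc.prems(1)] f(2)] by simp
      then show ?case using insert ck_bound_add by auto
    qed
    have "C_k_on k (cube p) (\<lambda>P. frechet_derivative f (at P) v)" for v
    proof (rule C_k_on_cong[OF open_cube])
      show "C_k_on k (cube p) (\<lambda>x. \<Sum>b\<in>Basis. (v \<bullet> b) * D b x)"
        by (rule Suc.IH[OF Suc.prems(1), of _ "\<Sum>b\<in>Basis. 2 ^ k * \<bar>v \<bullet> b\<bar> * N b"])
          (rule sum[OF finite_Basis order_refl])
      show "(\<Sum>b\<in>Basis. (v \<bullet> b) * D b x) = frechet_derivative f (at x) v" if "x \<in> cube p" for x
        using fun_cong[OF frechet_derivative_at[OF f(1)[OF that]]] .
    qed
    then show ?thesis using f(1) by (auto simp: differentiable_def)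
  qed
qed auto

text \<open>Bounds exist because the closed cube is compact and \<open>f\<close> is regular on all
  of it. The scale 1 is arbitrary.\<close>

lemma C_k_on_imp_ck_bound:
  fixes f :: "'a::euclidean_space \<Rightarrow> real"
  shows "C_k_on k UNIV f \<Longrightarrow> \<exists>M. ck_bound k 1 f M"
proof (induction k arbitrary: f)
  case 0
  have "bounded (f ` cbox (- One) One)"
    using 0 by (intro compact_imp_bounded compact_continuous_image) (auto intro: continuous_on_subset)
  moreover have "cube 1 \<subseteq> cbox (- One) (One :: 'a)"
    using box_subset_cbox[of "- One" "One :: 'a"] by (simp add: cube_eq_box)
  ultimately have "bounded (f ` cube 1)" by (meson bounded_subset image_mono)
  then show ?case using 0 by (auto simp: bounded_iff intro: continuous_on_subset)
next
  case (Suc k)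
  let ?D = "\<lambda>b P. frechet_derivative f (at P) b"
  have D: "(f has_derivative (\<lambda>h. \<Sum>b\<in>Basis. (h \<bullet> b) * ?D b P)) (at P)" for P
  proof -
    have *: "(f has_derivative frechet_derivative f (at P)) (at P)"
      using Suc.prems frechet_derivative_works by auto
    interpret linear "frechet_derivative f (at P)" using has_derivative_linear[OF *] .
    have "frechet_derivative f (at P) (\<Sum>b\<in>Basis. (h \<bullet> b) *\<^sub>R b) = (\<Sum>b\<in>Basis. (h \<bullet> b) * ?D b P)" for h
      unfolding sum scale by simp
    then have "frechet_derivative f (at P) = (\<lambda>h. \<Sum>b\<in>Basis. (h \<bullet> b) * ?D b P)"
      unfolding euclidean_representation by blast
    then show ?thesis using * by metis
  qed
  have "continuous_on UNIV f"
    using D by (rule has_derivative_imp_continuous_on)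
  then have "bounded (f ` cbox (- One) One)"
    by (intro compact_imp_bounded compact_continuous_image) (auto intro: continuous_on_subset)
  moreover have "cube 1 \<subseteq> cbox (- One) (One :: 'a)"
    using box_subset_cbox[of "- One" "One :: 'a"] by (simp add: cube_eq_box)
  ultimately obtain M\<^sub>0 where "\<forall>x\<in>cube 1. \<bar>f x\<bar> \<le> M\<^sub>0"
    unfolding bounded_iff by fastforce
  moreover have "\<exists>N. ck_bound k 1 (?D b) N" for b
    using Suc.IH[of "?D b"] Suc.prems by simp
  then obtain N where "\<And>b. ck_bound k 1 (?D b) (N b)"
    by metis
  ultimately show ?case
    using D by (intro exI[of _ "M\<^sub>0 + 1 * (\<Sum>b\<in>Basis. N b)"]
        ck_bound_SucI[where M\<^sub>0 = M\<^sub>0 and D = ?D and N = N]) auto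
qed

section \<open>Power series\<close>

lemma summable_on_real_comparison:
  fixes f g :: "'i \<Rightarrow> real"
  assumes "g summable_on I" "\<And>i. i \<in> I \<Longrightarrow> \<bar>f i\<bar> \<le> g i"
  shows "f summable_on I"
  by (rule abs_summable_summable[OF Infinite_Sum.abs_summable_on_comparison_test'[OF assms(1)]])
    (use assms(2) in auto)

lemma abs_has_sum_le:
  fixes f g :: "'i \<Rightarrow> real"
  assumes "(f has_sum S) I" "(g has_sum N) I" "\<And>i. i \<in> I \<Longrightarrow> \<bar>f i\<bar> \<le> g i"
  shows "\<bar>S\<bar> \<le> N"
proof -
  have "S \<le> N" by (rule has_sum_mono[OF assms(1,2)]) (use assms(3) in fastforce)
  moreover have "- S \<le> N"
    by (rule has_sum_mono[OF has_sum_uminusI[OF assms(1)] assms(2)]) (use assms(3) in fastforce)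
  ultimately show ?thesis by linarith
qed

text \<open>Regroups an unconditionally convergent sum by the value of \<open>e\<close>, the fibers
  being possibly infinite. It serves to collect the terms of a series that have the same
  exponent.\<close>

lemma has_sum_fibers:
  fixes h :: "'i \<Rightarrow> real"
  assumes h: "(h has_sum S) I" and e: "\<And>i. i \<in> I \<Longrightarrow> e i \<in> T"
  shows "((\<lambda>\<alpha>. infsum h {i \<in> I. e i = \<alpha>}) has_sum S) T"
proof (rule has_sum_SigmaD[where f = "\<lambda>(\<alpha>, i). h i"])
  show "((\<lambda>(\<alpha>, i). h i) has_sum S) (Sigma T (\<lambda>\<alpha>. {i \<in> I. e i = \<alpha>}))"
    using h by (rule has_sum_reindex_bij_witness[where i = snd and j = "\<lambda>i. (e i, i)", THEN iffD1, rotated -1])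
      (use e in auto)
  show "((\<lambda>i. case (\<alpha>, i) of (\<alpha>, i) \<Rightarrow> h i) has_sum infsum h {i \<in> I. e i = \<alpha>}) {i \<in> I. e i = \<alpha>}" for \<alpha>
    using summable_on_subset_banach[OF has_sum_imp_summable[OF h], of "{i \<in> I. e i = \<alpha>}"] by auto
qed

text \<open>Unconditional convergence of real sums is absolute, so the products are summable over
  the whole rectangle.\<close>

lemma has_sum_product_real:
  fixes f :: "'i \<Rightarrow> real" and h :: "'j \<Rightarrow> real"
  assumes "(f has_sum S) I" "(h has_sum T) J"
  shows "((\<lambda>(i, j). f i * h j) has_sum S * T) (I \<times> J)"
proof (rule has_sum_SigmaI)
  show "((\<lambda>j. case (i, j) of (i, j) \<Rightarrow> f i * h j) has_sum f i * T) J" for i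
    using has_sum_cmult_right[OF assms(2)] by simp
  show "((\<lambda>i. f i * T) has_sum S * T) I"
    using has_sum_cmult_left[OF assms(1)] .
  have f: "(\<lambda>i. \<bar>f i\<bar>) summable_on I" and h: "(\<lambda>i. \<bar>h i\<bar>) summable_on J"
    using assms summable_on_iff_abs_summable_on_real has_sum_imp_summable by fastforce+
  have "(\<lambda>(i, j). \<bar>f i\<bar> * \<bar>h j\<bar>) summable_on I \<times> J"
  proof (rule summable_on_SigmaI)
    show "((\<lambda>j. case (i, j) of (i, j) \<Rightarrow> \<bar>f i\<bar> * \<bar>h j\<bar>) has_sum \<bar>f i\<bar> * infsum (\<lambda>i. \<bar>h i\<bar>) J) J" for i
      using has_sum_cmult_right[OF has_sum_infsum[OF h]] by simp
    show "(\<lambda>i. \<bar>f i\<bar> * infsum (\<lambda>i. \<bar>h i\<bar>) J) summable_on I"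
      using f by (rule summable_on_cmult_left)
  qed auto
  then show "(\<lambda>(i, j). f i * h j) summable_on I \<times> J"
    by (rule summable_on_real_comparison) (auto simp: abs_mult)
qed

section \<open>Monomials and the weighted norm of power series\<close>

definition monomial :: "('a::euclidean_space \<Rightarrow> nat) \<Rightarrow> 'a \<Rightarrow> real" where
  "monomial \<alpha> y = (\<Prod>b\<in>Basis. (y \<bullet> b) ^ \<alpha> b)"

definition total_degree :: "('a::euclidean_space \<Rightarrow> nat) \<Rightarrow> nat" where
  "total_degree \<alpha> = (\<Sum>b\<in>Basis. \<alpha> b)"

lemma monomial_diag: "monomial \<alpha> (\<rho> *\<^sub>R One) = \<rho> ^ total_degree \<alpha>"
  by (simp add: monomial_def total_degree_def power_sum)

lemma abs_monomial_le: "y \<in> cube \<rho> \<Longrightarrow> \<bar>monomial \<alpha> y\<bar> \<le> \<rho> ^ total_degree \<alpha>"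
  unfolding monomial_def total_degree_def power_sum abs_prod power_abs
  by (intro prod_mono) (auto simp: cube_def intro!: power_mono dest: order_less_imp_le)

lemma monomial_add: "monomial (\<lambda>b. \<alpha> b + \<beta> b) y = monomial \<alpha> y * monomial \<beta> y"
  by (simp add: monomial_def power_add prod.distrib)

lemma total_degree_add: "total_degree (\<lambda>b. \<alpha> b + \<beta> b) = total_degree \<alpha> + total_degree \<beta>"
  by (simp add: total_degree_def sum.distrib)

lemma monomial_Suc:
  assumes "b \<in> Basis"
  shows "monomial (\<alpha>(b := Suc (\<alpha> b))) y = (y \<bullet> b) * monomial \<alpha> y"
proof -
  have "monomial (\<alpha>(b := Suc (\<alpha> b))) y = monomial (\<lambda>c. \<alpha> c + (if c = b then 1 else 0)) y"
    by (rule arg_cong[of _ _ "\<lambda>\<beta>. monomial \<beta> y"]) auto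
  also have "\<dots> = monomial \<alpha> y * (\<Prod>c\<in>Basis. if c = b then y \<bullet> b else 1)"
  proof -
    have "monomial (\<lambda>c. if c = b then 1 else 0) y = (\<Prod>c\<in>Basis. if c = b then y \<bullet> b else 1)"
      unfolding monomial_def by (rule prod.cong) auto
    then show ?thesis unfolding monomial_add by simp
  qed
  finally show ?thesis using assms by (simp add: prod.delta)
qed

lemma total_degree_Suc:
  assumes "b \<in> Basis"
  shows "total_degree (\<alpha>(b := Suc (\<alpha> b))) = Suc (total_degree \<alpha>)"
proof -
  have "total_degree (\<alpha>(b := Suc (\<alpha> b))) = (\<Sum>c\<in>Basis. \<alpha> c + (if c = b then 1 else 0))"
    unfolding total_degree_def by (rule sum.cong) auto
  then show ?thesis using assms by (simp add: total_degree_def sum.distrib)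
qed

text \<open>The weighted \<ell>^1 norm of the Taylor coefficients about \<open>P\<close>; the weight
  of a coefficient is the supremum of its monomial on the cube. The fixed point argument takes place
  at \<open>P = 0\<close>, while other centers are needed because analyticity demands an expansion
  about every point.\<close>

definition ps_bound :: "'a::euclidean_space \<Rightarrow> real \<Rightarrow> ('a \<Rightarrow> real) \<Rightarrow> real \<Rightarrow> bool" where
  "ps_bound P \<rho> f M \<longleftrightarrow> 0 < \<rho> \<and> (\<exists>c N.
     ((\<lambda>\<alpha>. \<bar>c \<alpha>\<bar> * \<rho> ^ total_degree \<alpha>) has_sum N) multi_indices \<and> N \<le> M \<and>
     (\<forall>y\<in>cube \<rho>. ((\<lambda>\<alpha>. c \<alpha> * monomial \<alpha> y) has_sum f (P + y)) multi_indices))"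

text \<open>
  Since exponents may be repeated here, products and sums of series need no explicit formula for
  their coefficients.
\<close>

lemma ps_bound_family:
  fixes e :: "'i \<Rightarrow> 'a::euclidean_space \<Rightarrow> nat"
  assumes \<rho>: "0 < \<rho>" and e: "\<And>i. i \<in> I \<Longrightarrow> e i \<in> multi_indices"
    and N: "((\<lambda>i. \<bar>a i\<bar> * \<rho> ^ total_degree (e i)) has_sum N) I" "N \<le> M"
    and f: "\<And>y. y \<in> cube \<rho> \<Longrightarrow> ((\<lambda>i. a i * monomial (e i) y) has_sum f (P + y)) I"
  shows "ps_bound P \<rho> f M"
proof -
  define J where "J \<alpha> = {i \<in> I. e i = \<alpha>}" for \<alpha>
  define c where "c \<alpha> = infsum a (J \<alpha>)" for \<alpha>
  have c: "((\<lambda>\<alpha>. c \<alpha> * monomial \<alpha> y) has_sum f (P + y)) multi_indices" if "y \<in> cube \<rho>" for y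
  proof -
    have "infsum (\<lambda>i. a i * monomial (e i) y) (J \<alpha>) = c \<alpha> * monomial \<alpha> y" for \<alpha>
      unfolding c_def infsum_cmult_left'[symmetric] by (rule infsum_cong) (simp add: J_def)
    then show ?thesis using has_sum_fibers[where e = e, OF f[OF that] e, folded J_def] by simp
  qed
  have "infsum (\<lambda>i. \<bar>a i\<bar> * \<rho> ^ total_degree (e i)) (J \<alpha>) = infsum (\<lambda>i. \<bar>a i\<bar>) (J \<alpha>) * \<rho> ^ total_degree \<alpha>" for \<alpha>
    unfolding infsum_cmult_left'[symmetric] by (rule infsum_cong) (simp add: J_def)
  then have N': "((\<lambda>\<alpha>. infsum (\<lambda>i. \<bar>a i\<bar>) (J \<alpha>) * \<rho> ^ total_degree \<alpha>) has_sum N) multi_indices"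
    using has_sum_fibers[where e = e, OF N(1) e, folded J_def] by simp
  have c_le: "\<bar>c \<alpha>\<bar> * \<rho> ^ total_degree \<alpha> \<le> infsum (\<lambda>i. \<bar>a i\<bar>) (J \<alpha>) * \<rho> ^ total_degree \<alpha>" for \<alpha>
  proof -
    have "(\<lambda>i. \<bar>a i\<bar> * \<rho> ^ total_degree (e i)) summable_on J \<alpha>"
      using summable_on_subset_banach[OF has_sum_imp_summable[OF N(1)]] by (auto simp: J_def)
    also have "?this \<longleftrightarrow> (\<lambda>i. \<bar>a i\<bar> * \<rho> ^ total_degree \<alpha>) summable_on J \<alpha>"
      by (rule summable_on_cong) (simp add: J_def)
    finally have "(\<lambda>i. \<bar>a i\<bar>) summable_on J \<alpha>"
      using \<rho> by (simp add: summable_on_cmult_left')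
    then have "\<bar>c \<alpha>\<bar> \<le> infsum (\<lambda>i. \<bar>a i\<bar>) (J \<alpha>)"
      using norm_infsum_bound[of a "J \<alpha>"] by (simp add: c_def)
    then show ?thesis using \<rho> by (simp add: mult_right_mono)
  qed
  have "(\<lambda>\<alpha>. \<bar>c \<alpha>\<bar> * \<rho> ^ total_degree \<alpha>) summable_on multi_indices"
    by (rule summable_on_real_comparison[OF has_sum_imp_summable[OF N']]) (use c_le \<rho> in \<open>auto simp: abs_mult\<close>)
  then obtain N'' where N'': "((\<lambda>\<alpha>. \<bar>c \<alpha>\<bar> * \<rho> ^ total_degree \<alpha>) has_sum N'') multi_indices"
    using has_sum_infsum by blast
  have "N'' \<le> N" using has_sum_mono[OF N'' N'] c_le by blast
  then show ?thesis
    unfolding ps_bound_def using \<rho> N'' N(2) c by (intro conjI exI[of _ c] exI[of _ N'']) auto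
qed

lemma ps_bound_abs_le:
  assumes "ps_bound P \<rho> f M" "y \<in> cube \<rho>"
  shows "\<bar>f (P + y)\<bar> \<le> M"
proof -
  obtain c N where c: "((\<lambda>\<alpha>. \<bar>c \<alpha>\<bar> * \<rho> ^ total_degree \<alpha>) has_sum N) multi_indices" "N \<le> M"
    "\<And>y. y \<in> cube \<rho> \<Longrightarrow> ((\<lambda>\<alpha>. c \<alpha> * monomial \<alpha> y) has_sum f (P + y)) multi_indices"
    using assms(1) unfolding ps_bound_def by blast
  have "\<bar>f (P + y)\<bar> \<le> N"
    by (rule abs_has_sum_le[OF c(3)[OF assms(2)] c(1)])
      (use abs_monomial_le[OF assms(2)] in \<open>auto simp: abs_mult intro: mult_left_mono\<close>)
  then show ?thesis using c(2) by simp
qed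

lemma ps_bound_nonneg: "ps_bound P \<rho> f M \<Longrightarrow> 0 \<le> M"
  using ps_bound_abs_le[of P \<rho> f M 0] by (force simp: ps_bound_def)

lemma ps_bound_mono:
  assumes "ps_bound P \<rho> f M" "0 < r" "r \<le> \<rho>" "M \<le> M'"
  shows "ps_bound P r f M'"
proof -
  obtain c N where c: "((\<lambda>\<alpha>. \<bar>c \<alpha>\<bar> * \<rho> ^ total_degree \<alpha>) has_sum N) multi_indices" "N \<le> M"
    "\<And>y. y \<in> cube \<rho> \<Longrightarrow> ((\<lambda>\<alpha>. c \<alpha> * monomial \<alpha> y) has_sum f (P + y)) multi_indices"
    using assms(1) unfolding ps_bound_def by blast
  have le: "\<bar>c \<alpha>\<bar> * r ^ total_degree \<alpha> \<le> \<bar>c \<alpha>\<bar> * \<rho> ^ total_degree \<alpha>" for \<alpha>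
    using assms by (intro mult_left_mono power_mono) auto
  have "(\<lambda>\<alpha>. \<bar>c \<alpha>\<bar> * r ^ total_degree \<alpha>) summable_on multi_indices"
    by (rule summable_on_real_comparison[OF has_sum_imp_summable[OF c(1)]])
      (use le assms in \<open>auto simp: abs_mult\<close>)
  then obtain N' where N': "((\<lambda>\<alpha>. \<bar>c \<alpha>\<bar> * r ^ total_degree \<alpha>) has_sum N') multi_indices"
    using has_sum_infsum by blast
  have "N' \<le> M'" using has_sum_mono[OF N' c(1) le] c(2) assms(4) by simp
  then show ?thesis
    using N' c(3) cube_mono[OF assms(3)] assms(2) unfolding ps_bound_def by blast
qed

lemma ps_bound_cong:
  assumes "ps_bound P \<rho> f M" "\<And>y. y \<in> cube \<rho> \<Longrightarrow> f (P + y) = h (P + y)"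
  shows "ps_bound P \<rho> h M"
  using assms unfolding ps_bound_def by auto

lemma ps_bound_const:
  assumes "0 < \<rho>"
  shows "ps_bound P \<rho> (\<lambda>_. a) \<bar>a\<bar>"
  by (rule ps_bound_family[where I = "{()}" and e = "\<lambda>_ _. 0" and a = "\<lambda>_. a" and N = "\<bar>a\<bar>"])
    (use assms in \<open>auto simp: multi_indices_def monomial_def total_degree_def intro!: has_sum_finiteI\<close>)

lemma ps_bound_coordinate:
  assumes "0 < \<rho>" "b \<in> Basis"
  shows "ps_bound P \<rho> (\<lambda>x. (x - P) \<bullet> b) \<rho>"
proof (rule ps_bound_family[where I = "{()}" and e = "\<lambda>_. (\<lambda>_. 0)(b := Suc 0)" and a = "\<lambda>_. 1" and N = \<rho>])
  have 1: "total_degree ((\<lambda>_. 0)(b := Suc 0)) = 1"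
    using total_degree_Suc[OF assms(2), of "\<lambda>_. 0"] by (simp add: total_degree_def)
  have 2: "monomial ((\<lambda>_. 0)(b := Suc 0)) y = y \<bullet> b" for y
    using monomial_Suc[OF assms(2), of "\<lambda>_. 0"] by (simp add: monomial_def)
  show "((\<lambda>i. \<bar>1\<bar> * \<rho> ^ total_degree ((\<lambda>_. 0)(b := Suc 0))) has_sum \<rho>) {()}"
    unfolding 1 by (intro has_sum_finiteI) auto
  show "((\<lambda>i. 1 * monomial ((\<lambda>_. 0)(b := Suc 0)) y) has_sum (P + y - P) \<bullet> b) {()}" for y
    unfolding 2 by (intro has_sum_finiteI) auto
qed (use assms in \<open>auto simp: multi_indices_def\<close>)

lemma ps_bound_add:
  assumes "ps_bound P \<rho> f M" "ps_bound P \<rho> h M'"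
  shows "ps_bound P \<rho> (\<lambda>x. f x + h x) (M + M')"
proof -
  have \<rho>: "0 < \<rho>" using assms(1) by (simp add: ps_bound_def)
  obtain c N where c: "((\<lambda>\<alpha>. \<bar>c \<alpha>\<bar> * \<rho> ^ total_degree \<alpha>) has_sum N) multi_indices" "N \<le> M"
    "\<And>y. y \<in> cube \<rho> \<Longrightarrow> ((\<lambda>\<alpha>. c \<alpha> * monomial \<alpha> y) has_sum f (P + y)) multi_indices"
    using assms(1) unfolding ps_bound_def by blast
  obtain d N' where d: "((\<lambda>\<alpha>. \<bar>d \<alpha>\<bar> * \<rho> ^ total_degree \<alpha>) has_sum N') multi_indices" "N' \<le> M'"
    "\<And>y. y \<in> cube \<rho> \<Longrightarrow> ((\<lambda>\<alpha>. d \<alpha> * monomial \<alpha> y) has_sum h (P + y)) multi_indices"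
    using assms(2) unfolding ps_bound_def by blast
  have le: "\<bar>c \<alpha> + d \<alpha>\<bar> * \<rho> ^ total_degree \<alpha> \<le> \<bar>c \<alpha>\<bar> * \<rho> ^ total_degree \<alpha> + \<bar>d \<alpha>\<bar> * \<rho> ^ total_degree \<alpha>" for \<alpha>
    unfolding distrib_right[symmetric] using \<rho> by (intro mult_right_mono) auto
  have sum: "((\<lambda>\<alpha>. \<bar>c \<alpha>\<bar> * \<rho> ^ total_degree \<alpha> + \<bar>d \<alpha>\<bar> * \<rho> ^ total_degree \<alpha>) has_sum N + N') multi_indices"
    using has_sum_add[OF c(1) d(1)] .
  have "(\<lambda>\<alpha>. \<bar>c \<alpha> + d \<alpha>\<bar> * \<rho> ^ total_degree \<alpha>) summable_on multi_indices"
    by (rule summable_on_real_comparison[OF has_sum_imp_summable[OF sum]])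
      (use le \<rho> in \<open>auto simp: abs_mult\<close>)
  then obtain N'' where N'': "((\<lambda>\<alpha>. \<bar>c \<alpha> + d \<alpha>\<bar> * \<rho> ^ total_degree \<alpha>) has_sum N'') multi_indices"
    using has_sum_infsum by blast
  show ?thesis
  proof (rule ps_bound_family[where e = "\<lambda>\<alpha>. \<alpha>", OF \<rho> _ N''])
    show "N'' \<le> M + M'" using has_sum_mono[OF N'' sum le] c(2) d(2) by simp
    show "((\<lambda>\<alpha>. (c \<alpha> + d \<alpha>) * monomial \<alpha> y) has_sum f (P + y) + h (P + y)) multi_indices"
      if "y \<in> cube \<rho>" for y
      using has_sum_add[OF c(3) d(3), OF that that] by (simp add: distrib_right)
  qed
qed

lemma ps_bound_mult:
  assumes "ps_bound P \<rho> f M" "ps_bound P \<rho> h M'"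
  shows "ps_bound P \<rho> (\<lambda>x. f x * h x) (M * M')"
proof -
  have \<rho>: "0 < \<rho>" using assms(1) by (simp add: ps_bound_def)
  obtain c N where c: "((\<lambda>\<alpha>. \<bar>c \<alpha>\<bar> * \<rho> ^ total_degree \<alpha>) has_sum N) multi_indices" "N \<le> M"
    "\<And>y. y \<in> cube \<rho> \<Longrightarrow> ((\<lambda>\<alpha>. c \<alpha> * monomial \<alpha> y) has_sum f (P + y)) multi_indices"
    using assms(1) unfolding ps_bound_def by blast
  obtain d N' where d: "((\<lambda>\<alpha>. \<bar>d \<alpha>\<bar> * \<rho> ^ total_degree \<alpha>) has_sum N') multi_indices" "N' \<le> M'"
    "\<And>y. y \<in> cube \<rho> \<Longrightarrow> ((\<lambda>\<alpha>. d \<alpha> * monomial \<alpha> y) has_sum h (P + y)) multi_indices"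
    using assms(2) unfolding ps_bound_def by blast
  have nn: "0 \<le> N" "0 \<le> N'" using has_sum_nonneg[OF c(1)] has_sum_nonneg[OF d(1)] \<rho> by simp_all
  show ?thesis
  proof (rule ps_bound_family[where I = "multi_indices \<times> multi_indices" and N = "N * N'"
        and e = "\<lambda>i b. fst i b + snd i b" and a = "\<lambda>i. c (fst i) * d (snd i)"])
    show "((\<lambda>i. \<bar>c (fst i) * d (snd i)\<bar> * \<rho> ^ total_degree (\<lambda>b. fst i b + snd i b)) has_sum N * N')
        (multi_indices \<times> multi_indices)"
      using has_sum_product_real[OF c(1) d(1)]
      by (simp add: total_degree_add power_add abs_mult case_prod_unfold mult_ac)
    show "((\<lambda>i. c (fst i) * d (snd i) * monomial (\<lambda>b. fst i b + snd i b) y) has_sum f (P + y) * h (P + y))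
        (multi_indices \<times> multi_indices)" if "y \<in> cube \<rho>" for y
      using has_sum_product_real[OF c(3) d(3), OF that that]
      by (simp add: monomial_add case_prod_unfold mult_ac)
    show "N * N' \<le> M * M'" using nn c(2) d(2) by (intro mult_mono) auto
  qed (use \<rho> in \<open>auto simp: multi_indices_def\<close>)
qed

text \<open>Serves twice: for series of functions, and for the re-expansion about another point,
  where each monomial of the old series is one of the \<open>F i\<close>.\<close>

lemma ps_bound_has_sum:
  assumes \<rho>: "0 < \<rho>" and F: "\<And>i. i \<in> I \<Longrightarrow> ps_bound P \<rho> (F i) (M i)" and M: "(M has_sum K) I"
    and f: "\<And>y. y \<in> cube \<rho> \<Longrightarrow> ((\<lambda>i. F i (P + y)) has_sum f (P + y)) I"
  shows "ps_bound P \<rho> f K"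
proof -
  have "\<forall>i\<in>I. \<exists>c N. ((\<lambda>\<alpha>. \<bar>c \<alpha>\<bar> * \<rho> ^ total_degree \<alpha>) has_sum N) multi_indices \<and> N \<le> M i \<and>
     (\<forall>y\<in>cube \<rho>. ((\<lambda>\<alpha>. c \<alpha> * monomial \<alpha> y) has_sum F i (P + y)) multi_indices)"
    using F unfolding ps_bound_def by blast
  then obtain c N where c: "\<And>i. i \<in> I \<Longrightarrow> ((\<lambda>\<alpha>. \<bar>c i \<alpha>\<bar> * \<rho> ^ total_degree \<alpha>) has_sum N i) multi_indices"
    "\<And>i. i \<in> I \<Longrightarrow> N i \<le> M i"
    "\<And>i y. i \<in> I \<Longrightarrow> y \<in> cube \<rho> \<Longrightarrow> ((\<lambda>\<alpha>. c i \<alpha> * monomial \<alpha> y) has_sum F i (P + y)) multi_indices"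
    unfolding bchoice_iff by blast
  have N: "0 \<le> N i" if "i \<in> I" for i
    using has_sum_nonneg[OF c(1)[OF that]] \<rho> by simp
  have "N summable_on I"
    by (rule summable_on_real_comparison[OF has_sum_imp_summable[OF M]]) (use N c(2) in auto)
  then obtain K' where K': "(N has_sum K') I" using has_sum_infsum by blast
  have abs_sum: "(\<lambda>i. \<bar>c (fst i) (snd i)\<bar> * \<rho> ^ total_degree (snd i)) summable_on I \<times> multi_indices"
    by (rule summable_on_SigmaI[where g = N])
      (use c(1) \<rho> has_sum_imp_summable[OF K'] in auto)
  show ?thesis
  proof (rule ps_bound_family[where I = "I \<times> multi_indices" and N = K'
        and e = snd and a = "\<lambda>i. c (fst i) (snd i)"])
    show "((\<lambda>i. \<bar>c (fst i) (snd i)\<bar> * \<rho> ^ total_degree (snd i)) has_sum K') (I \<times> multi_indices)"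
      by (rule has_sum_SigmaI[where g = N]) (use c(1) K' abs_sum in auto)
    show "K' \<le> K" using has_sum_mono[OF K' M c(2)] .
    show "((\<lambda>i. c (fst i) (snd i) * monomial (snd i) y) has_sum f (P + y)) (I \<times> multi_indices)"
      if y: "y \<in> cube \<rho>" for y
    proof (rule has_sum_SigmaI[where g = "\<lambda>i. F i (P + y)"])
      show "(\<lambda>i. c (fst i) (snd i) * monomial (snd i) y) summable_on I \<times> multi_indices"
        by (rule summable_on_real_comparison[OF abs_sum])
          (use abs_monomial_le[OF y] in \<open>auto simp: abs_mult intro: mult_left_mono\<close>)
    qed (use c(3) y f in auto)
  qed (use \<rho> in auto)
qed

lemma ps_bound_suminf:
  fixes F :: "nat \<Rightarrow> 'a::euclidean_space \<Rightarrow> real"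
  assumes \<rho>: "0 < \<rho>" and F: "\<And>n. ps_bound P \<rho> (F n) (M n)" and M: "summable M"
  shows "ps_bound P \<rho> (\<lambda>x. \<Sum>n. F n x) (\<Sum>n. M n)"
proof (rule ps_bound_has_sum[OF \<rho> F])
  have nn: "0 \<le> M n" for n using ps_bound_nonneg[OF F] .
  show "(M has_sum (\<Sum>n. M n)) UNIV"
    using M nn by (intro sums_nonneg_imp_has_sum summable_sums)
  show "((\<lambda>n. F n (P + y)) has_sum (\<Sum>n. F n (P + y))) UNIV" if "y \<in> cube \<rho>" for y
  proof (rule norm_summable_imp_has_sum)
    show "summable (\<lambda>n. norm (F n (P + y)))"
      by (rule summable_comparison_test'[OF M, of 0]) (use ps_bound_abs_le[OF F that] in auto)
    then show "(\<lambda>n. F n (P + y)) sums (\<Sum>n. F n (P + y))"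
      by (rule summable_sums[OF summable_norm_cancel])
  qed
qed

lemma ps_bound_uniform_limit:
  assumes "((\<lambda>\<alpha>. \<bar>c \<alpha>\<bar> * \<rho> ^ total_degree \<alpha>) has_sum N) multi_indices"
    "\<And>y. y \<in> cube \<rho> \<Longrightarrow> ((\<lambda>\<alpha>. c \<alpha> * monomial \<alpha> y) has_sum f y) multi_indices"
  shows "uniform_limit (cube \<rho>) (\<lambda>F y. \<Sum>\<alpha>\<in>F. c \<alpha> * monomial \<alpha> y) f (finite_subsets_at_top multi_indices)"
  by (rule Weierstrass_m_test_general'[OF _ assms(2) has_sum_imp_summable[OF assms(1)]])
    (auto simp: abs_mult intro!: mult_left_mono abs_monomial_le)

lemma continuous_on_monomial: "continuous_on S (monomial \<alpha>)"
  unfolding monomial_def by (intro continuous_intros)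

lemma ps_bound_continuous:
  assumes "ps_bound 0 \<rho> f M"
  shows "continuous_on (cube \<rho>) f"
proof -
  obtain c N where c: "((\<lambda>\<alpha>. \<bar>c \<alpha>\<bar> * \<rho> ^ total_degree \<alpha>) has_sum N) multi_indices" "N \<le> M"
    "\<And>y. y \<in> cube \<rho> \<Longrightarrow> ((\<lambda>\<alpha>. c \<alpha> * monomial \<alpha> y) has_sum f (0 + y)) multi_indices"
    using assms unfolding ps_bound_def by blast
  have "uniform_limit (cube \<rho>) (\<lambda>F y. \<Sum>\<alpha>\<in>F. c \<alpha> * monomial \<alpha> y) f (finite_subsets_at_top multi_indices)"
    using c by (intro ps_bound_uniform_limit) auto
  then show ?thesis
    by (rule uniform_limit_theorem[rotated])
      (auto intro!: always_eventually continuous_intros continuous_on_monomial)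
qed

lemma antideriv_monomial:
  assumes b: "b \<in> Basis"
  shows "antideriv b (monomial \<alpha>) y = monomial (\<alpha>(b := Suc (\<alpha> b))) y / real (Suc (\<alpha> b))"
proof -
  have "monomial \<alpha> (y - ((1 - t) * (y \<bullet> b)) *\<^sub>R b) = t ^ \<alpha> b * monomial \<alpha> y" for t
  proof -
    have "monomial \<alpha> (y - ((1 - t) * (y \<bullet> b)) *\<^sub>R b) =
        (\<Prod>c\<in>Basis. (if c = b then t ^ \<alpha> b else 1) * (y \<bullet> c) ^ \<alpha> c)"
      unfolding monomial_def
      by (rule prod.cong) (use b in \<open>auto simp: inner_diff_left inner_Basis algebra_simps power_mult_distrib\<close>)
    then show ?thesis using b by (simp add: prod.distrib monomial_def prod.delta)
  qed
  moreover have "integral {0..1} (\<lambda>t::real. t ^ n) = 1 / real (Suc n)" for n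
  proof -
    have "((\<lambda>t::real. t ^ n) has_integral (1 ^ Suc n / real (Suc n) - 0 ^ Suc n / real (Suc n))) {0..1}"
      by (rule fundamental_theorem_of_calculus)
        (auto intro!: derivative_eq_intros simp flip: has_real_derivative_iff_has_vector_derivative
          simp del: of_nat_Suc power_Suc)
    then show ?thesis by (simp add: integral_unique)
  qed
  ultimately show ?thesis by (simp add: antideriv_def monomial_Suc[OF b])
qed

text \<open>Termwise integration raises the degree by one, whence the factor \<open>\<rho>\<close>,
  and divides the coefficient by a number that is at least 1. Uniform convergence on the cube
  permits it.\<close>

lemma ps_bound_antideriv:
  assumes f: "ps_bound 0 \<rho> f M" and b: "b \<in> Basis"
  shows "ps_bound 0 \<rho> (antideriv b f) (\<rho> * M)"
proof -
  have \<rho>: "0 < \<rho>" using f by (simp add: ps_bound_def)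
  obtain c N where c: "((\<lambda>\<alpha>. \<bar>c \<alpha>\<bar> * \<rho> ^ total_degree \<alpha>) has_sum N) multi_indices" "N \<le> M"
    "\<And>y. y \<in> cube \<rho> \<Longrightarrow> ((\<lambda>\<alpha>. c \<alpha> * monomial \<alpha> y) has_sum f (0 + y)) multi_indices"
    using f unfolding ps_bound_def by blast
  define e where "e \<alpha> = \<alpha>(b := Suc (\<alpha> b))" for \<alpha> :: "'a \<Rightarrow> nat"
  define a where "a \<alpha> = c \<alpha> / real (Suc (\<alpha> b))" for \<alpha>
  have contf: "continuous_on (cube \<rho>) f" using ps_bound_continuous[OF f] .
  have le: "\<bar>a \<alpha>\<bar> * \<rho> ^ total_degree (e \<alpha>) \<le> \<rho> * (\<bar>c \<alpha>\<bar> * \<rho> ^ total_degree \<alpha>)" for \<alpha>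
  proof -
    have "\<bar>a \<alpha>\<bar> \<le> \<bar>c \<alpha>\<bar>" by (simp add: a_def field_simps mult_left_le)
    then show ?thesis using \<rho> by (simp add: e_def total_degree_Suc[OF b] mult_right_mono)
  qed
  have \<rho>c: "((\<lambda>\<alpha>. \<rho> * (\<bar>c \<alpha>\<bar> * \<rho> ^ total_degree \<alpha>)) has_sum \<rho> * N) multi_indices"
    using has_sum_cmult_right[OF c(1)] .
  have "(\<lambda>\<alpha>. \<bar>a \<alpha>\<bar> * \<rho> ^ total_degree (e \<alpha>)) summable_on multi_indices"
    by (rule summable_on_real_comparison[OF has_sum_imp_summable[OF \<rho>c]])
      (use le \<rho> in \<open>auto simp: abs_mult\<close>)
  then obtain N' where N': "((\<lambda>\<alpha>. \<bar>a \<alpha>\<bar> * \<rho> ^ total_degree (e \<alpha>)) has_sum N') multi_indices"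
    using has_sum_infsum by blast
  have unif: "uniform_limit (cube \<rho>) (\<lambda>F y. \<Sum>\<alpha>\<in>F. c \<alpha> * monomial \<alpha> y) f (finite_subsets_at_top multi_indices)"
    using c by (intro ps_bound_uniform_limit) auto
  show ?thesis
  proof (rule ps_bound_family[OF \<rho> _ N'])
    show "N' \<le> \<rho> * M"
      using has_sum_mono[OF N' \<rho>c le] mult_left_mono[OF c(2), of \<rho>] \<rho> by linarith
    show "((\<lambda>\<alpha>. a \<alpha> * monomial (e \<alpha>) y) has_sum antideriv b f (0 + y)) multi_indices" if y: "y \<in> cube \<rho>" for y
      unfolding has_sum_def tendsto_iff
    proof (intro allI impI)
      fix \<epsilon> :: real assume \<epsilon>: "0 < \<epsilon>"
      \<comment> \<open>Integration multiplies the error by at most \<open>\<rho>\<close>; the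
        factor 2 makes the final inequality strict.\<close>
      have "\<forall>\<^sub>F F in finite_subsets_at_top multi_indices. \<forall>y\<in>cube \<rho>.
          dist (\<Sum>\<alpha>\<in>F. c \<alpha> * monomial \<alpha> y) (f y) < \<epsilon> / (2 * \<rho>)"
        using uniform_limitD[OF unif, of "\<epsilon> / (2 * \<rho>)"] \<epsilon> \<rho> by simp
      then show "\<forall>\<^sub>F F in finite_subsets_at_top multi_indices.
          dist (\<Sum>\<alpha>\<in>F. a \<alpha> * monomial (e \<alpha>) y) (antideriv b f (0 + y)) < \<epsilon>"
      proof (rule eventually_mono)
        fix F assume F: "\<forall>y\<in>cube \<rho>. dist (\<Sum>\<alpha>\<in>F. c \<alpha> * monomial \<alpha> y) (f y) < \<epsilon> / (2 * \<rho>)"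
        let ?S = "\<lambda>y. \<Sum>\<alpha>\<in>F. c \<alpha> * monomial \<alpha> y"
        have contS: "continuous_on (cube \<rho>) ?S"
          by (intro continuous_intros continuous_on_monomial)
        have "antideriv b ?S y = (\<Sum>\<alpha>\<in>F. c \<alpha> * antideriv b (monomial \<alpha>) y)"
        \<comment> \<open>At this point \<open>F\<close> is an arbitrary set; if it is infinite, all
          the sums are 0 by convention.\<close>
        proof (cases "finite F")
          case True
          have "(\<lambda>t. c \<alpha> * monomial \<alpha> (y - ((1 - t) * (y \<bullet> b)) *\<^sub>R b)) integrable_on {0..1}" for \<alpha>
            using continuous_on_slide[OF continuous_on_monomial y b]
            by (intro integrable_continuous_interval continuous_intros)
          then show ?thesis
            using True by (simp add: antideriv_def integral_sum sum_distrib_left mult.left_commute)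
        qed (simp add: antideriv_def)
        also have "\<dots> = (\<Sum>\<alpha>\<in>F. a \<alpha> * monomial (e \<alpha>) y)"
          by (simp add: antideriv_monomial[OF b] a_def e_def)
        finally have S: "antideriv b ?S y = (\<Sum>\<alpha>\<in>F. a \<alpha> * monomial (e \<alpha>) y)" .
        have "\<bar>antideriv b (\<lambda>y. ?S y - f y) y\<bar> \<le> \<rho> * (\<epsilon> / (2 * \<rho>))"
          by (rule antideriv_bound[OF _ _ y b])
            (use F in \<open>auto simp: dist_real_def intro!: continuous_intros contS contf less_imp_le\<close>)
        also have "\<dots> < \<epsilon>" using \<rho> \<epsilon> by simp
        finally show "dist (\<Sum>\<alpha>\<in>F. a \<alpha> * monomial (e \<alpha>) y) (antideriv b f (0 + y)) < \<epsilon>"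
          by (simp add: antideriv_diff[OF contS contf y b] S dist_real_def)
      qed
    qed
  qed (use b in \<open>auto simp: multi_indices_def e_def\<close>)
qed

text \<open>Both constants are 1: the weighted \<ell>^1 norm is submultiplicative, and integration
  costs exactly the factor \<open>p\<close>.\<close>

lemma function_scale_ps: "function_scale (ps_bound 0) 1 1"
proof unfold_locales
  show pos: "0 < p" if "ps_bound 0 p f M" for p M and f :: "'a \<Rightarrow> real"
    using that by (simp add: ps_bound_def)
  fix p q M N and f h :: "'a \<Rightarrow> real"
  assume f: "ps_bound 0 p f M"
  show "ps_bound 0 p h M" if "\<And>x. x \<in> cube p \<Longrightarrow> f x = h x"
    using ps_bound_cong[of 0 p f M h] f that by simp
  show "\<bar>f x\<bar> \<le> M" if "x \<in> cube p" for x
    using ps_bound_abs_le[OF f that] by simp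
  show "continuous_on (cube p) f"
    using f by (rule ps_bound_continuous)
  show "ps_bound 0 q f N" if "0 < q" "q \<le> p" "M \<le> N"
    using f that by (rule ps_bound_mono)
  show "ps_bound 0 p (antideriv b f) (1 * p * M)" if "b \<in> Basis" for b
    using ps_bound_antideriv[OF f that] by simp
  assume h: "ps_bound 0 p h N"
  show "ps_bound 0 p (\<lambda>x. f x + h x) (M + N)"
    using f h by (rule ps_bound_add)
  show "ps_bound 0 p (\<lambda>x. f x * h x) (1 * M * N)"
    using ps_bound_mult[OF f h] by simp
next
  fix p a :: real
  assume "0 < p"
  then show "ps_bound 0 p (\<lambda>_. a) \<bar>a\<bar>" by (rule ps_bound_const)
next
  fix p Ms and F :: "nat \<Rightarrow> 'a \<Rightarrow> real"
  assume F: "\<And>n. ps_bound 0 p (F n) (Ms n)" and "summable Ms"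
  moreover have "0 < p" using F[of 0] by (simp add: ps_bound_def)
  ultimately show "ps_bound 0 p (\<lambda>x. \<Sum>n. F n x) (\<Sum>n. Ms n)"
    by (intro ps_bound_suminf)
qed auto

section \<open>Change of center and real analyticity\<close>

lemma ps_bound_prod:
  assumes "0 < \<rho>" "finite S" "\<And>b. b \<in> S \<Longrightarrow> ps_bound P \<rho> (F b) r"
  shows "ps_bound P \<rho> (\<lambda>x. \<Prod>b\<in>S. F b x ^ \<alpha> b) (\<Prod>b\<in>S. r ^ \<alpha> b)"
  using assms(2,3)
proof (induction S)
  case empty
  show ?case using ps_bound_const[OF assms(1), of P 1] by simp
next
  case (insert b S)
  have "ps_bound P \<rho> (\<lambda>x. F b x ^ n) (r ^ n)" for n
  proof (induction n)
    case 0
    show ?case using ps_bound_const[OF assms(1), of P 1] by simp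
  next
    case (Suc n)
    then show ?case using ps_bound_mult[OF insert.prems[of b]] by simp
  qed
  then show ?case using insert by (simp add: ps_bound_mult)
qed

text \<open>About \<open>P\<close>, the coordinate \<open>x \<bullet> b\<close> is the constant
  \<open>P \<bullet> b\<close> plus a centered coordinate, so its norm is at most
  \<open>\<bar>P \<bullet> b\<bar> + \<rho> \<le> r\<close>. By submultiplicativity a monomial has
  at most the norm that it has about 0 at radius \<open>r\<close>, and no binomial expansion is
  required.\<close>

lemma ps_bound_recenter:
  assumes f: "ps_bound 0 r f M" and \<rho>: "0 < \<rho>" and P: "\<And>b. b \<in> Basis \<Longrightarrow> \<bar>P \<bullet> b\<bar> + \<rho> \<le> r"
  shows "ps_bound P \<rho> f M"
proof -
  obtain c N where c: "((\<lambda>\<alpha>. \<bar>c \<alpha>\<bar> * r ^ total_degree \<alpha>) has_sum N) multi_indices" "N \<le> M"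
    "\<And>y. y \<in> cube r \<Longrightarrow> ((\<lambda>\<alpha>. c \<alpha> * monomial \<alpha> y) has_sum f (0 + y)) multi_indices"
    using f unfolding ps_bound_def by blast
  have "ps_bound P \<rho> f N"
  proof (rule ps_bound_has_sum[OF \<rho> _ c(1)])
    fix \<alpha> :: "'a \<Rightarrow> nat"
    have "ps_bound P \<rho> (\<lambda>x. x \<bullet> b) r" if "b \<in> Basis" for b
      using ps_bound_mono[OF ps_bound_add[OF ps_bound_const[OF \<rho>, of P "P \<bullet> b"] ps_bound_coordinate[OF \<rho> that]] \<rho> order_refl P[OF that]]
      by (simp add: inner_diff_left)
    then have "ps_bound P \<rho> (\<lambda>x. \<Prod>b\<in>Basis. (x \<bullet> b) ^ \<alpha> b) (\<Prod>b\<in>(Basis::'a set). r ^ \<alpha> b)"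
      by (intro ps_bound_prod \<rho>) auto
    then have "ps_bound P \<rho> (monomial \<alpha>) (r ^ total_degree \<alpha>)"
      by (simp add: monomial_def[abs_def] total_degree_def power_sum)
    then show "ps_bound P \<rho> (\<lambda>x. c \<alpha> * monomial \<alpha> x) (\<bar>c \<alpha>\<bar> * r ^ total_degree \<alpha>)"
      using ps_bound_mult[OF ps_bound_const[OF \<rho>]] by blast
  next
    fix y :: 'a assume "y \<in> cube \<rho>"
    then have "P + y \<in> cube r"
      using P by (force simp: cube_def inner_add_left)
    then show "((\<lambda>\<alpha>. c \<alpha> * monomial \<alpha> (P + y)) has_sum f (P + y)) multi_indices"
      using c(3)[of "P + y"] by simp
  qed
  then show ?thesis using ps_bound_mono[OF _ \<rho> order_refl c(2)] by blast
qed

lemma norm_less_imp_in_cube: "norm y < r \<Longrightarrow> y \<in> cube r"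
  unfolding cube_def using Basis_le_norm order_le_less_trans by blast

lemma ps_bound_imp_real_analytic_on:
  fixes f :: "'a::euclidean_space \<Rightarrow> real"
  assumes f: "ps_bound 0 r f M"
  shows "real_analytic_on (cube r) f"
  unfolding real_analytic_on_def
proof
  fix P :: 'a assume P: "P \<in> cube r"
  \<comment> \<open>The distance from \<open>P\<close> to the boundary of the cube in the maximum
    norm.\<close>
  define \<rho> where "\<rho> = r - Max ((\<lambda>b. \<bar>P \<bullet> b\<bar>) ` Basis)"
  have "Max ((\<lambda>b. \<bar>P \<bullet> b\<bar>) ` Basis) < r"
    using P by (subst Max_less_iff) (auto simp: cube_def)
  then have \<rho>: "0 < \<rho>" by (simp add: \<rho>_def)
  have "\<bar>P \<bullet> b\<bar> + \<rho> \<le> r" if "b \<in> Basis" for b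
  proof -
    have "\<bar>P \<bullet> b\<bar> \<le> Max ((\<lambda>b. \<bar>P \<bullet> b\<bar>) ` Basis)" using that by (intro Max_ge) auto
    then show ?thesis unfolding \<rho>_def by linarith
  qed
  then have "ps_bound P \<rho> f M" using ps_bound_recenter[OF f \<rho>] by blast
  then obtain c N where c: 
    "\<And>y. y \<in> cube \<rho> \<Longrightarrow> ((\<lambda>\<alpha>. c \<alpha> * monomial \<alpha> y) has_sum f (P + y)) multi_indices"
    unfolding ps_bound_def by blast
  have "((\<lambda>\<alpha>. c \<alpha> * (\<Prod>b\<in>Basis. ((Q - P) \<bullet> b) ^ \<alpha> b)) has_sum f Q) multi_indices" if "Q \<in> ball P \<rho>" for Q
    using c[OF norm_less_imp_in_cube[of "Q - P"]] that by (simp add: dist_norm norm_minus_commute monomial_def)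
  then show "\<exists>r>0. \<exists>c. \<forall>Q\<in>ball P r.
      ((\<lambda>\<alpha>. c \<alpha> * (\<Prod>b\<in>Basis. ((Q - P) \<bullet> b) ^ \<alpha> b)) has_sum f Q) multi_indices"
    using \<rho> by blast
qed

text \<open>Evaluating the series at the corner \<open>\<rho> *\<^sub>R One\<close> turns every
  monomial into its weight. Convergence there is absolute, and this is exactly finiteness of the
  norm. The radius is chosen so that the closed cube lies in the given ball.\<close>

lemma real_analytic_on_imp_ps_bound:
  fixes f :: "'a::euclidean_space \<Rightarrow> real"
  assumes "real_analytic_on UNIV f"
  shows "\<exists>\<rho> M. ps_bound 0 \<rho> f M"
proof -
  obtain r c where r: "0 < r" and c:
    "\<And>Q. Q \<in> ball 0 r \<Longrightarrow> ((\<lambda>\<alpha>. c \<alpha> * (\<Prod>b\<in>Basis. ((Q - 0) \<bullet> b) ^ \<alpha> b)) has_sum f Q) multi_indices"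
    using assms unfolding real_analytic_on_def by blast
  define \<rho> where "\<rho> = r / (2 * DIM('a))"
  have \<rho>: "0 < \<rho>" and \<rho>_lt: "DIM('a) * \<rho> < r" using r by (auto simp: \<rho>_def field_simps)
  have in_ball: "y \<in> ball 0 r" if "\<And>b. b \<in> Basis \<Longrightarrow> \<bar>y \<bullet> b\<bar> \<le> \<rho>" for y :: 'a
  proof -
    have "norm y \<le> (\<Sum>b\<in>Basis. \<bar>y \<bullet> b\<bar>)" by (rule norm_le_l1)
    also have "\<dots> \<le> (\<Sum>b\<in>(Basis::'a set). \<rho>)" using that by (rule sum_mono)
    also have "\<dots> < r" using \<rho>_lt by simp
    finally show ?thesis by simp
  qed
  have "\<rho> *\<^sub>R One \<in> ball (0::'a) r" using \<rho> by (intro in_ball) simp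
  then have "((\<lambda>\<alpha>. c \<alpha> * monomial \<alpha> (\<rho> *\<^sub>R One)) has_sum f (\<rho> *\<^sub>R One)) multi_indices"
    using c[of "\<rho> *\<^sub>R One"] by (simp add: monomial_def)
  then have "(\<lambda>\<alpha>. c \<alpha> * \<rho> ^ total_degree \<alpha>) summable_on multi_indices"
    unfolding monomial_diag by (rule has_sum_imp_summable)
  then have "(\<lambda>\<alpha>. \<bar>c \<alpha>\<bar> * \<rho> ^ total_degree \<alpha>) summable_on multi_indices"
    using \<rho> summable_on_iff_abs_summable_on_real[THEN iffD1] by (fastforce simp: abs_mult)
  moreover have "((\<lambda>\<alpha>. c \<alpha> * monomial \<alpha> y) has_sum f (0 + y)) multi_indices" if "y \<in> cube \<rho>" for y
    using c[OF in_ball[of y]] that by (simp add: monomial_def cube_def less_imp_le)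
  ultimately show ?thesis
    unfolding ps_bound_def using \<rho> has_sum_infsum by blast
qed

text \<open>Only countably many summable bounds are nonzero; the corresponding terms are enumerated
  and \<open>ck_bound_suminf\<close> applies. This avoids an enumeration of
  \<open>multi_indices\<close>.\<close>

lemma ck_bound_has_sum:
  fixes F :: "'i \<Rightarrow> 'a::euclidean_space \<Rightarrow> real"
  assumes p: "0 < p" and F: "\<And>i. i \<in> I \<Longrightarrow> ck_bound k p (F i) (M i)" and M: "M summable_on I"
    and F0: "\<And>i. i \<in> I \<Longrightarrow> M i = 0 \<Longrightarrow> F i = (\<lambda>_. 0)"
    and f: "\<And>y. y \<in> cube p \<Longrightarrow> ((\<lambda>i. F i y) has_sum f y) I"
  shows "\<exists>K. ck_bound k p f K"
proof -
  define I' where "I' = {i \<in> I. M i \<noteq> 0}"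
  have "countable I'"
    using abs_summable_countable[OF M[THEN summable_on_iff_abs_summable_on_real[THEN iffD1]]]
    by (simp add: I'_def)
  define \<phi> where "\<phi> = to_nat_on I'"
  have inj: "inj_on \<phi> I'" unfolding \<phi>_def using \<open>countable I'\<close> by (rule inj_on_to_nat_on)
  define \<psi> where "\<psi> = the_inv_into I' \<phi>"
  have \<psi>: "\<psi> (\<phi> i) = i" if "i \<in> I'" for i using the_inv_into_f_f[OF inj that] by (simp add: \<psi>_def)
  define G where "G n = (if n \<in> \<phi> ` I' then F (\<psi> n) else (\<lambda>_. 0))" for n
  define L where "L n = (if n \<in> \<phi> ` I' then M (\<psi> n) else 0)" for n
  have transfer: "((\<lambda>n. if n \<in> \<phi> ` I' then h (\<psi> n) else 0) has_sum S) UNIV"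
    if "(h has_sum S) I" "\<And>i. i \<in> I \<Longrightarrow> M i = 0 \<Longrightarrow> h i = 0" for h :: "'i \<Rightarrow> real" and S
  proof -
    have "(h has_sum S) I'"
      using that by (subst has_sum_cong_neutral[where T = I and g = h]) (auto simp: I'_def)
    also have "?this \<longleftrightarrow> ((\<lambda>n. h (\<psi> n)) has_sum S) (\<phi> ` I')"
      using \<psi> by (subst has_sum_reindex[OF inj]) (auto intro!: has_sum_cong)
    also have "\<dots> \<longleftrightarrow> ((\<lambda>n. if n \<in> \<phi> ` I' then h (\<psi> n) else 0) has_sum S) UNIV"
      by (rule has_sum_cong_neutral) auto
    finally show ?thesis .
  qed
  have "ck_bound k p (\<lambda>x. \<Sum>n. G n x) (\<Sum>n. L n)"
  proof (rule ck_bound_suminf[OF p])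
    show "ck_bound k p (G n) (L n)" for n
      using F \<psi> ck_bound_zero[OF p] by (auto simp: G_def L_def I'_def)
    show "summable L"
      using has_sum_imp_sums[OF transfer[OF has_sum_infsum[OF M]]] by (auto simp: L_def[abs_def] sums_iff)
  qed
  moreover have "(\<Sum>n. G n x) = f x" if "x \<in> cube p" for x
  proof -
    have "G n x = (if n \<in> \<phi> ` I' then F (\<psi> n) x else 0)" for n by (simp add: G_def)
    then show ?thesis
      using has_sum_imp_sums[OF transfer[OF f[OF that]]] F0 by (simp add: sums_iff)
  qed
  ultimately show ?thesis using ck_bound_cong by blast
qed

text \<open>A coordinate is the antiderivative of 1, so at order 1 its bound is
  \<open>2 * p\<close>; each multiplication costs another factor 2. Hence the base
  \<open>4 * p\<close>.\<close>

lemma ck_bound_monomial: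
  assumes p: "0 < p"
  shows "ck_bound 1 p (monomial \<alpha>) ((4 * p) ^ total_degree \<alpha>)"
proof -
  have coord: "ck_bound 1 p (\<lambda>x. x \<bullet> b) (2 * p)" if "b \<in> Basis" for b :: 'a
    using ck_bound_antideriv[OF p that ck_bound_const[OF p, of 1 1]] by (simp add: antideriv_const[abs_def])
  have power: "ck_bound 1 p (\<lambda>x. F x * (x \<bullet> b) ^ n) (K * (4 * p) ^ n)"
    if "ck_bound 1 p F K" "b \<in> Basis" for F K n and b :: 'a
  proof (induction n)
    case 0
    then show ?case using that by simp
  next
    case (Suc n)
    have "ck_bound 1 p (\<lambda>x. (x \<bullet> b) * (F x * (x \<bullet> b) ^ n)) (2 ^ 1 * (2 * p) * (K * (4 * p) ^ n))"
      by (rule ck_bound_mult[OF p coord[OF that(2)] Suc])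
    then show ?case by (simp add: mult_ac)
  qed
  have "ck_bound 1 p (\<lambda>x. \<Prod>b\<in>S. (x \<bullet> b) ^ \<alpha> b) ((4 * p) ^ (\<Sum>b\<in>S. \<alpha> b))"
    if "finite S" "S \<subseteq> Basis" for S :: "'a set"
    using that
  proof (induction S)
    case empty
    show ?case using ck_bound_const[OF p, of 1 1] by simp
  next
    case (insert b S)
    then show ?case
      using power[of "\<lambda>x. \<Prod>b\<in>S. (x \<bullet> b) ^ \<alpha> b" "(4 * p) ^ (\<Sum>b\<in>S. \<alpha> b)" b "\<alpha> b"]
      by (simp add: power_add mult_ac)
  qed
  from this[OF finite_Basis order_refl] show ?thesis
    by (simp only: monomial_def[abs_def] total_degree_def)
qed

text \<open>At scale \<open>r / 4\<close> the crude bound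
  \<open>(4 * p) ^ total_degree \<alpha>\<close> of a monomial equals its weight in the norm at
  radius \<open>r\<close>, so the series converges in C^1.\<close>

lemma ps_bound_imp_C_1_on:
  assumes f: "ps_bound 0 r f M"
  shows "C_k_on 1 (cube (r / 4)) f"
proof -
  have r: "0 < r" using f by (simp add: ps_bound_def)
  obtain c N where c: "((\<lambda>\<alpha>. \<bar>c \<alpha>\<bar> * r ^ total_degree \<alpha>) has_sum N) multi_indices" "N \<le> M"
    "\<And>y. y \<in> cube r \<Longrightarrow> ((\<lambda>\<alpha>. c \<alpha> * monomial \<alpha> y) has_sum f (0 + y)) multi_indices"
    using f unfolding ps_bound_def by blast
  have p: "0 < r / 4" using r by simp
  have "\<exists>K. ck_bound 1 (r / 4) f K"
  proof (rule ck_bound_has_sum[OF p, where F = "\<lambda>\<alpha> y. c \<alpha> * monomial \<alpha> y"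
        and M = "\<lambda>\<alpha>. 2 ^ 1 * \<bar>c \<alpha>\<bar> * (4 * (r / 4)) ^ total_degree \<alpha>"])
    show "ck_bound 1 (r / 4) (\<lambda>y. c \<alpha> * monomial \<alpha> y) (2 ^ 1 * \<bar>c \<alpha>\<bar> * (4 * (r / 4)) ^ total_degree \<alpha>)" for \<alpha>
      by (rule ck_bound_mult[OF p ck_bound_const[OF p] ck_bound_monomial[OF p]])
    show "(\<lambda>\<alpha>. 2 ^ 1 * \<bar>c \<alpha>\<bar> * (4 * (r / 4)) ^ total_degree \<alpha>) summable_on multi_indices"
      using summable_on_cmult_right[OF has_sum_imp_summable[OF c(1)], of 2] by (simp add: mult.assoc)
    show "((\<lambda>\<alpha>. c \<alpha> * monomial \<alpha> y) has_sum f y) multi_indices" if "y \<in> cube (r / 4)" for y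
      using c(3)[of y] that cube_mono[of "r / 4" r] r by auto
  qed (use r in auto)
  then show ?thesis using ck_bound_imp_C_k_on[OF p] by blast
qed

section \<open>Connections and their Ricci tensors\<close>

lemma linear_euclidean_sum:
  fixes f :: "'a::euclidean_space \<Rightarrow> 'b::real_vector"
  assumes "linear f"
  shows "f x = (\<Sum>b\<in>Basis. (x \<bullet> b) *\<^sub>R f b)"
proof -
  have "f (\<Sum>b\<in>Basis. (x \<bullet> b) *\<^sub>R b) = (\<Sum>b\<in>Basis. (x \<bullet> b) *\<^sub>R f b)"
    by (simp only: linear_sum[OF assms] linear_scale[OF assms])
  then show ?thesis by (simp only: euclidean_representation)
qed

lemma bilinear_eq_Basis:
  fixes f h :: "'a::euclidean_space \<Rightarrow> 'a \<Rightarrow> real"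
  assumes "bilinear f" "bilinear h" "\<And>i j. i \<in> Basis \<Longrightarrow> j \<in> Basis \<Longrightarrow> f i j = h i j"
  shows "f x y = h x y"
proof -
  have lin: "linear (\<lambda>x. f x y)" "linear (\<lambda>x. h x y)" "linear (f x)" "linear (h x)" for x y
    using assms(1,2) by (simp_all add: bilinear_def)
  have "f i y = h i y" if "i \<in> Basis" for i
    using linear_euclidean_sum[OF lin(3), of i y] linear_euclidean_sum[OF lin(4), of i y] assms(3) that by simp
  then show ?thesis
    using linear_euclidean_sum[OF lin(1), of x y] linear_euclidean_sum[OF lin(2), of x y] by simp
qed

lemma bilinear_expand_right:
  fixes h :: "'a::euclidean_space \<Rightarrow> 'a \<Rightarrow> real"
  assumes "bilinear h"
  shows "h x y = (\<Sum>b\<in>Basis. (y \<bullet> b) * h x b)"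
  using linear_euclidean_sum[of "h x" y] assms by (simp add: bilinear_def)

lemma bilinear_expand_left:
  fixes h :: "'a::euclidean_space \<Rightarrow> 'a \<Rightarrow> real"
  assumes "bilinear h"
  shows "h x y = (\<Sum>b\<in>Basis. (x \<bullet> b) * h b y)"
  using linear_euclidean_sum[of "\<lambda>x. h x y" x] assms by (simp add: bilinear_def)

section \<open>Connections given by Christoffel symbols\<close>

definition christoffel_field ::
    "('a \<Rightarrow> 'a \<Rightarrow> 'a \<Rightarrow> real) \<Rightarrow> 'a \<Rightarrow> 'a \<Rightarrow> 'a::euclidean_space" where
  "christoffel_field G x y = (\<Sum>j\<in>Basis. \<Sum>k\<in>Basis. \<Sum>l\<in>Basis. ((x \<bullet> j) * (y \<bullet> k) * G j k l) *\<^sub>R l)"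

definition connection_of ::
    "('a \<Rightarrow> 'a \<Rightarrow> 'a \<Rightarrow> 'a) \<Rightarrow> ('a \<Rightarrow> 'a) \<Rightarrow> ('a \<Rightarrow> 'a) \<Rightarrow> 'a \<Rightarrow> 'a::euclidean_space" where
  "connection_of \<Gamma> X Y P = frechet_derivative Y (at P) (X P) + \<Gamma> P (X P) (Y P)"

lemma christoffel_field_inner:
  assumes "l \<in> Basis"
  shows "christoffel_field G x y \<bullet> l = (\<Sum>j\<in>Basis. \<Sum>k\<in>Basis. (x \<bullet> j) * (y \<bullet> k) * G j k l)"
  using assms by (simp add: christoffel_field_def inner_sum_left inner_Basis if_distrib sum.delta cong: if_cong)

lemma sum_inner_Basis:
  fixes F :: "'a::euclidean_space \<Rightarrow> real"
  assumes "k \<in> Basis"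
  shows "(\<Sum>b\<in>Basis. (k \<bullet> b) * F b) = F k"
proof -
  have "(\<Sum>b\<in>Basis. (k \<bullet> b) * F b) = (\<Sum>b\<in>Basis. if b = k then F b else 0)"
    by (rule sum.cong) (use assms in \<open>auto simp: inner_Basis\<close>)
  then show ?thesis using assms by simp
qed

lemma christoffel_field_Basis:
  assumes "j \<in> Basis" "k \<in> Basis" "l \<in> Basis"
  shows "christoffel_field G j k \<bullet> l = G j k l"
  using assms
  by (simp add: christoffel_field_inner sum_inner_Basis mult.assoc flip: sum_distrib_left)

lemma bilinear_christoffel_field: "bilinear (christoffel_field G)"
  unfolding bilinear_def linear_iff christoffel_field_def
  by (simp add: algebra_simps sum.distrib scaleR_sum_right)

lemma christoffel_field_sym:
  assumes "\<And>j k l. j \<in> Basis \<Longrightarrow> k \<in> Basis \<Longrightarrow> l \<in> Basis \<Longrightarrow> G j k l = G k j l"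
  shows "christoffel_field G x y = christoffel_field G y x"
  unfolding christoffel_field_def
  by (subst sum.swap) (intro sum.cong refl, simp add: assms mult_ac)

lemma christoffel_field_eqI:
  assumes "bilinear h" "\<And>j k l. j \<in> Basis \<Longrightarrow> k \<in> Basis \<Longrightarrow> l \<in> Basis \<Longrightarrow> h j k \<bullet> l = G j k l"
  shows "christoffel_field G x y = h x y"
proof (rule euclidean_eqI)
  fix l :: 'a assume l: "l \<in> Basis"
  have bil: "bilinear (\<lambda>x y. f x y \<bullet> l)" if "bilinear f" for f :: "'a \<Rightarrow> 'a \<Rightarrow> 'a"
    using that unfolding bilinear_def linear_iff by (simp add: inner_add_left)
  show "christoffel_field G x y \<bullet> l = h x y \<bullet> l"
    by (rule bilinear_eq_Basis[OF bil[OF bilinear_christoffel_field] bil[OF assms(1)]])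
      (use assms(2) l in \<open>auto simp: christoffel_field_Basis\<close>)
qed

lemma has_derivative_christoffel_field:
  assumes "\<And>j k l. j \<in> Basis \<Longrightarrow> k \<in> Basis \<Longrightarrow> l \<in> Basis \<Longrightarrow> (G j k l has_derivative D j k l) (at P)"
  shows "((\<lambda>Q. christoffel_field (\<lambda>j k l. G j k l Q) y z) has_derivative
    (\<lambda>v. christoffel_field (\<lambda>j k l. D j k l v) y z)) (at P)"
  unfolding christoffel_field_def
  by (intro has_derivative_sum has_derivative_scaleR_left has_derivative_mult_right assms)

lemma connection_on_connection_of:
  assumes \<Gamma>: "\<And>P. bilinear (\<Gamma> P)"
  shows "connection_on U (connection_of \<Gamma>)"
proof -
  have add: "\<Gamma> P (x + x') y = \<Gamma> P x y + \<Gamma> P x' y" "\<Gamma> P x (y + y') = \<Gamma> P x y + \<Gamma> P x y'"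
    and scale: "\<Gamma> P (a *\<^sub>R x) y = a *\<^sub>R \<Gamma> P x y" "\<Gamma> P x (a *\<^sub>R y) = a *\<^sub>R \<Gamma> P x y" for P a x x' y y'
    using \<Gamma>[of P] by (simp_all add: bilinear_ladd bilinear_radd bilinear_lmul bilinear_rmul)
  have D: "(Y has_derivative frechet_derivative Y (at P)) (at P)" if "C_k_on 1 U Y" "P \<in> U"
    for Y :: "'a \<Rightarrow> 'b::real_normed_vector" and P
    using that by (simp add: frechet_derivative_works)
  have lin: "linear (frechet_derivative Y (at P))" if "C_k_on 1 U Y" "P \<in> U" for Y :: "'a \<Rightarrow> 'a" and P
    using has_derivative_linear[OF D[OF that]] .
  have "frechet_derivative (\<lambda>Q. Y Q + Y' Q) (at P) = (\<lambda>v. frechet_derivative Y (at P) v + frechet_derivative Y' (at P) v)"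
    if "C_k_on 1 U Y" "C_k_on 1 U Y'" "P \<in> U" for Y Y' :: "'a \<Rightarrow> 'a" and P
    using frechet_derivative_at[OF has_derivative_add[OF D[OF that(1,3)] D[OF that(2,3)]]] by (rule sym)
  moreover have "frechet_derivative (\<lambda>Q. f Q *\<^sub>R Y Q) (at P) =
      (\<lambda>v. f P *\<^sub>R frechet_derivative Y (at P) v + frechet_derivative f (at P) v *\<^sub>R Y P)"
    if "C_k_on 1 U f" "C_k_on 1 U Y" "P \<in> U" for f and Y :: "'a \<Rightarrow> 'a" and P
    using frechet_derivative_at[OF has_derivative_scaleR[OF D[OF that(1,3)] D[OF that(2,3)]]] by (rule sym)
  ultimately show ?thesis
    unfolding connection_on_def connection_of_def
    by (intro conjI allI impI ballI)
      (simp_all add: add scale linear_add[OF lin] linear_scale[OF lin] algebra_simps del: C_k_on.simps One_nat_def)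
qed

lemma torsion_free_on_connection_of:
  assumes "\<And>P x y. \<Gamma> P x y = \<Gamma> P y x"
  shows "torsion_free_on U (connection_of \<Gamma>)"
  unfolding torsion_free_on_def connection_of_def lie_bracket_def
  using assms by (simp add: algebra_simps del: C_k_on.simps)

lemma christoffel_connection_of: "christoffel (connection_of \<Gamma>) i j k P = \<Gamma> P i j \<bullet> k"
  by (simp add: christoffel_def connection_of_def)

lemma curvature_at_connection_of:
  assumes \<Gamma>: "\<And>P. bilinear (\<Gamma> P)"
  shows "curvature_at (connection_of \<Gamma>) P x y z =
    frechet_derivative (\<lambda>Q. \<Gamma> Q y z) (at P) x + \<Gamma> P x (\<Gamma> P y z) -
    (frechet_derivative (\<lambda>Q. \<Gamma> Q x z) (at P) y + \<Gamma> P y (\<Gamma> P x z))"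
  by (simp add: curvature_at_def curvature_def connection_of_def[abs_def] lie_bracket_def bilinear_lzero[OF \<Gamma>])

lemma curvature_at_christoffel_field:
  assumes D: "\<And>j k l. j \<in> Basis \<Longrightarrow> k \<in> Basis \<Longrightarrow> l \<in> Basis \<Longrightarrow> (G j k l has_derivative D j k l) (at P)"
  defines "\<Gamma> \<equiv> \<lambda>P. christoffel_field (\<lambda>j k l. G j k l P)"
  shows "curvature_at (connection_of \<Gamma>) P x y z =
    christoffel_field (\<lambda>j k l. D j k l x) y z + \<Gamma> P x (\<Gamma> P y z) -
    (christoffel_field (\<lambda>j k l. D j k l y) x z + \<Gamma> P y (\<Gamma> P x z))"
proof -
  have "frechet_derivative (\<lambda>Q. \<Gamma> Q y z) (at P) = (\<lambda>v. christoffel_field (\<lambda>j k l. D j k l v) y z)" for y z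
    unfolding \<Gamma>_def by (rule frechet_derivative_at[OF has_derivative_christoffel_field[OF D], symmetric])
  then show ?thesis
    by (subst curvature_at_connection_of) (simp_all add: \<Gamma>_def bilinear_christoffel_field)
qed

text \<open>The derivative-free part \<Gamma>_jk^n \<Gamma>_ln^l - \<Gamma>_lk^n \<Gamma>_jn^l of
  the coordinate formula for the Ricci tensor.\<close>

definition ricci_quadratic :: "('a \<Rightarrow> 'a \<Rightarrow> 'a \<Rightarrow> real) \<Rightarrow> 'a::euclidean_space \<Rightarrow> 'a \<Rightarrow> real" where
  "ricci_quadratic G j k = (\<Sum>l\<in>Basis. \<Sum>n\<in>Basis. G j k n * G l n l - G l k n * G j n l)"

text \<open>The second sum is symmetric after an exchange of the summation indices \<open>l\<close>
  and \<open>n\<close>. Consequently the quadratic term does not affect the antisymmetric part of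
  the Ricci tensor.\<close>

lemma ricci_quadratic_sym:
  assumes "\<And>j k l. j \<in> Basis \<Longrightarrow> k \<in> Basis \<Longrightarrow> l \<in> Basis \<Longrightarrow> G j k l = G k j l" "j \<in> Basis" "k \<in> Basis"
  shows "ricci_quadratic G j k = ricci_quadratic G k j"
proof -
  have "(\<Sum>l\<in>Basis. \<Sum>n\<in>Basis. G l k n * G j n l) = (\<Sum>l\<in>Basis. \<Sum>n\<in>Basis. G n k l * G j l n)"
    by (rule sum.swap)
  also have "\<dots> = (\<Sum>l\<in>Basis. \<Sum>n\<in>Basis. G l j n * G k n l)"
  proof (intro sum.cong refl)
    fix l n :: 'a assume "l \<in> Basis" "n \<in> Basis"
    then have "G n k l = G k n l" "G j l n = G l j n" using assms by auto
    then show "G n k l * G j l n = G l j n * G k n l" by simp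
  qed
  finally have eq: "(\<Sum>l\<in>Basis. \<Sum>n\<in>Basis. G l k n * G j n l) = (\<Sum>l\<in>Basis. \<Sum>n\<in>Basis. G l j n * G k n l)" .
  have "(\<Sum>l\<in>Basis. \<Sum>n\<in>Basis. G j k n * G l n l) = (\<Sum>l\<in>Basis. \<Sum>n\<in>Basis. G k j n * G l n l)"
    using assms by (auto intro!: sum.cong)
  then show ?thesis
    unfolding ricci_quadratic_def sum_subtractf eq by (rule arg_cong)
qed

text \<open>\<open>D j k l l\<close> is the derivative of \<Gamma>_jk^l in direction l, and
  \<open>D l k l j\<close> that of \<Gamma>_lk^l in direction j. Summed over l, the latter is the
  derivative of the trace of the symbols.\<close>

lemma ricci_christoffel_field:
  assumes D: "\<And>j k l. j \<in> Basis \<Longrightarrow> k \<in> Basis \<Longrightarrow> l \<in> Basis \<Longrightarrow> (G j k l has_derivative D j k l) (at P)"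
    and jk: "j \<in> Basis" "k \<in> Basis"
  shows "ricci (curvature_at (connection_of (\<lambda>P. christoffel_field (\<lambda>j k l. G j k l P))) P) j k =
    (\<Sum>l\<in>Basis. D j k l l - D l k l j) + ricci_quadratic (\<lambda>j k l. G j k l P) j k"
proof -
  let ?\<Gamma> = "christoffel_field (\<lambda>j k l. G j k l P)"
  have "?\<Gamma> x (?\<Gamma> y z) \<bullet> l = (\<Sum>n\<in>Basis. G y z n P * G x n l P)"
    if "x \<in> Basis" "y \<in> Basis" "z \<in> Basis" "l \<in> Basis" for x y z l
  proof -
    have "?\<Gamma> x (?\<Gamma> y z) = (\<Sum>n\<in>Basis. (?\<Gamma> y z \<bullet> n) *\<^sub>R ?\<Gamma> x n)"
      by (rule linear_euclidean_sum) (use bilinear_christoffel_field in \<open>auto simp: bilinear_def\<close>)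
    then show ?thesis
      using that by (simp add: inner_sum_left christoffel_field_Basis)
  qed
  then show ?thesis
    unfolding ricci_def trace_endo_def ricci_quadratic_def sum.distrib[symmetric]
    using jk by (intro sum.cong refl)
      (simp add: curvature_at_christoffel_field[OF D] inner_diff_left inner_add_left christoffel_field_Basis sum_subtractf)
qed

lemma bilinear_ricciI:
  assumes "\<And>x z. linear (\<lambda>y. A x y z)" "\<And>x y. linear (A x y)"
  shows "bilinear (ricci A)"
  using assms unfolding bilinear_def ricci_def trace_endo_def linear_iff
  by (simp add: inner_add_left sum.distrib sum_distrib_left)

text \<open>The Ricci equation is solved for basis vectors; bilinearity extends it to all tangent
  vectors.\<close>

lemma bilinear_ricci_curvature_at:
  assumes D: "\<And>j k l. j \<in> Basis \<Longrightarrow> k \<in> Basis \<Longrightarrow> l \<in> Basis \<Longrightarrow> (G j k l has_derivative D j k l) (at P)"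
  shows "bilinear (ricci (curvature_at (connection_of (\<lambda>P. christoffel_field (\<lambda>j k l. G j k l P))) P))"
proof -
  have D_add: "D j k l (x + y) = D j k l x + D j k l y" and D_scale: "D j k l (a *\<^sub>R x) = a * D j k l x"
    if "j \<in> Basis" "k \<in> Basis" "l \<in> Basis" for j k l a x y
    using has_derivative_linear[OF D[OF that]] by (simp_all add: linear_add linear_scale)
  have lin_D: "linear (\<lambda>y. christoffel_field (\<lambda>j k l. D j k l y) u v)" for u v
    unfolding linear_iff christoffel_field_def
    by (simp add: D_add D_scale scaleR_sum_right sum.distrib[symmetric] algebra_simps)
  have lin1: "linear (\<lambda>y. christoffel_field H y z)" and lin2: "linear (christoffel_field H z)"
    for H and z :: 'a
    using bilinear_christoffel_field[of H] by (auto simp: bilinear_def)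
  let ?\<Gamma> = "christoffel_field (\<lambda>j k l. G j k l P)"
  have R: "curvature_at (connection_of (\<lambda>P. christoffel_field (\<lambda>j k l. G j k l P))) P =
    (\<lambda>x y z. christoffel_field (\<lambda>j k l. D j k l x) y z + ?\<Gamma> x (?\<Gamma> y z) -
      (christoffel_field (\<lambda>j k l. D j k l y) x z + ?\<Gamma> y (?\<Gamma> x z)))"
    by (intro ext curvature_at_christoffel_field D)
  show ?thesis
    unfolding R
    by (rule bilinear_ricciI; intro linear_compose_add linear_compose_sub lin_D lin1 lin2
        linear_compose[OF _ lin2, unfolded o_def])
qed

section \<open>The prescribed Ricci tensor\<close>

lemma bilinear_ricci:
  assumes "A \<in> alg_curvature_ops"
  shows "bilinear (ricci A)"
proof (rule bilinear_ricciI)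
  show "linear (\<lambda>y. A x y z)" "linear (A x y)" for x y z
    using assms unfolding alg_curvature_ops_def by blast+
qed

lemma bilinear_ricci_s:
  fixes A :: "'a::euclidean_space \<Rightarrow> 'a \<Rightarrow> 'a \<Rightarrow> 'a"
  assumes "bilinear (ricci A)"
  shows "bilinear (ricci_s A)"
proof -
  have "linear (\<lambda>x. ricci A x y)" "linear (\<lambda>y. ricci A x y)" for x y
    using assms by (simp_all add: bilinear_def)
  moreover have "linear (\<lambda>x. f x / 2)" if "linear f" for f :: "'a \<Rightarrow> real"
    using that by (simp add: linear_iff add_divide_distrib)
  ultimately show ?thesis
    unfolding bilinear_def ricci_s_def by (intro conjI allI) (blast intro: linear_compose_add)+
qed

lemma scalar_curv_eq_ricci:
  "scalar_curv A h = (\<Sum>i\<in>Basis. \<Sum>j\<in>Basis. inverse_gram h i j * ricci A i j)"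
  by (simp add: scalar_curv_def ricci_def trace_endo_def sum_distrib_left)

text \<open>With k the inverse of the symmetric h: k^T = (k h) k^T = k (k h)^T = k.\<close>

lemma inverse_gram_sym:
  assumes h: "inner_product_form h" and ij: "i \<in> Basis" "j \<in> Basis"
  shows "inverse_gram h i j = inverse_gram h j i"
proof -
  let ?k = "inverse_gram h"
  have inv: "(\<Sum>l\<in>Basis. h i l * ?k l j) = (if i = j then 1 else 0)"
    "(\<Sum>l\<in>Basis. ?k i l * h l j) = (if i = j then 1 else 0)" if "i \<in> Basis" "j \<in> Basis" for i j
    using is_inverse_gram_inverse_gram[OF h] that by (auto simp: is_inverse_gram_def)
  have sym: "h x y = h y x" for x y using h by (auto simp: inner_product_form_def)
  have "?k j i = (\<Sum>n\<in>Basis. (if i = n then 1 else 0) * ?k j n)"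
    using ij by (simp add: mult_delta_left)
  also have "\<dots> = (\<Sum>n\<in>Basis. (\<Sum>l\<in>Basis. ?k i l * h l n) * ?k j n)"
    using inv(2) ij by (intro sum.cong) auto
  also have "\<dots> = (\<Sum>l\<in>Basis. ?k i l * (\<Sum>n\<in>Basis. ?k j n * h n l))"
    by (simp add: sum_distrib_left sum_distrib_right sym[of _ _] mult_ac)
      (subst sum.swap, simp add: sym mult_ac)
  also have "\<dots> = (\<Sum>l\<in>Basis. ?k i l * (if j = l then 1 else 0))"
    using inv(2) ij by (intro sum.cong) auto
  also have "\<dots> = ?k i j" using ij by (simp add: mult_delta_right)
  finally show ?thesis by simp
qed

text \<open>The endomorphism in use is self-adjoint with respect to the metric at 0 only; at other
  points the form \<open>h (E x) y\<close> has to be symmetrized.\<close>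

definition sym_part :: "('a \<Rightarrow> 'a \<Rightarrow> real) \<Rightarrow> ('a \<Rightarrow> 'a) \<Rightarrow> 'a \<Rightarrow> 'a \<Rightarrow> real" where
  "sym_part h E x y = (h (E x) y + h x (E y)) / 2"

text \<open>
  If \<open>E\<close> is held fixed, the trace of the form \<open>sym_part h E\<close> with respect to \<open>h\<close> does not depend
  on \<open>h\<close>. This keeps the scalar curvature constant without dividing by the metric.
\<close>

lemma scalar_curv_sym_part:
  assumes h: "inner_product_form h" and a: "\<And>i j. a i j = - a j i"
    and R: "\<And>i j. i \<in> Basis \<Longrightarrow> j \<in> Basis \<Longrightarrow> ricci R i j = a i j + sym_part h E i j"
  shows "scalar_curv R h = trace_endo E"
proof -
  let ?k = "inverse_gram h"
  have bil: "bilinear h" using h by (simp add: inner_product_form_def)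
  have inv: "(\<Sum>l\<in>Basis. h i l * ?k l j) = (if i = j then 1 else 0)"
    "(\<Sum>l\<in>Basis. ?k i l * h l j) = (if i = j then 1 else 0)" if "i \<in> Basis" "j \<in> Basis" for i j
    using is_inverse_gram_inverse_gram[OF h] that by (auto simp: is_inverse_gram_def)
  have sym: "h x y = h y x" for x y using h by (auto simp: inner_product_form_def)
  \<comment> \<open>An antisymmetric form contracted with the symmetric inverse metric gives its own
    negative.\<close>
  have "(\<Sum>i\<in>Basis. \<Sum>j\<in>Basis. ?k i j * a i j) = (\<Sum>j\<in>Basis. \<Sum>i\<in>Basis. ?k i j * a i j)"
    by (rule sum.swap)
  also have "\<dots> = (\<Sum>j\<in>Basis. \<Sum>i\<in>Basis. - (?k j i * a j i))"
    using inverse_gram_sym[OF h] a by (intro sum.cong refl) (metis mult_minus_right)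
  finally have anti: "(\<Sum>i\<in>Basis. \<Sum>j\<in>Basis. ?k i j * a i j) = 0"
    by (simp add: sum_negf)
  have 1: "(\<Sum>i\<in>Basis. \<Sum>j\<in>Basis. ?k i j * h (E i) j) = trace_endo E"
  proof -
    have "(\<Sum>j\<in>Basis. ?k i j * h (E i) j) = E i \<bullet> i" if i: "i \<in> Basis" for i
    proof -
      have "(\<Sum>j\<in>Basis. ?k i j * h (E i) j) = (\<Sum>j\<in>Basis. \<Sum>l\<in>Basis. (E i \<bullet> l) * (?k i j * h j l))"
        by (subst bilinear_expand_left[OF bil]) (simp add: sum_distrib_left mult.left_commute sym)
      also have "\<dots> = (\<Sum>l\<in>Basis. (E i \<bullet> l) * (\<Sum>j\<in>Basis. ?k i j * h j l))"
        by (subst sum.swap) (simp add: sum_distrib_left)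
      also have "\<dots> = (\<Sum>l\<in>Basis. (E i \<bullet> l) * (if i = l then 1 else 0))"
        using inv(2) i by (intro sum.cong) auto
      finally show ?thesis using i by (simp add: mult_delta_right)
    qed
    then show ?thesis by (simp add: trace_endo_def)
  qed
  have "(\<Sum>i\<in>Basis. \<Sum>j\<in>Basis. ?k i j * h i (E j)) = (\<Sum>j\<in>Basis. \<Sum>i\<in>Basis. ?k i j * h i (E j))"
    by (rule sum.swap)
  also have "\<dots> = (\<Sum>j\<in>Basis. \<Sum>i\<in>Basis. ?k j i * h (E j) i)"
    using inverse_gram_sym[OF h] sym by (intro sum.cong refl) metis
  finally have 2: "(\<Sum>i\<in>Basis. \<Sum>j\<in>Basis. ?k i j * h i (E j)) = trace_endo E"
    using 1 by simp
  have "scalar_curv R h = (\<Sum>i\<in>Basis. \<Sum>j\<in>Basis.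
      ?k i j * a i j + (?k i j * h (E i) j + ?k i j * h i (E j)) / 2)"
    unfolding scalar_curv_eq_ricci by (intro sum.cong refl) (simp add: R sym_part_def algebra_simps)
  also have "\<dots> = 0 + (trace_endo E + trace_endo E) / 2"
    unfolding anti[symmetric] 1[symmetric] 2[symmetric]
    by (simp only: sum.distrib sum_divide_distrib[symmetric]) (simp add: 1 2)
  finally show ?thesis by simp
qed

text \<open>Raises the second index of \<open>\<sigma>\<close> with the inverse Gram matrix.\<close>

lemma linear_representing_endo:
  fixes h \<sigma> :: "'a::euclidean_space \<Rightarrow> 'a \<Rightarrow> real"
  assumes h: "inner_product_form h" and \<sigma>: "bilinear \<sigma>"
  obtains E where "linear E" "\<And>x y. h (E x) y = \<sigma> x y"
proof -
  let ?k = "inverse_gram h"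
  define E where "E x = (\<Sum>i\<in>Basis. \<Sum>j\<in>Basis. (\<sigma> x i * ?k i j) *\<^sub>R j)" for x
  have bil: "bilinear h" using h by (simp add: inner_product_form_def)
  have "linear E"
    unfolding linear_iff E_def using \<sigma>
    by (simp add: bilinear_ladd bilinear_lmul algebra_simps sum.distrib scaleR_sum_right)
  moreover have "h (E x) y = \<sigma> x y" for x y
  proof (rule bilinear_eq_Basis[of "\<lambda>x. h (E x)" \<sigma>])
    show "bilinear (\<lambda>x. h (E x))"
      using bil \<open>linear E\<close> by (simp add: bilinear_def linear_iff)
    fix x l :: 'a assume l: "l \<in> Basis"
    have "h (E x) l = (\<Sum>i\<in>Basis. \<Sum>j\<in>Basis. \<sigma> x i * ?k i j * h j l)"
    proof -
      have lin: "linear (\<lambda>x. h x l)" using bil by (simp add: bilinear_def)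
      show ?thesis unfolding E_def by (simp add: linear_sum[OF lin] linear_scale[OF lin])
    qed
    also have "\<dots> = (\<Sum>i\<in>Basis. \<sigma> x i * (\<Sum>j\<in>Basis. ?k i j * h j l))"
      by (simp add: sum_distrib_left mult.assoc)
    also have "\<dots> = (\<Sum>i\<in>Basis. \<sigma> x i * (if i = l then 1 else 0))"
      using is_inverse_gram_inverse_gram[OF h] l by (intro sum.cong) (auto simp: is_inverse_gram_def)
    also have "\<dots> = \<sigma> x l" using l by (simp add: mult_delta_right)
    finally show "h (E x) l = \<sigma> x l" .
  qed (rule \<sigma>)
  ultimately show ?thesis using that by blast
qed

section \<open>Solving the Ricci equation\<close>

context function_scale
begin

text \<open>Some scale is enough, since the scale is shrunk anyway: this is regularity of the germ
  at 0.\<close>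

definition admissible :: "('a \<Rightarrow> real) \<Rightarrow> bool" where
  "admissible f \<longleftrightarrow> (\<exists>p M. B p f M)"

lemma admissibleI: "B p f M \<Longrightarrow> admissible f"
  unfolding admissible_def by blast

lemma admissible_const: "admissible (\<lambda>_. a)"
  using const[of 1 a] admissibleI by auto

lemma admissible_common_scale:
  assumes "finite I" "\<And>i. i \<in> I \<Longrightarrow> admissible (F i)" "0 < q"
  obtains p where "0 < p" "p \<le> q" "\<And>i. i \<in> I \<Longrightarrow> \<exists>M. B p (F i) M"
proof -
  have "\<exists>p>0. p \<le> q \<and> (\<forall>i\<in>I. \<exists>M. B p (F i) M)"
    using assms
  proof (induction I)
    case empty
    then show ?case by auto
  next
    case (insert i I)
    then obtain p where p: "0 < p" "p \<le> q" "\<forall>i\<in>I. \<exists>M. B p (F i) M" by blast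
    obtain r M where r: "B r (F i) M" using insert.prems unfolding admissible_def by blast
    have "0 < min p r" using p(1) pos[OF r] by simp
    moreover have "\<exists>M. B (min p r) (F j) M" if "j \<in> insert i I" for j
    proof (cases "j = i")
      case True
      then show ?thesis using mono[OF r \<open>0 < min p r\<close>] by force
    next
      case False
      then obtain M' where "B p (F j) M'" using p(3) \<open>j \<in> insert i I\<close> by blast
      then show ?thesis using mono[OF _ \<open>0 < min p r\<close>] by force
    qed
    ultimately show ?case using p(2) by (intro exI[of _ "min p r"]) auto
  qed
  then show ?thesis using that by blast
qed

lemma admissible_add:
  assumes "admissible f" "admissible h"
  shows "admissible (\<lambda>x. f x + h x)"
proof -
  obtain p where "\<And>i. i \<in> {True, False} \<Longrightarrow> \<exists>M. B p (if i then f else h) M"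
    by (rule admissible_common_scale[of "{True, False}" "\<lambda>i. if i then f else h" 1])
      (use assms in auto)
  then obtain M N where "B p f M" "B p h N" by (metis insertCI)
  then show ?thesis using add admissibleI by blast
qed

lemma admissible_mult:
  assumes "admissible f" "admissible h"
  shows "admissible (\<lambda>x. f x * h x)"
proof -
  obtain p where "\<And>i. i \<in> {True, False} \<Longrightarrow> \<exists>M. B p (if i then f else h) M"
    by (rule admissible_common_scale[of "{True, False}" "\<lambda>i. if i then f else h" 1])
      (use assms in auto)
  then obtain M N where "B p f M" "B p h N" by (metis insertCI)
  then show ?thesis using mult admissibleI by blast
qed

lemma admissible_sum: "(\<And>i. i \<in> I \<Longrightarrow> admissible (F i)) \<Longrightarrow> admissible (\<lambda>x. \<Sum>i\<in>I. F i x)"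
  by (induction I rule: infinite_finite_induct) (auto intro: admissible_const admissible_add)

text \<open>Coordinates come for free in every function scale, as antiderivatives of the constant
  1.\<close>

lemma admissible_coordinate: "b \<in> Basis \<Longrightarrow> admissible (\<lambda>x. x \<bullet> b)"
  using antideriv[OF const[of 1 1], of b] admissibleI by (auto simp: antideriv_const[abs_def])

lemma admissible_linear:
  assumes "linear f"
  shows "admissible f"
proof -
  have "f = (\<lambda>x. \<Sum>b\<in>Basis. (x \<bullet> b) * f b)"
    by (rule ext) (rule linear_euclidean_sum[OF assms, unfolded real_scaleR_def])
  moreover have "admissible (\<lambda>x. \<Sum>b\<in>Basis. (x \<bullet> b) * f b)"
    by (intro admissible_sum admissible_mult admissible_coordinate admissible_const)
  ultimately show ?thesis by simp
qed

lemma lipschitz_op_admissible: "admissible f \<Longrightarrow> lipschitz_op I (\<lambda>w. f)"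
  unfolding admissible_def using lipschitz_op_const by blast

end

text \<open>Gives all but one of the first derivatives of each correction at 0, so that the
  curvature there is not disturbed.\<close>

lemma derivative_along_zero_set:
  fixes w :: "'a::euclidean_space \<Rightarrow> real"
  assumes W: "(w has_derivative W) (at 0)" and "0 < q"
    and w: "\<And>x. x \<in> cube q \<Longrightarrow> x \<bullet> i = 0 \<Longrightarrow> w x = 0" and b: "b \<bullet> i = 0"
  shows "W b = 0"
proof -
  have "((\<lambda>t. w (t *\<^sub>R b)) has_derivative (\<lambda>t. W (t *\<^sub>R b))) (at 0)"
    by (rule has_derivative_compose[where f = "\<lambda>t. t *\<^sub>R b" and g = w])
      (use W in \<open>auto intro!: derivative_eq_intros\<close>)
  moreover have "\<forall>\<^sub>F t in nhds 0. t *\<^sub>R b \<in> cube q"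
  proof -
    have "((\<lambda>t. t *\<^sub>R b) \<longlongrightarrow> 0 *\<^sub>R b) (nhds 0)"
      by (intro tendsto_scaleR tendsto_const) (simp add: filterlim_ident)
    from topological_tendstoD[OF this open_cube] show ?thesis using \<open>0 < q\<close> by simp
  qed
  then obtain T where T: "open T" "0 \<in> T" "\<And>t. t \<in> T \<Longrightarrow> t *\<^sub>R b \<in> cube q"
    unfolding eventually_nhds by blast
  have "((\<lambda>t. 0) has_derivative (\<lambda>t. W (t *\<^sub>R b))) (at 0)"
    by (rule has_derivative_transform_within_open[OF calculation T(1,2)]) (use T(3) w b in simp)
  then have "(\<lambda>t. W (t *\<^sub>R b)) = (\<lambda>t. 0)"
    using has_derivative_const has_derivative_unique by blast
  from fun_cong[OF this, of 1] show ?thesis by simp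
qed

text \<open>Curvature needs no more than one derivative of the symbols. The factor 1/4 in
  \<open>C_1\<close> comes from power series, where the C^1 estimate is proved on a smaller
  cube.\<close>

locale regular_function_scale = function_scale B C \<kappa>
  for B :: "real \<Rightarrow> ('a::euclidean_space \<Rightarrow> real) \<Rightarrow> real \<Rightarrow> bool" and C \<kappa> :: real +
  fixes reg :: "'a set \<Rightarrow> ('a \<Rightarrow> real) \<Rightarrow> bool"
  assumes reg: "B p f M \<Longrightarrow> reg (cube p) f"
    and C_1: "B p f M \<Longrightarrow> C_k_on 1 (cube (p / 4)) f"
begin

text \<open>The compatibility condition \<open>S_0\<close> says that the linear symbols already
  solve the Ricci equation at 0; it makes the correction vanish there together with its first
  derivatives.\<close>

theorem curvature_with_prescribed_ricci:
  fixes A :: "'a \<Rightarrow> 'a \<Rightarrow> 'a \<Rightarrow> 'a" and S :: "'a \<Rightarrow> 'a \<Rightarrow> 'a \<Rightarrow> real"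
  assumes dim: "DIM('a) \<ge> 3" and A: "A \<in> alg_curvature_ops"
    and S: "\<And>j k. j \<in> Basis \<Longrightarrow> k \<in> Basis \<Longrightarrow> admissible (S j k)"
    and S_sym: "\<And>j k. S j k = S k j" and S_0: "\<And>j k. S j k 0 = ricci_s A j k"
  obtains p G where "0 < p"
    "\<And>j k l. j \<in> Basis \<Longrightarrow> k \<in> Basis \<Longrightarrow> l \<in> Basis \<Longrightarrow> \<exists>M. B p (G j k l) M"
    "\<And>j k l. G j k l = G k j l"
    "curvature_at (connection_of (\<lambda>P. christoffel_field (\<lambda>j k l. G j k l P))) 0 = A"
    "\<And>P. P \<in> cube (p / 4) \<Longrightarrow>
       bilinear (ricci (curvature_at (connection_of (\<lambda>P. christoffel_field (\<lambda>j k l. G j k l P))) P))"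
    "\<And>P j k. P \<in> cube (p / 4) \<Longrightarrow> j \<in> Basis \<Longrightarrow> k \<in> Basis \<Longrightarrow>
       ricci (curvature_at (connection_of (\<lambda>P. christoffel_field (\<lambda>j k l. G j k l P))) P) j k =
       ricci_a A j k + S j k P"
proof -
  have A_lin: "linear (\<lambda>x. A x y z)" "linear (\<lambda>y. A x y z)" "linear (A x y)"
    and A_anti: "A x y z = - A y x z" and A_cyc: "A x y z + A y z x + A z x y = 0" for x y z
    using A unfolding alg_curvature_ops_def by blast+
  \<comment> \<open>The factor 1/3 is the one for which \<open>h x y z - h y x z = A x y z\<close>:
    by antisymmetry and the Bianchi identity the difference without the factor is
    \<open>3 *\<^sub>R A x y z\<close>.\<close>
  define h where "h x y z = (1 / 3) *\<^sub>R (A x y z + A x z y)" for x y z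
  have lin_h: "linear (\<lambda>x. h x y z)" and bil_h: "bilinear (h x)" for x y z
    using A_lin unfolding h_def bilinear_def
    by (auto intro!: linear_compose_scale_right linear_compose_add)
  define c where "c j k l P = h P j k \<bullet> l" for j k l P
  have lin_c: "linear (c j k l)" for j k l
    using lin_h[of j k] by (simp add: c_def linear_iff inner_add_left)
  have c_sym: "c j k l = c k j l" for j k l by (simp add: c_def[abs_def] h_def add.commute)
  text \<open>This is where dimension at least 3 is needed: an index different from both \<open>j\<close> and \<open>k\<close>
    keeps the correction out of the traces of the Christoffel symbols.\<close>
  define \<iota> where "\<iota> j k = (SOME l. l \<in> Basis - {j, k})" for j k :: 'a
  have \<iota>: "\<iota> j k \<in> Basis" "\<iota> j k \<noteq> j" "\<iota> j k \<noteq> k" for j k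
  proof -
    have "card {j, k} < card (Basis :: 'a set)" using dim card_insert_le_m1[of 2 "{k}" j] by simp
    then have "\<not> Basis \<subseteq> {j, k}" using card_mono[of "{j, k}" "Basis :: 'a set"] by auto
    then have "\<exists>l. l \<in> Basis - {j, k}" by blast
    then have "\<iota> j k \<in> Basis - {j, k}" unfolding \<iota>_def by (rule someI_ex)
    then show "\<iota> j k \<in> Basis" "\<iota> j k \<noteq> j" "\<iota> j k \<noteq> k" by auto
  qed
  have \<iota>_sym: "\<iota> j k = \<iota> k j" for j k by (simp add: \<iota>_def insert_commute)
  \<comment> \<open>Averaging over \<open>(j, k)\<close> and \<open>(k, j)\<close> makes the symbols
    symmetric for every \<open>w\<close>, before anything is known about the solution.\<close>
  define G where "G w j k l x = c j k l x + (if l = \<iota> j k then 1 / 2 * (w (j, k) x + w (k, j) x) else 0)"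
    for w :: "'a \<times> 'a \<Rightarrow> 'a \<Rightarrow> real" and j k l x
  have G_sym: "G w j k l = G w k j l" for w j k l
    unfolding G_def[abs_def] c_sym[of j k] \<iota>_sym[of j k] add.commute[of "w (k, j) _"] by simp
  define Q where "Q w j k x = ricci_quadratic (\<lambda>j k l. G w j k l x) j k" for w j k x
  \<comment> \<open>The linear symbols contribute the whole of \<open>ricci A\<close> through their
    derivatives, so only \<open>S\<close> minus \<open>ricci_s A\<close> and the quadratic term
    remain for the correction. The signs are written as sums and products to fit the closure rules
    of \<open>lipschitz_op\<close>.\<close>
  define \<Phi> where "\<Phi> \<beta> w x = (S (fst \<beta>) (snd \<beta>) x + - ricci_s A (fst \<beta>) (snd \<beta>)) + (- 1) * Q w (fst \<beta>) (snd \<beta>) x"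
    for \<beta> w x
  define I where "I = (Basis \<times> Basis :: ('a \<times> 'a) set)"
  have "finite I" by (simp add: I_def)
  have lip_G: "lipschitz_op I (\<lambda>w. G w j k l)" if "j \<in> Basis" "k \<in> Basis" for j k l
  proof (cases "l = \<iota> j k")
    case True
    then have "(\<lambda>w. G w j k l) = (\<lambda>w x. c j k l x + 1 / 2 * (w (j, k) x + w (k, j) x))"
      by (simp add: G_def fun_eq_iff)
    then show ?thesis
      using that by (auto simp only: I_def intro!: lipschitz_op_add lipschitz_op_mult lipschitz_op_proj
          lipschitz_op_admissible admissible_linear lin_c admissible_const)
  next
    case False
    then have "(\<lambda>w. G w j k l) = (\<lambda>w. c j k l)" by (simp add: G_def fun_eq_iff)
    then show ?thesis using lipschitz_op_admissible[OF admissible_linear[OF lin_c]] by simp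
  qed
  have lip: "lipschitz_op I (\<Phi> \<beta>)" if "\<beta> \<in> I" for \<beta>
  proof -
    have 1: "lipschitz_op I (\<lambda>w x. \<Sum>l\<in>Basis. \<Sum>n\<in>Basis.
        G w (fst \<beta>) (snd \<beta>) n x * G w l n l x + (- 1) * (G w l (snd \<beta>) n x * G w (fst \<beta>) n l x))"
      using that unfolding I_def
      by (intro lipschitz_op_sum lipschitz_op_add lipschitz_op_mult lip_G[unfolded I_def]
          lipschitz_op_admissible admissible_const) auto
    show ?thesis
      unfolding \<Phi>_def[abs_def] Q_def ricci_quadratic_def
      using that 1 S unfolding I_def
      by (intro lipschitz_op_add[OF lipschitz_op_admissible] lipschitz_op_mult
          lipschitz_op_admissible admissible_add admissible_const) auto
  qed
  obtain q w where q: "0 < q" "q \<le> 1" and w_B: "\<And>\<beta>. \<beta> \<in> I \<Longrightarrow> B q (w \<beta>) 1"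
    and w_eq: "\<And>\<beta> x. \<beta> \<in> I \<Longrightarrow> x \<in> cube q \<Longrightarrow> w \<beta> x = antideriv (\<iota> (fst \<beta>) (snd \<beta>)) (\<Phi> \<beta> w) x"
    and \<Phi>_B: "\<And>\<beta>. \<beta> \<in> I \<Longrightarrow> \<exists>M. B q (\<Phi> \<beta> w) M"
    by (rule integral_system_solvable[of I "\<lambda>\<beta>. \<iota> (fst \<beta>) (snd \<beta>)" \<Phi> 1])
      (use \<open>finite I\<close> \<iota> lip in auto)
  have Q_sym: "Q w j k x = Q w k j x" if "j \<in> Basis" "k \<in> Basis" for j k x
    unfolding Q_def using that by (intro ricci_quadratic_sym) (simp add: G_sym)
  \<comment> \<open>No uniqueness is invoked: \<open>\<Phi>\<close> sees \<open>w\<close> only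
    through the averaged \<open>G\<close>, so the equations for \<open>(j, k)\<close> and
    \<open>(k, j)\<close> have the same right-hand side and the same direction of
    integration.\<close>
  have w_sym: "w (j, k) x = w (k, j) x" if "j \<in> Basis" "k \<in> Basis" "x \<in> cube q" for j k x
  proof -
    have "\<Phi> (j, k) w = \<Phi> (k, j) w"
      using Q_sym[OF that(1,2)] S_sym[of j k] by (simp add: \<Phi>_def fun_eq_iff ricci_s_def add.commute)
    then show ?thesis using w_eq[of "(j, k)" x] w_eq[of "(k, j)" x] that \<iota>_sym[of j k] by (simp add: I_def)
  qed
  have w_0: "w \<beta> x = 0" if "\<beta> \<in> I" "x \<in> cube q" "x \<bullet> \<iota> (fst \<beta>) (snd \<beta>) = 0" for \<beta> x
    using w_eq[OF that(1,2)] antideriv_eq_0[OF that(3)] by simp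
  define W where "W \<beta> P = frechet_derivative (w \<beta>) (at P)" for \<beta> P
  have W: "(w \<beta> has_derivative W \<beta> P) (at P)" if "\<beta> \<in> I" "P \<in> cube (q / 4)" for \<beta> P
    using C_1[OF w_B[OF that(1)]] that(2) by (simp add: W_def frechet_derivative_works)
  have sub: "cube (q / 4) \<subseteq> cube q" using q by (intro cube_mono) simp
  have W_\<iota>: "W (j, k) P (\<iota> j k) = \<Phi> (j, k) w P" if "j \<in> Basis" "k \<in> Basis" "P \<in> cube (q / 4)" for j k P
  proof -
    have jk: "(j, k) \<in> I" using that by (simp add: I_def)
    obtain M where M: "B q (\<Phi> (j, k) w) M" using \<Phi>_B[OF jk] by blast
    show ?thesis
      by (rule derivative_eq_along_antideriv[OF W[OF jk that(3)] _ cont[OF M]])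
        (use w_eq[OF jk] that(3) sub \<iota> in auto)
  qed
  \<comment> \<open>By \<open>w_sym\<close> the average in \<open>G\<close> is just
    \<open>w (j, k)\<close> on the cube, so one derivative \<open>W (j, k)\<close> suffices.\<close>
  define D where "D P j k l v = c j k l v + (if l = \<iota> j k then W (j, k) P v else 0)" for P j k l v
  have D: "(G w j k l has_derivative D P j k l) (at P)"
    if "j \<in> Basis" "k \<in> Basis" "l \<in> Basis" "P \<in> cube (q / 4)" for P j k l
  proof -
    have "((\<lambda>x. c j k l x + (if l = \<iota> j k then w (j, k) x else 0)) has_derivative D P j k l) (at P)"
    proof (cases "l = \<iota> j k")
      case True
      then show ?thesis
        unfolding D_def[abs_def] using that W[of "(j, k)" P] lin_c[of j k l]
        by (auto simp: I_def intro!: has_derivative_add linear_imp_has_derivative)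
    next
      case False
      then show ?thesis
        unfolding D_def[abs_def] using lin_c[of j k l] by (simp add: linear_imp_has_derivative)
    qed
    then show ?thesis
      by (rule has_derivative_transform_within_open[OF _ open_cube that(4)])
        (use w_sym[OF that(1,2)] sub in \<open>auto simp: G_def\<close>)
  qed
  let ?R = "curvature_at (connection_of (\<lambda>P. christoffel_field (\<lambda>j k l. G w j k l P)))"
  have ricci_R: "ricci (?R P) j k = ricci_a A j k + S j k P"
    if "P \<in> cube (q / 4)" "j \<in> Basis" "k \<in> Basis" for P j k
  proof -
    have "ricci (?R P) j k = (\<Sum>l\<in>Basis. D P j k l l - D P l k l j) + Q w j k P"
      unfolding Q_def using that by (intro ricci_christoffel_field D) auto
    also have "(\<Sum>l\<in>Basis. D P j k l l - D P l k l j) =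
        (\<Sum>l\<in>Basis. A l j k \<bullet> l + (if l = \<iota> j k then \<Phi> (j, k) w P else 0))"
    proof (rule sum.cong)
      fix l :: 'a assume l: "l \<in> Basis"
      have "h l j k - h j l k = A l j k"
      proof -
        have "A l k j = A l j k + A j k l" using A_cyc[of l j k] A_anti[of k l j] by (simp add: algebra_simps)
        then show ?thesis using A_anti[of j l k]
          by (simp add: h_def algebra_simps flip: scaleR_add_left)
      qed
      then have "c j k l l - c l k l j = A l j k \<bullet> l"
        by (simp add: c_def flip: inner_diff_left)
      \<comment> \<open>Here the trace of the correction drops out: \<Gamma>_lk^l contains no
        \<open>w\<close>, for every \<open>l\<close>.\<close>
      moreover have "l \<noteq> \<iota> l k" using \<iota>(2)[of l k] by simp
      ultimately show "D P j k l l - D P l k l j = A l j k \<bullet> l + (if l = \<iota> j k then \<Phi> (j, k) w P else 0)"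
        using W_\<iota>[OF that(2,3,1)] unfolding D_def by auto
    qed simp
    also have "\<dots> = ricci A j k + \<Phi> (j, k) w P"
      using \<iota>(1)[of j k] by (simp add: sum.distrib ricci_def trace_endo_def)
    finally show ?thesis
      by (simp add: \<Phi>_def ricci_a_def ricci_s_def field_simps)
  qed
  have bil_R: "bilinear (ricci (?R P))" if "P \<in> cube (q / 4)" for P
    by (rule bilinear_ricci_curvature_at[OF D[OF _ _ _ that]])
  have q4: "0 \<in> cube (q / 4)" using q by simp
  have G_0: "G w j k l 0 = 0" if "j \<in> Basis" "k \<in> Basis" for j k l
    using w_0[of "(j, k)" 0] w_0[of "(k, j)" 0] that q(1) linear_0[OF lin_c[of j k l]]
    by (simp add: G_def I_def)
  \<comment> \<open>Along \<open>\<iota> j k\<close> the derivative is the right-hand side at 0,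
    where \<open>Q\<close> vanishes with \<open>G\<close> and the rest cancels by
    \<open>S_0\<close>. The other basis directions lie in the hyperplane on which \<open>w\<close>
    is 0.\<close>
  have W_0: "W (j, k) 0 v = 0" if "j \<in> Basis" "k \<in> Basis" for j k v
  proof -
    have jk: "(j, k) \<in> I" using that by (simp add: I_def)
    have "Q w j k 0 = 0"
      unfolding Q_def ricci_quadratic_def using that G_0 by simp
    then have "W (j, k) 0 (\<iota> j k) = 0"
      using W_\<iota>[OF that q4] S_0[of j k] by (simp add: \<Phi>_def)
    moreover have "W (j, k) 0 b = 0" if "b \<in> Basis" "b \<noteq> \<iota> j k" for b
      by (rule derivative_along_zero_set[OF W[OF jk q4] q(1)])
        (use w_0[OF jk] that \<iota>(1) in \<open>auto simp: inner_Basis\<close>)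
    ultimately have "W (j, k) 0 b = 0" if "b \<in> Basis" for b using that by blast
    then show ?thesis
      using linear_euclidean_sum[OF has_derivative_linear[OF W[OF jk q4]], of v] by simp
  qed
  have R_0: "?R 0 = A"
  proof (intro ext)
    fix x y z
    have G_0': "christoffel_field (\<lambda>j k l. G w j k l 0) u v = 0" for u v
      by (simp add: christoffel_field_def G_0)
    have D_0: "christoffel_field (\<lambda>j k l. D 0 j k l u) v t = h u v t" for u v t
      by (rule christoffel_field_eqI[OF bil_h]) (simp add: D_def W_0 c_def)
    have "?R 0 x y z = h x y z - h y x z"
      by (subst curvature_at_christoffel_field[OF D[OF _ _ _ q4]]) (simp_all add: G_0' D_0)
    also have "\<dots> = A x y z"
    proof -
      have "A x z y = A x y z + A y z x" using A_cyc[of x y z] A_anti[of z x y] by (simp add: algebra_simps)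
      then show ?thesis using A_anti[of y x z]
        by (simp add: h_def algebra_simps flip: scaleR_add_left)
    qed
    finally show "?R 0 x y z = A x y z" .
  qed
  have G_adm: "admissible (G w j k l)" if "j \<in> Basis" "k \<in> Basis" for j k l
  proof -
    have w: "admissible (w (j, k))" "admissible (w (k, j))"
      using that admissibleI[OF w_B] by (simp_all add: I_def)
    show ?thesis
    proof (cases "l = \<iota> j k")
      case True
      then have "G w j k l = (\<lambda>x. c j k l x + 1 / 2 * (w (j, k) x + w (k, j) x))"
        by (simp add: G_def fun_eq_iff)
      then show ?thesis
        by (simp only:) (intro admissible_add admissible_mult admissible_const
            admissible_linear[OF lin_c] w)
    next
      case False
      then have "G w j k l = c j k l" by (simp add: G_def fun_eq_iff)
      then show ?thesis using admissible_linear[OF lin_c] by simp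
    qed
  qed
  \<comment> \<open>Admissibility yields a bound at some scale only, so the final \<open>p\<close>
    may have to be smaller than \<open>q\<close>.\<close>
  obtain p where p: "0 < p" "p \<le> q"
    "\<And>i. i \<in> Basis \<times> Basis \<times> Basis \<Longrightarrow> \<exists>M. B p (case i of (j, k, l) \<Rightarrow> G w j k l) M"
    by (rule admissible_common_scale[of "Basis \<times> Basis \<times> Basis" "\<lambda>(j, k, l). G w j k l" q])
      (use G_adm q in auto)
  have sub': "cube (p / 4) \<subseteq> cube (q / 4)" using p by (intro cube_mono) simp
  show ?thesis
  proof (rule that[of p "G w"])
    show "\<exists>M. B p (G w j k l) M" if "j \<in> Basis" "k \<in> Basis" "l \<in> Basis" for j k l
      using p(3)[of "(j, k, l)"] that by simp
  qed (use p(1) G_sym R_0 bil_R ricci_R sub' in blast)+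
qed

text \<open>The three Ricci conditions are read off from the two parts of the new Ricci tensor: the
  antisymmetric part is that of \<open>A\<close> at every point, and the symmetric part is
  determined by \<open>E\<close> and the metric, with \<open>E = 0\<close> in the antisymmetric and
  \<open>E\<close> a multiple of the identity in the traceless case.\<close>

theorem geometric_realization:
  fixes A :: "'a \<Rightarrow> 'a \<Rightarrow> 'a \<Rightarrow> 'a" and g :: "'a \<Rightarrow> 'a \<Rightarrow> 'a \<Rightarrow> real"
  assumes dim: "DIM('a) \<ge> 3" and A: "A \<in> alg_curvature_ops"
    and g: "\<And>P. inner_product_form (g P)"
    and g_adm: "\<And>i j. i \<in> Basis \<Longrightarrow> j \<in> Basis \<Longrightarrow> admissible (\<lambda>P. g P i j)"
  shows "\<exists>U nabla. open U \<and> 0 \<in> U \<and>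
           connection_on U nabla \<and> torsion_free_on U nabla \<and> regular_connection_on reg U nabla \<and>
           curvature_at nabla 0 = A \<and>
           (\<exists>c. \<forall>P\<in>U. scalar_curv (curvature_at nabla P) (g P) = c) \<and>
           (ricci_symmetric A \<longrightarrow> (\<forall>P\<in>U. ricci_symmetric (curvature_at nabla P))) \<and>
           (ricci_antisymmetric A \<longrightarrow> (\<forall>P\<in>U. ricci_antisymmetric (curvature_at nabla P))) \<and>
           (ricci_traceless A (g 0) \<longrightarrow> (\<forall>P\<in>U. ricci_traceless (curvature_at nabla P) (g P)))"
proof -
  have g_bil: "bilinear (g P)" and g_sym: "g P x y = g P y x"
    and g_nondeg: "(\<And>y. g P x y = 0) \<Longrightarrow> x = 0" for P x y
    using g[of P] by (auto simp: inner_product_form_def)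
  have bil_A: "bilinear (ricci A)" by (rule bilinear_ricci[OF A])
  obtain E where E_lin: "linear E" and E: "\<And>x y. g 0 (E x) y = ricci_s A x y"
    using linear_representing_endo[OF g bilinear_ricci_s[OF bil_A]] by metis
  have ricci_s_sym: "ricci_s A x y = ricci_s A y x" for x y by (simp add: ricci_s_def add.commute)
  have sym_part_sym: "sym_part (g P) E x y = sym_part (g P) E y x" for P x y
    using g_sym[of P "E x" y] g_sym[of P x "E y"] by (simp add: sym_part_def)
  obtain p G where p: "0 < p"
    and G_B: "\<And>j k l. j \<in> Basis \<Longrightarrow> k \<in> Basis \<Longrightarrow> l \<in> Basis \<Longrightarrow> \<exists>M. B p (G j k l) M"
    and G_sym: "\<And>j k l. G j k l = G k j l"
    and R_0: "curvature_at (connection_of (\<lambda>P. christoffel_field (\<lambda>j k l. G j k l P))) 0 = A"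
    and R_bil: "\<And>P. P \<in> cube (p / 4) \<Longrightarrow>
       bilinear (ricci (curvature_at (connection_of (\<lambda>P. christoffel_field (\<lambda>j k l. G j k l P))) P))"
    and R: "\<And>P j k. P \<in> cube (p / 4) \<Longrightarrow> j \<in> Basis \<Longrightarrow> k \<in> Basis \<Longrightarrow>
       ricci (curvature_at (connection_of (\<lambda>P. christoffel_field (\<lambda>j k l. G j k l P))) P) j k =
       ricci_a A j k + sym_part (g P) E j k"
  proof (rule curvature_with_prescribed_ricci[OF dim A, of "\<lambda>j k P. sym_part (g P) E j k"])
    show "admissible (\<lambda>P. sym_part (g P) E j k)" if "j \<in> Basis" "k \<in> Basis" for j k
    proof -
      \<comment> \<open>The entries are combinations of the metric entries with constant
        coefficients, so they have exactly the regularity of the metric.\<close>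
      have "(\<lambda>P. sym_part (g P) E j k) = (\<lambda>P. 1 / 2 *
          ((\<Sum>b\<in>Basis. (E j \<bullet> b) * g P b k) + (\<Sum>b\<in>Basis. (E k \<bullet> b) * g P j b)))"
      proof
        fix P
        show "sym_part (g P) E j k =
            1 / 2 * ((\<Sum>b\<in>Basis. (E j \<bullet> b) * g P b k) + (\<Sum>b\<in>Basis. (E k \<bullet> b) * g P j b))"
          using bilinear_expand_left[OF g_bil, of P "E j" k] bilinear_expand_right[OF g_bil, of P j "E k"]
          by (simp add: sym_part_def)
      qed
      then show ?thesis
        using that
        by (auto simp only: intro!: admissible_mult admissible_add admissible_sum admissible_const g_adm)
    qed
    show "(\<lambda>P. sym_part (g P) E j k) = (\<lambda>P. sym_part (g P) E k j)" for j k
      by (simp add: sym_part_sym[of _ j k])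
    show "sym_part (g 0) E j k = ricci_s A j k" for j k
      using g_sym[of 0 j "E k"] E ricci_s_sym[of k j] by (simp add: sym_part_def)
  qed blast
  define \<Gamma> where "\<Gamma> P = christoffel_field (\<lambda>j k l. G j k l P)" for P
  let ?R = "curvature_at (connection_of \<Gamma>)"
  note R_0 = R_0[folded \<Gamma>_def] and R_bil = R_bil[folded \<Gamma>_def] and R = R[folded \<Gamma>_def]
  have lin: "linear (\<lambda>x. ricci A x y)" "linear (\<lambda>y. ricci A x y)"
    "linear (\<lambda>x. g P x y)" "linear (\<lambda>y. g P x y)"
    "linear (\<lambda>x. g P (E x) y)" "linear (\<lambda>y. g P x (E y))" for P x y
    using bil_A g_bil[of P] linear_compose[OF E_lin, unfolded o_def] unfolding bilinear_def by blast+
  have half: "linear (\<lambda>x. f x / 2)" if "linear f" for f :: "'a \<Rightarrow> real"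
    using that by (simp add: linear_iff add_divide_distrib)
  have bil_target: "bilinear (\<lambda>x y. ricci_a A x y + sym_part (g P) E x y)" for P
    unfolding bilinear_def ricci_a_def sym_part_def
    by (intro conjI allI linear_compose_add half linear_compose_sub lin)
  have R_eq: "ricci (?R P) x y = ricci_a A x y + sym_part (g P) E x y" if "P \<in> cube (p / 4)" for P x y
    by (rule bilinear_eq_Basis[OF R_bil[OF that] bil_target R[OF that]])
  have R_s: "ricci_s (?R P) x y = sym_part (g P) E x y" if "P \<in> cube (p / 4)" for P x y
    using R_eq[OF that, of x y] R_eq[OF that, of y x] sym_part_sym[of P x y]
    by (simp add: ricci_s_def[of "?R P"] ricci_a_def field_simps)
  have R_a: "ricci_a (?R P) x y = ricci_a A x y" if "P \<in> cube (p / 4)" for P x y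
    using R_eq[OF that, of x y] R_eq[OF that, of y x] sym_part_sym[of P x y]
    by (simp add: ricci_a_def[of "?R P"]) (simp add: ricci_a_def field_simps)
  have scalar: "scalar_curv (?R P) (g P) = trace_endo E" if "P \<in> cube (p / 4)" for P
    by (rule scalar_curv_sym_part[OF g, of "ricci_a A"])
      (use R_eq[OF that] in \<open>auto simp: ricci_a_def field_simps\<close>)
  \<comment> \<open>Nondegeneracy at 0 recovers \<open>E\<close> from the form that it represents.
    The case \<open>t = 0\<close> serves Ricci antisymmetric operators.\<close>
  have E_eq: "E x = t *\<^sub>R x" if "\<And>x y. ricci_s A x y = t * g 0 x y" for t x
  proof -
    have "g 0 (E x - t *\<^sub>R x) y = 0" for y
      using E[of x y] that[of x y] by (simp add: bilinear_lsub[OF g_bil] bilinear_lmul[OF g_bil])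
    then show ?thesis using g_nondeg[of 0 "E x - t *\<^sub>R x"] by simp
  qed
  have sym_part_scaled: "sym_part (g P) E x y = t * g P x y" if "\<And>x. E x = t *\<^sub>R x" for P t x y
    by (simp add: sym_part_def that bilinear_lmul[OF g_bil] bilinear_rmul[OF g_bil])
  have bil_\<Gamma>: "bilinear (\<Gamma> P)" for P by (simp add: \<Gamma>_def bilinear_christoffel_field)
  have sym_\<Gamma>: "\<Gamma> P x y = \<Gamma> P y x" for P x y
    unfolding \<Gamma>_def by (rule christoffel_field_sym) (simp add: G_sym)
  show ?thesis
  proof (intro exI[of _ "cube (p / 4)"] exI[of _ "connection_of \<Gamma>"] conjI impI ballI)
    show "connection_on (cube (p / 4)) (connection_of \<Gamma>)"
      using bil_\<Gamma> by (rule connection_on_connection_of)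
    show "torsion_free_on (cube (p / 4)) (connection_of \<Gamma>)"
      using sym_\<Gamma> by (rule torsion_free_on_connection_of)
    show "regular_connection_on reg (cube (p / 4)) (connection_of \<Gamma>)"
      unfolding regular_connection_on_def
    proof (intro ballI)
      fix i j k :: 'a assume ijk: "i \<in> Basis" "j \<in> Basis" "k \<in> Basis"
      then obtain M where "B p (G i j k) M" using G_B by blast
      then have "B (p / 4) (G i j k) M" using mono p by fastforce
      moreover have "christoffel (connection_of \<Gamma>) i j k = G i j k"
        using ijk by (simp add: fun_eq_iff christoffel_connection_of \<Gamma>_def christoffel_field_Basis)
      ultimately show "reg (cube (p / 4)) (christoffel (connection_of \<Gamma>) i j k)"
        using reg by simp
    qed
    show "ricci_symmetric (?R P)" if "ricci_symmetric A" "P \<in> cube (p / 4)" for P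
      using that R_a by (simp add: ricci_symmetric_def)
    show "ricci_antisymmetric (?R P)" if "ricci_antisymmetric A" "P \<in> cube (p / 4)" for P
      using R_s[OF that(2)] sym_part_scaled[OF E_eq[of 0]] that(1) by (simp add: ricci_antisymmetric_def)
    show "ricci_traceless (?R P) (g P)" if traceless: "ricci_traceless A (g 0)" and P: "P \<in> cube (p / 4)" for P
    proof -
      \<comment> \<open>The factor is fixed by the data at 0; since the scalar curvature is the
        trace of \<open>E\<close>, it equals \<open>t\<close> times the dimension at every point,
        which is what the trace-free condition there requires.\<close>
      define t where "t = scalar_curv A (g 0) / real DIM('a)"
      have E_t: "E x = t *\<^sub>R x" for x
        using traceless by (intro E_eq) (simp add: ricci_traceless_def ricci_0_def t_def)
      then have "trace_endo E = real DIM('a) * t" by (simp add: trace_endo_def)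
      then show ?thesis
        using scalar[OF P] R_s[OF P] sym_part_scaled[OF E_t] by (simp add: ricci_traceless_def ricci_0_def)
    qed
  qed (use p R_0 scalar in auto)
qed

end

theorem theorem1p3:
  fixes g :: "'a::euclidean_space \<Rightarrow> 'a \<Rightarrow> 'a \<Rightarrow> real"
    and A :: "'a \<Rightarrow> 'a \<Rightarrow> 'a \<Rightarrow> 'a"
    and s :: nat
    and reg :: "'a set \<Rightarrow> ('a \<Rightarrow> real) \<Rightarrow> bool"
  assumes "DIM('a) \<ge> 3"
    and "s \<ge> 1"
    and "reg = C_k_on s \<or> reg = real_analytic_on"
    and "pseudo_riemannian_metric reg g"
    and "A \<in> alg_curvature_ops"
  shows "\<exists>U nabla. open U \<and> 0 \<in> U \<and>
           connection_on U nabla \<and> torsion_free_on U nabla \<and> regular_connection_on reg U nabla \<and>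
           curvature_at nabla 0 = A \<and>
           (\<exists>c. \<forall>P\<in>U. scalar_curv (curvature_at nabla P) (g P) = c) \<and>
           (ricci_symmetric A \<longrightarrow> (\<forall>P\<in>U. ricci_symmetric (curvature_at nabla P))) \<and>
           (ricci_antisymmetric A \<longrightarrow> (\<forall>P\<in>U. ricci_antisymmetric (curvature_at nabla P))) \<and>
           (ricci_traceless A (g 0) \<longrightarrow> (\<forall>P\<in>U. ricci_traceless (curvature_at nabla P) (g P)))"
proof -
  have g: "inner_product_form (g P)" for P
    using assms(4) by (simp add: pseudo_riemannian_metric_def)
  have reg_g: "reg UNIV (\<lambda>P. g P i j)" if "i \<in> Basis" "j \<in> Basis" for i j
    using assms(4) that by (simp add: pseudo_riemannian_metric_def)
  from assms(3) show ?thesis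
  proof
    assume reg_eq: "reg = C_k_on s"
    let ?B = "\<lambda>p f M. 0 < p \<and> ck_bound s p f M"
    interpret function_scale ?B "2 ^ s" "real (Suc s)" by (rule function_scale_ck)
    interpret regular_function_scale ?B "2 ^ s" "real (Suc s)" reg
    proof
      fix p M and f :: "'a \<Rightarrow> real" assume f: "0 < p \<and> ck_bound s p f M"
      then show "reg (cube p) f" using ck_bound_imp_C_k_on by (auto simp: reg_eq)
      \<comment> \<open>The assumption \<open>s \<ge> 1\<close> is used to lower the order to 1; the
        shrinking to \<open>p / 4\<close> only meets the common form of \<open>C_1\<close>.\<close>
      have "ck_bound s (p / 4) f M" using f ck_bound_mono[of s p f M "p / 4" M] by simp
      then have "ck_bound 1 (p / 4) f M" using f ck_bound_le_order[of "p / 4" s f M 1] assms(2) by simp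
      then show "C_k_on 1 (cube (p / 4)) f" using f by (intro ck_bound_imp_C_k_on[of "p / 4"]) auto
    qed
    have "admissible (\<lambda>P. g P i j)" if ij: "i \<in> Basis" "j \<in> Basis" for i j
    proof -
      obtain M where "ck_bound s 1 (\<lambda>P. g P i j) M"
        using C_k_on_imp_ck_bound reg_g[OF ij] unfolding reg_eq by blast
      then show ?thesis using admissibleI[of 1] by simp
    qed
    then show ?thesis by (rule geometric_realization[OF assms(1,5) g])
  next
    assume reg_eq: "reg = real_analytic_on"
    interpret function_scale "ps_bound (0 :: 'a)" 1 1 by (rule function_scale_ps)
    interpret regular_function_scale "ps_bound (0 :: 'a)" 1 1 reg
      by unfold_locales (simp_all add: reg_eq ps_bound_imp_real_analytic_on ps_bound_imp_C_1_on del: One_nat_def)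
    have "admissible (\<lambda>P. g P i j)" if "i \<in> Basis" "j \<in> Basis" for i j
      using real_analytic_on_imp_ps_bound reg_g[OF that] admissibleI unfolding reg_eq by blast
    then show ?thesis by (rule geometric_realization[OF assms(1,5) g])
  qed
qed

end
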